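(* Let $b$ be any polynomial. There is a deterministic algorithm which, given a directed multigraph on $n$ vertices with at most $2^{b(n)}$ arcs, computes the number of its Hamiltonian cycles in time $2^{\,n-\Omega(\sqrt{n/\log n})}$.
   Context: A Hamiltonian cycle in a directed multigraph is a directed cycle visiting every vertex exactly once; in a multigraph, cycles using different parallel arcs are counted as different, so the number of Hamiltonian cycles equals $\sum_{\sigma}\prod_{i=1}^n m(i,\sigma(i))$, where $\sigma$ ranges over the permutations of the vertex set $\{1,\dots,n\}$ consisting of exactly one cycle and $m(u,v)$ is the number of arcs from $u$ to $v$. *)

theory Defs
  imports
    Complex_Main
    "HOL-Computational_Algebra.Polynomial"
    "HOL-Library.Log_Nat"
    "HOL-Library.FuncSet"
    "HOL-Combinatorics.Orbits"
    "Graph_Theory.Arc_Walk"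
begin

section \<open>Hamiltonian cycles in directed multigraphs\<close>

text \<open>
  A directed multigraph is a \<^locale>\<open>fin_digraph\<close>: arcs are objects of their own, and
  parallel arcs and loops are allowed.  \<^const>\<open>pre_digraph.cycle\<close> is a nonempty closed arc
  walk whose tails are pairwise distinct.  Such a list has a distinguished starting arc, so the
  \<open>n\<close> rotations of a list are one and the same cycle; a cycle is therefore counted
  through its set of arcs, which determines the list up to rotation and distinguishes parallel
  arcs.
\<close>

definition hamiltonian :: "('a, 'b) pre_digraph \<Rightarrow> 'b list \<Rightarrow> bool" where
  "hamiltonian G p \<longleftrightarrow> pre_digraph.cycle G p \<and> tail G ` set p = verts G"

definition hamiltonian_cycles :: "('a, 'b) pre_digraph \<Rightarrow> 'b set set" where
  "hamiltonian_cycles G = {set p | p. hamiltonian G p}"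

definition num_hamiltonian_cycles :: "('a, 'b) pre_digraph \<Rightarrow> nat" where
  "num_hamiltonian_cycles G = card (hamiltonian_cycles G)"

definition arcs_from_to :: "('a, 'b) pre_digraph \<Rightarrow> 'a \<Rightarrow> 'a \<Rightarrow> 'b set" where
  "arcs_from_to G u v = {e \<in> arcs G. tail G e = u \<and> head G e = v}"

definition multiplicity_of :: "('a, 'b) pre_digraph \<Rightarrow> 'a \<Rightarrow> 'a \<Rightarrow> nat" where
  "multiplicity_of G u v = card (arcs_from_to G u v)"

text \<open>The familiar formula over permutations consisting of exactly one cycle.\<close>

lemma hamiltonian_cycles_eq:
  assumes "fin_digraph G"
  shows "hamiltonian_cycles G = (\<lambda>(\<sigma>, f). f ` verts G) `
    (SIGMA \<sigma>:{\<sigma>. \<sigma> permutes verts G \<and> cyclic_on \<sigma> (verts G)}.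
       PiE (verts G) (\<lambda>v. arcs_from_to G v (\<sigma> v)))" (is "?H = ?m ` ?S")
proof
  interpret fin_digraph G by fact
  show "?m ` ?S \<subseteq> ?H"
  proof clarify
    fix \<sigma> f
    assume perm: "\<sigma> permutes verts G" and cyc: "cyclic_on \<sigma> (verts G)"
      and f: "f \<in> (\<Pi>\<^sub>E v\<in>verts G. arcs_from_to G v (\<sigma> v))"
    have f': "f v \<in> arcs G" "tail G (f v) = v" "head G (f v) = \<sigma> v" if "v \<in> verts G" for v
      using f that by (auto simp: PiE_iff arcs_from_to_def)
    obtain s where s: "s \<in> verts G" and orb: "verts G = orbit \<sigma> s"
      using cyc by (auto simp: cyclic_on_def)
    define n where "n = funpow_dist1 \<sigma> s s"
    have so: "s \<in> orbit \<sigma> s" using s orb by simp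
    have inV: "(\<sigma> ^^ k) s \<in> verts G" for k
      using s perm by (induction k) (auto simp: permutes_in_image)
    have n0: "n > 0" by (simp add: n_def)
    have ns: "(\<sigma> ^^ n) s = s" unfolding n_def by (rule funpow_dist1_prop[OF so])
    have im: "verts G = (\<lambda>k. (\<sigma> ^^ k) s) ` {0..<n}"
      unfolding n_def orb by (rule orbit_conv_funpow_dist1[OF so])
    have inj: "inj_on (\<lambda>k. (\<sigma> ^^ k) s) {0..<n}"
      unfolding n_def by (rule inj_on_funpow_dist1[OF so])
    define p where "p = map (\<lambda>k. f ((\<sigma> ^^ k) s)) [0..<n]"
    have "cas s (map (\<lambda>k. f ((\<sigma> ^^ k) s)) [0..<j]) ((\<sigma> ^^ j) s)" for j
    proof (induction j)
      case (Suc j)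
      then show ?case using f'[OF inV[of j]] by (auto simp: awlast_if_cas)
    qed simp
    from this[of n] have cas: "cas s p s" by (simp add: p_def ns)
    have set_p: "set p = f ` verts G" unfolding im p_def by (auto simp: image_image)
    have ne: "p \<noteq> []" using n0 by (simp add: p_def)
    have "map (head G) p = map \<sigma> (map (\<lambda>k. (\<sigma> ^^ k) s) [0..<n])"
      using f' inV by (simp add: p_def)
    also have "distinct \<dots>"
      using inj permutes_inj[OF perm]
      by (subst distinct_map) (auto simp: distinct_map intro: inj_on_subset)
    finally have "distinct (tl (awalk_verts s p))"
      using ne by (simp add: awalk_verts_conv'[OF cas])
    moreover have "awalk s p s" using s cas set_p f' by (auto simp: awalk_def)
    ultimately have "cycle p" using ne by (auto simp: cycle_def)
    moreover have "tail G ` set p = verts G"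
      using f' by (force simp: set_p image_image)
    ultimately show "f ` verts G \<in> hamiltonian_cycles G"
      unfolding hamiltonian_cycles_def hamiltonian_def using set_p by blast
  qed
  show "?H \<subseteq> ?m ` ?S"
  proof
    fix C assume "C \<in> ?H"
    then obtain p u where C: "C = set p" and tails: "tail G ` set p = verts G"
      and w: "awalk u p u" and d: "distinct (tl (awalk_verts u p))" and ne: "p \<noteq> []"
      by (auto simp: hamiltonian_cycles_def hamiltonian_def cycle_def)
    have cas: "cas u p u" and arcs: "set p \<subseteq> arcs G" and u: "u \<in> verts G"
      using w by (auto simp: awalk_def)
    have dh: "distinct (map (head G) p)"
      using d ne by (simp add: awalk_verts_conv'[OF cas])
    have "awlast u p = u" using cas by (rule awlast_if_cas)
    then have hl: "head G (last p) = u" using ne by (simp add: awalk_verts_conv)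
    have tu: "tail G (hd p) = u" using cas ne by (cases p) auto
    have eq: "map (tail G) p @ [u] = u # map (head G) p"
      using awalk_verts_conv[of u p] awalk_verts_conv'[OF cas] ne hl tu by simp
    have ms: "mset (map (tail G) p) = mset (map (head G) p)"
      using arg_cong[OF eq, of mset] by simp
    have dt: "distinct (map (tail G) p)"
      using dh mset_eq_imp_distinct_iff[OF ms] by simp
    have heads: "head G ` set p = verts G"
      using mset_eq_setD[OF ms] tails by simp
    have it: "inj_on (tail G) (set p)" and ih: "inj_on (head G) (set p)"
      using dt dh by (auto simp: distinct_map)
    define g where "g = the_inv_into (set p) (tail G)"
    have gt: "g (tail G e) = e" if "e \<in> set p" for e
      unfolding g_def using it that by (rule the_inv_into_f_f)
    have bg: "bij_betw g (verts G) (set p)"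
      unfolding g_def using it tails by (intro bij_betw_the_inv_into) (auto simp: bij_betw_def)
    have bh: "bij_betw (head G) (set p) (verts G)"
      using ih heads by (auto simp: bij_betw_def)
    define \<sigma> where "\<sigma> v = (if v \<in> verts G then head G (g v) else v)" for v
    have "bij_betw \<sigma> (verts G) (verts G)"
      using bij_betw_trans[OF bg bh] by (rule bij_betw_cong[THEN iffD1, rotated]) (simp add: \<sigma>_def)
    then have perm: "\<sigma> permutes verts G"
      by (rule bij_imp_permutes) (simp add: \<sigma>_def)
    have step: "\<sigma> (tail G e) = head G e" if "e \<in> set p" for e
      using that tails gt by (auto simp: \<sigma>_def)
    have pow: "tail G (p ! i) = (\<sigma> ^^ i) u" if "i < length p" for i
      using that
    proof (induction i)
      case 0
      then show ?case using tu ne by (simp add: hd_conv_nth)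
    next
      case (Suc i)
      have "tail G (p ! Suc i) = (map (tail G) p @ [u]) ! Suc i"
        using Suc.prems by (simp add: nth_append)
      also have "\<dots> = head G (p ! i)" using Suc.prems unfolding eq by simp
      also have "\<dots> = \<sigma> (tail G (p ! i))" using Suc.prems by (simp add: step)
      finally show ?case using Suc by simp
    qed
    have "verts G \<subseteq> orbit \<sigma> u"
    proof
      fix v assume "v \<in> verts G"
      then obtain e where "e \<in> set p" "v = head G e" using heads by blast
      then obtain i where i: "i < length p" "v = head G (p ! i)" by (metis in_set_conv_nth)
      then have "v = (\<sigma> ^^ Suc i) u" using step[of "p ! i"] pow[of i] by simp
      then show "v \<in> orbit \<sigma> u" unfolding orbit_altdef by blast
    qed
    moreover have "orbit \<sigma> u \<subseteq> verts G"
      using permutes_orbit_subset[OF perm u] .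
    ultimately have cyc: "cyclic_on \<sigma> (verts G)"
      using u by (auto simp: cyclic_on_def)
    have "restrict g (verts G) \<in> (\<Pi>\<^sub>E v\<in>verts G. arcs_from_to G v (\<sigma> v))"
    proof (rule restrict_PiE_iff[THEN iffD2], rule ballI)
      fix v assume v: "v \<in> verts G"
      then obtain e where e: "e \<in> set p" "v = tail G e" using tails by auto
      then show "g v \<in> arcs_from_to G v (\<sigma> v)"
        using arcs step gt by (auto simp: arcs_from_to_def)
    qed
    moreover have "restrict g (verts G) ` verts G = C"
      using bg C by (auto simp: bij_betw_def)
    ultimately show "C \<in> ?m ` ?S"
      using perm cyc by (intro image_eqI[where x = "(\<sigma>, restrict g (verts G))"]) auto
  qed
qed

lemma num_hamiltonian_cycles_eq:
  assumes "fin_digraph G"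
  shows "num_hamiltonian_cycles G =
    (\<Sum>\<sigma> | \<sigma> permutes verts G \<and> cyclic_on \<sigma> (verts G).
       \<Prod>v\<in>verts G. multiplicity_of G v (\<sigma> v))"
proof -
  interpret fin_digraph G by fact
  let ?P = "{\<sigma>. \<sigma> permutes verts G \<and> cyclic_on \<sigma> (verts G)}"
  let ?F = "\<lambda>\<sigma>. PiE (verts G) (\<lambda>v. arcs_from_to G v (\<sigma> v))"
  have inj: "inj_on (\<lambda>(\<sigma>, f). f ` verts G) (Sigma ?P ?F)"
  proof (rule inj_onI, clarify)
    fix \<sigma> f \<tau> g
    assume perm: "\<sigma> permutes verts G" "\<tau> permutes verts G"
      and fg: "f \<in> ?F \<sigma>" "g \<in> ?F \<tau>" and eq: "f ` verts G = g ` verts G"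
    have f: "tail G (f v) = v" "head G (f v) = \<sigma> v" if "v \<in> verts G" for v
      using fg that by (auto simp: PiE_iff arcs_from_to_def)
    have g: "tail G (g v) = v" "head G (g v) = \<tau> v" if "v \<in> verts G" for v
      using fg that by (auto simp: PiE_iff arcs_from_to_def)
    have fgv: "f v = g v" if v: "v \<in> verts G" for v
    proof -
      obtain w where "w \<in> verts G" "f v = g w" using eq v by blast
      then show ?thesis using f(1)[OF v] g(1)[of w] by simp
    qed
    have "f v = g v" for v
      using fgv PiE_arb[OF fg(1)] PiE_arb[OF fg(2)] by (cases "v \<in> verts G") auto
    then have "f = g" by auto
    moreover have "\<sigma> v = \<tau> v" for v
    proof (cases "v \<in> verts G")
      case True
      then show ?thesis using f(2) g(2) fgv by metis
    next
      case False
      then show ?thesis using perm by (simp add: permutes_def)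
    qed
    ultimately show "\<sigma> = \<tau> \<and> f = g" by auto
  qed
  have fin: "finite ?P"
    using finite_permutations[OF finite_verts] by (rule rev_finite_subset) auto
  have finF: "finite (?F \<sigma>)" for \<sigma>
    by (intro finite_PiE) (auto simp: arcs_from_to_def)
  have "num_hamiltonian_cycles G = card (Sigma ?P ?F)"
    unfolding num_hamiltonian_cycles_def hamiltonian_cycles_eq[OF assms]
    by (rule card_image[OF inj])
  also have "\<dots> = (\<Sum>\<sigma>\<in>?P. card (?F \<sigma>))"
    using fin finF by (intro card_SigmaI) auto
  finally show ?thesis by (simp add: card_PiE multiplicity_of_def)
qed


section \<open>Random access machines with logarithmic cost\<close>

text \<open>
  The machine has registers, addressed by constants of the program, and an unbounded random
  access memory; every cell holds a natural number.  Programs are finite and built from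
  assignments by sequencing, branching and looping, which agrees with a jump-based
  instruction set up to a constant factor in running time.

  Since cells are unbounded, arithmetic must not be charged at unit cost.  Every evaluation
  of an expression node is charged the binary length of the value it produces, so that each
  operation pays for its operands (including addresses) and for its result.
\<close>

record state =
  reg :: "nat \<Rightarrow> nat"
  mem :: "nat \<Rightarrow> nat"

datatype expr =
    Lit nat
  | Reg nat
  | Mem expr
  | Add expr expr
  | Sub expr expr
  | Mul expr expr
  | Div expr expr

datatype prog =
    Skip
  | Assign nat expr
  | Store expr expr
  | Seq prog prog
  | Cond expr prog prog
  | While expr prog

definition len :: "nat \<Rightarrow> nat" where
  "len k = max 1 (floorlog 2 k)"

text \<open>Subtraction is truncated at 0, and division by 0 yields 0.\<close>

fun val :: "expr \<Rightarrow> state \<Rightarrow> nat" where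
  "val (Lit k) s = k"
| "val (Reg r) s = reg s r"
| "val (Mem a) s = mem s (val a s)"
| "val (Add a b) s = val a s + val b s"
| "val (Sub a b) s = val a s - val b s"
| "val (Mul a b) s = val a s * val b s"
| "val (Div a b) s = val a s div val b s"

fun cost :: "expr \<Rightarrow> state \<Rightarrow> nat" where
  "cost (Lit k) s = len k"
| "cost (Reg r) s = len (reg s r)"
| "cost (Mem a) s = cost a s + len (val (Mem a) s)"
| "cost (Add a b) s = cost a s + cost b s + len (val (Add a b) s)"
| "cost (Sub a b) s = cost a s + cost b s + len (val (Sub a b) s)"
| "cost (Mul a b) s = cost a s + cost b s + len (val (Mul a b) s)"
| "cost (Div a b) s = cost a s + cost b s + len (val (Div a b) s)"

text \<open>
  \<open>exec P s t s'\<close>: started in state \<open>s\<close>, the program \<open>P\<close> halts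
  in state \<open>s'\<close> after time \<open>t\<close>.  A guard holds iff its value is nonzero.
\<close>

inductive exec :: "prog \<Rightarrow> state \<Rightarrow> nat \<Rightarrow> state \<Rightarrow> bool" where
  Skip: "exec Skip s 1 s"
| Assign: "exec (Assign r a) s (cost a s + 1) (s\<lparr>reg := (reg s)(r := val a s)\<rparr>)"
| Store: "exec (Store a b) s (cost a s + cost b s + 1)
            (s\<lparr>mem := (mem s)(val a s := val b s)\<rparr>)"
| Seq: "exec P s t s' \<Longrightarrow> exec Q s' t' s'' \<Longrightarrow> exec (Seq P Q) s (t + t') s''"
| CondTrue: "val a s \<noteq> 0 \<Longrightarrow> exec P s t s' \<Longrightarrow> exec (Cond a P Q) s (cost a s + 1 + t) s'"
| CondFalse: "val a s = 0 \<Longrightarrow> exec Q s t s' \<Longrightarrow> exec (Cond a P Q) s (cost a s + 1 + t) s'"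
| WhileFalse: "val a s = 0 \<Longrightarrow> exec (While a P) s (cost a s + 1) s"
| WhileTrue: "val a s \<noteq> 0 \<Longrightarrow> exec P s t s' \<Longrightarrow> exec (While a P) s' t' s'' \<Longrightarrow>
    exec (While a P) s (cost a s + 1 + t + t') s''"

text \<open>Programs are deterministic: time and final state are determined by the initial state.\<close>

lemma exec_deterministic:
  "exec P s t s' \<Longrightarrow> exec P s u s'' \<Longrightarrow> t = u \<and> s' = s''"
proof (induction arbitrary: u s'' rule: exec.induct)
  case (Skip s)
  then show ?case by (auto elim: exec.cases)
next
  case (Assign r a s)
  then show ?case by (auto elim: exec.cases)
next
  case (Store a b s)
  then show ?case by (auto elim: exec.cases)
next
  case (Seq P s t s1 Q t' s2)
  from Seq.prems obtain v v' s3 where "exec P s v s3" "exec Q s3 v' s''" "u = v + v'"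
    by (auto elim: exec.cases)
  with Seq.IH show ?case by metis
next
  case (CondTrue a s P t s1 Q)
  from CondTrue.prems CondTrue.hyps obtain v where "exec P s v s''" "u = cost a s + 1 + v"
    by (auto elim: exec.cases)
  with CondTrue.IH show ?case by metis
next
  case (CondFalse a s Q t s1 P)
  from CondFalse.prems CondFalse.hyps obtain v where "exec Q s v s''" "u = cost a s + 1 + v"
    by (auto elim: exec.cases)
  with CondFalse.IH show ?case by metis
next
  case (WhileFalse a s P)
  then show ?case by (auto elim: exec.cases)
next
  case (WhileTrue a s P t s1 t' s2)
  from WhileTrue.prems WhileTrue.hyps obtain v v' s3
    where "exec P s v s3" "exec (While a P) s3 v' s''" "u = cost a s + 1 + v + v'"
    by (auto elim: exec.cases)
  with WhileTrue.IH show ?case by metis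
qed

text \<open>
  A multigraph with vertex set \<open>{1..n}\<close> is presented by \<open>n\<close> in register 0 and
  its multiplicity matrix, row by row, in the memory cells \<open>0, \<dots>, n\<^sup>2 - 1\<close>.
  (Listing the arcs one by one would not do, as there may be exponentially many.)
\<close>

definition input_state :: "nat \<Rightarrow> (nat, 'b) pre_digraph \<Rightarrow> state" where
  "input_state n G =
     \<lparr>reg = (\<lambda>r. if r = 0 then n else 0),
      mem = (\<lambda>k. if k < n * n then multiplicity_of G (k div n + 1) (k mod n + 1) else 0)\<rparr>"

definition result :: "state \<Rightarrow> nat" where
  "result s = reg s 0"

end

theory Submission
  imports
    Defs
    "HOL-Combinatorics.Multiset_Permutations"
    "HOL-Combinatorics.Cycles"
    "HOL-Library.Nat_Bijection"
    "HOL-Real_Asymp.Real_Asymp"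
begin

text \<open>
  Fix a set \<open>K\<close> of \<open>k\<close> vertices, with \<open>k\<close> of order \<open>\<surd>(n / log n)\<close>.  By inclusion and exclusion over
  the subsets \<open>X\<close> of the other \<open>n - k\<close> vertices, the Hamiltonian cycles are counted by the
  closed walks of length \<open>n\<close> through \<open>K \<union> X\<close> that visit every vertex of \<open>K\<close> exactly once.  Cutting such a
  walk at its visits to \<open>K\<close>, their number is the coefficient of \<open>z\<^sup>n\<close> in the Hamiltonian cycle
  polynomial of a \<open>k \<times> k\<close> matrix of walk generating functions.  Substituting a large integer for \<open>z\<close> makes
  this one instance of the same problem with \<open>k\<close> vertices and numbers of polynomially many bits; reducing
  it modulo polynomially many polynomially small moduli, every residue is found in a table of all
  \<open>k \<times> k\<close> matrices with small entries.  The table has \<open>2\<^bsup>O(k^2 log n)\<^esup>\<close> entries, which is at most about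
  \<open>2\<^bsup>n/2\<^esup>\<close>, so the \<open>2\<^bsup>n-k\<^esup>\<close> subsets \<open>X\<close> dominate.
\<close>

section \<open>The counting identity: inclusion-exclusion and walk generating functions\<close>

subsection \<open>Weighted Hamiltonian cycles\<close>

text \<open>The saving of order sqrt(n / log n) is what a table affords: with entries below N, a
  polynomial in n, it has N^(k^2) = 2^(O(k^2 log n)) entries, and k is the largest value, if there
  is one, that keeps the exponent at most n/2. The numbers that arise have polynomially many bits,
  too large to index a table, hence the reduction modulo small numbers. The moduli are all of 1,
  ..., N instead of primes: no prime has to be found, and lcm(1, ..., 2m+1) >= 4^m, which has an
  elementary proof, shows that they determine the value. As the moduli are not coprime, remaindering
  is a search in steps of the current lcm. One program serves both levels: with a single vertex in K
  it is plain inclusion and exclusion, which fills the table; with k vertices and the table it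
  solves the instance. The machine has only naturals, so terms of either sign are summed apart. All
  polynomial factors are absorbed by a power of N, paid for with half of the saving.\<close>

fun wt :: "(nat \<Rightarrow> nat \<Rightarrow> 'a::comm_semiring_1) \<Rightarrow> nat \<Rightarrow> nat list \<Rightarrow> nat \<Rightarrow> 'a" where
  "wt M u [] t = M u t"
| "wt M u (v # w) t = M u v * wt M v w t"

definition hc_from :: "(nat \<Rightarrow> nat \<Rightarrow> 'a::comm_semiring_1) \<Rightarrow> nat set \<Rightarrow> nat \<Rightarrow> 'a" where
  "hc_from M S u = (\<Sum>w\<in>permutations_of_set S. wt M u w 0)"

text \<open>Every cycle is listed from vertex 0, so that it is counted once and not once per
  rotation. Weights lie in an arbitrary commutative semiring because both numbers and polynomials
  are substituted. For n = 0 the value is \<open>M 0 0\<close>, not 0, so the empty graph is treated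
  apart.\<close>

definition hc :: "(nat \<Rightarrow> nat \<Rightarrow> 'a::comm_semiring_1) \<Rightarrow> nat \<Rightarrow> 'a" where
  "hc M n = hc_from M {1..<n} 0"

lemma hc_from_empty [simp]: "hc_from M {} u = M u 0"
  by (simp add: hc_from_def)

lemma hc_from_rec:
  assumes "finite S" "S \<noteq> {}"
  shows "hc_from M S u = (\<Sum>v\<in>S. M u v * hc_from M (S - {v}) v)"
proof -
  have "hc_from M S u = (\<Sum>w\<in>(\<Union>v\<in>S. (#) v ` permutations_of_set (S - {v})). wt M u w 0)"
    unfolding hc_from_def by (subst permutations_of_set_nonempty[OF assms(2)]) simp
  also have "\<dots> = (\<Sum>v\<in>S. \<Sum>w\<in>(#) v ` permutations_of_set (S - {v}). wt M u w 0)"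
    by (rule sum.UNION_disjoint) (use assms in auto)
  also have "\<dots> = (\<Sum>v\<in>S. M u v * hc_from M (S - {v}) v)"
    unfolding hc_from_def
    by (intro sum.cong refl) (subst sum.reindex, auto simp: sum_distrib_left inj_on_def)
  finally show ?thesis .
qed

lemma wt_cong:
  assumes "\<And>x y. x \<in> insert u (set w) \<Longrightarrow> y \<in> insert t (set w) \<Longrightarrow> M x y = M' x y"
  shows "wt M u w t = wt M' u w t"
  using assms
proof (induction w arbitrary: u)
  case (Cons v w)
  have "wt M v w t = wt M' v w t" by (rule Cons.IH) (use Cons.prems in auto)
  then show ?case using Cons.prems by simp
qed simp

lemma hc_cong:
  assumes "0 < n" "\<And>u v. u < n \<Longrightarrow> v < n \<Longrightarrow> M u v = M' u v"
  shows "hc M n = hc M' n"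
  unfolding hc_def hc_from_def
  by (intro sum.cong refl wt_cong assms) (use assms(1) in \<open>auto dest: permutations_of_setD\<close>)

lemma poly_wt: "poly (wt M u w t) x = wt (\<lambda>u v. poly (M u v) x) u w t"
  by (induction w arbitrary: u) auto

lemma poly_hc: "poly (hc M n) x = hc (\<lambda>u v. poly (M u v) x) n"
  by (simp add: hc_def hc_from_def poly_sum poly_wt)

lemma wt_le:
  fixes M :: "nat \<Rightarrow> nat \<Rightarrow> nat"
  assumes "\<And>x y. x \<in> insert u (set w) \<Longrightarrow> y \<in> insert t (set w) \<Longrightarrow> M x y \<le> q"
  shows "wt M u w t \<le> q ^ Suc (length w)"
  using assms by (induction w arbitrary: u) (auto intro: mult_le_mono)

lemma hc_le:
  fixes M :: "nat \<Rightarrow> nat \<Rightarrow> nat"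
  assumes "0 < n" "\<And>u v. u < n \<Longrightarrow> v < n \<Longrightarrow> M u v \<le> q"
  shows "hc M n \<le> n ^ n * q ^ n"
proof -
  have "hc M n \<le> (\<Sum>w\<in>permutations_of_set {1..<n}. q ^ n)"
    unfolding hc_def hc_from_def
  proof (rule sum_mono)
    fix w assume w: "w \<in> permutations_of_set {1..<n}"
    have "wt M 0 w 0 \<le> q ^ Suc (length w)"
      by (rule wt_le) (use assms w in \<open>auto dest: permutations_of_setD\<close>)
    also have "Suc (length w) = n"
      using assms(1) length_finite_permutations_of_set[OF w] by simp
    finally show "wt M 0 w 0 \<le> q ^ n" .
  qed
  also have "\<dots> = fact (n - 1) * q ^ n" by simp
  also have "fact (n - 1) \<le> (n ^ n :: nat)"
  proof -
    have "fact (n - 1) \<le> (fact n :: nat)" by (rule fact_mono) simp_all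
    also have "\<dots> \<le> n ^ n" using fact_le_power[of n, where 'a=nat] by simp
    finally show ?thesis .
  qed
  finally show ?thesis by simp
qed

subsection \<open>Closed walks\<close>

definition walk_lists :: "nat set \<Rightarrow> nat set \<Rightarrow> nat \<Rightarrow> nat list set" where
  "walk_lists X S l = {w. length w = l \<and> set w \<subseteq> X \<union> S \<and> (\<forall>s\<in>S. count_list w s = 1)}"

text \<open>The index \<open>l\<close> counts the vertices strictly between \<open>u\<close> and the
  final 0, so these walks have l + 1 arcs.\<close>

definition walks :: "(nat \<Rightarrow> nat \<Rightarrow> 'a::comm_semiring_1) \<Rightarrow> nat set \<Rightarrow> nat set \<Rightarrow> nat \<Rightarrow> nat \<Rightarrow> 'a" where
  "walks A X S u l = (\<Sum>w\<in>walk_lists X S l. wt A u w 0)"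

lemma finite_walk_lists: "finite X \<Longrightarrow> finite S \<Longrightarrow> finite (walk_lists X S l)"
  by (rule finite_subset[OF _ finite_lists_length_eq[of "X \<union> S" l]]) (auto simp: walk_lists_def)

lemma walks_0: "walks A X S u 0 = (if S = {} then A u 0 else 0)"
proof -
  have "walk_lists X S 0 = (if S = {} then {[]} else {})" by (auto simp: walk_lists_def)
  then show ?thesis by (simp add: walks_def)
qed

text \<open>Classified by the first vertex: one in X leaves the obligation S unchanged, one in S
  discharges part of it.\<close>

lemma walk_lists_Suc:
  assumes "X \<inter> S = {}"
  shows "walk_lists X S (Suc l) =
    (\<Union>x\<in>X. (#) x ` walk_lists X S l) \<union> (\<Union>v\<in>S. (#) v ` walk_lists X (S - {v}) l)"
    (is "?L = ?R")
proof
  show "?L \<subseteq> ?R"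
  proof
    fix w assume w: "w \<in> ?L"
    then obtain v w' where [simp]: "w = v # w'" by (cases w) (auto simp: walk_lists_def)
    have w': "length w' = l" "set w' \<subseteq> X \<union> S" "v \<in> X \<union> S" "\<forall>s\<in>S. count_list (v # w') s = 1"
      using w by (auto simp: walk_lists_def)
    show "w \<in> ?R"
    proof (cases "v \<in> X")
      case True
      then have "w' \<in> walk_lists X S l"
        using w' assms by (auto simp: walk_lists_def split: if_splits)
      then show ?thesis using True by auto
    next
      case False
      then have v: "v \<in> S" using w' by auto
      then have "count_list w' v = 0" using w' by auto
      then have "v \<notin> set w'" by (simp add: count_list_0_iff)
      then have "w' \<in> walk_lists X (S - {v}) l"
        using w' v by (auto simp: walk_lists_def split: if_splits)
      then show ?thesis using v by auto
    qed
  qed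
  show "?R \<subseteq> ?L"
  proof
    fix w assume "w \<in> ?R"
    then consider x w' where "x \<in> X" "w = x # w'" "w' \<in> walk_lists X S l"
      | v w' where "v \<in> S" "w = v # w'" "w' \<in> walk_lists X (S - {v}) l" by auto
    then show "w \<in> ?L"
    proof cases
      case 1
      then show ?thesis using assms by (auto simp: walk_lists_def)
    next
      case 2
      then have "v \<notin> set w'" using assms by (auto simp: walk_lists_def)
      then show ?thesis using 2 by (auto simp: walk_lists_def count_list_0_iff)
    qed
  qed
qed

lemma walks_Suc:
  assumes "X \<inter> S = {}" "finite X" "finite S"
  shows "walks A X S u (Suc l) =
    (\<Sum>x\<in>X. A u x * walks A X S x l) + (\<Sum>v\<in>S. A u v * walks A X (S - {v}) v l)"
proof -
  note fin = finite_walk_lists[OF assms(2) assms(3)] finite_walk_lists[OF assms(2) finite_Diff[OF assms(3)]]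
  have "walks A X S u (Suc l) =
    (\<Sum>w\<in>(\<Union>x\<in>X. (#) x ` walk_lists X S l). wt A u w 0) +
    (\<Sum>w\<in>(\<Union>v\<in>S. (#) v ` walk_lists X (S - {v}) l). wt A u w 0)"
    unfolding walks_def walk_lists_Suc[OF assms(1)]
    by (rule sum.union_disjoint) (use assms fin in auto)
  also have "(\<Sum>w\<in>(\<Union>x\<in>X. (#) x ` walk_lists X S l). wt A u w 0) =
      (\<Sum>x\<in>X. \<Sum>w\<in>(#) x ` walk_lists X S l. wt A u w 0)"
    by (rule sum.UNION_disjoint) (use assms fin in auto)
  also have "\<dots> = (\<Sum>x\<in>X. A u x * walks A X S x l)"
    unfolding walks_def
    by (intro sum.cong refl) (subst sum.reindex, auto simp: sum_distrib_left inj_on_def)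
  also have "(\<Sum>w\<in>(\<Union>v\<in>S. (#) v ` walk_lists X (S - {v}) l). wt A u w 0) =
      (\<Sum>v\<in>S. \<Sum>w\<in>(#) v ` walk_lists X (S - {v}) l. wt A u w 0)"
    by (rule sum.UNION_disjoint) (use assms fin in auto)
  also have "\<dots> = (\<Sum>v\<in>S. A u v * walks A X (S - {v}) v l)"
    unfolding walks_def
    by (intro sum.cong refl) (subst sum.reindex, auto simp: sum_distrib_left inj_on_def)
  finally show ?thesis .
qed

text \<open>If some y in Y lies outside T, adding and removing y pairs the sets X with opposite
  signs.\<close>

lemma sum_alternating_between:
  assumes "finite Y" "T \<subseteq> Y"
  shows "(\<Sum>X | T \<subseteq> X \<and> X \<subseteq> Y. (- 1) ^ card (Y - X)) = (if T = Y then 1 else 0 :: int)"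
proof (cases "T = Y")
  case True
  then have "{X. T \<subseteq> X \<and> X \<subseteq> Y} = {Y}" by auto
  then show ?thesis using True by simp
next
  case False
  then obtain y where y: "y \<in> Y" "y \<notin> T" using assms by auto
  let ?P = "{X. T \<subseteq> X \<and> X \<subseteq> Y - {y}}"
  have fin: "finite ?P" using assms by auto
  have eq: "{X. T \<subseteq> X \<and> X \<subseteq> Y} = ?P \<union> insert y ` ?P"
  proof (intro equalityI subsetI)
    fix X assume X: "X \<in> {X. T \<subseteq> X \<and> X \<subseteq> Y}"
    show "X \<in> ?P \<union> insert y ` ?P"
    proof (cases "y \<in> X")
      case True
      then have "X = insert y (X - {y})" "X - {y} \<in> ?P" using X y by auto
      then show ?thesis by blast
    next
      case False
      then show ?thesis using X by auto
    qed
  next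
    fix X assume "X \<in> ?P \<union> insert y ` ?P"
    then show "X \<in> {X. T \<subseteq> X \<and> X \<subseteq> Y}" using y by auto
  qed
  have "(\<Sum>X | T \<subseteq> X \<and> X \<subseteq> Y. (- 1) ^ card (Y - X)) =
     (\<Sum>X\<in>?P. (- 1) ^ card (Y - X)) + (\<Sum>X\<in>insert y ` ?P. (- 1) ^ card (Y - X) :: int)"
    unfolding eq by (rule sum.union_disjoint) (use fin in auto)
  also have "(\<Sum>X\<in>insert y ` ?P. (- 1) ^ card (Y - X) :: int) = (\<Sum>X\<in>?P. (- 1) ^ card (Y - insert y X))"
    by (subst sum.reindex) (auto simp: inj_on_def)
  also have "\<dots> = (\<Sum>X\<in>?P. - ((- 1) ^ card (Y - X)))"
  proof (rule sum.cong[OF refl])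
    fix X assume X: "X \<in> ?P"
    have "Y - X = insert y (Y - insert y X)" using X y by auto
    moreover have "y \<notin> Y - insert y X" by simp
    ultimately have "card (Y - X) = Suc (card (Y - insert y X))"
      using assms(1) by (metis card_insert_disjoint finite_Diff)
    then show "(- 1) ^ card (Y - insert y X) = - ((- 1) ^ card (Y - X) :: int)" by simp
  qed
  finally show ?thesis using False by (simp add: sum_negf)
qed

lemma count_list_distinct: "distinct w \<Longrightarrow> s \<in> set w \<Longrightarrow> count_list w s = 1"
  by (induction w) auto

text \<open>A list of length |S| + |Y| that meets every element of the disjoint sets S and Y has no
  room for a repetition. This is where the length of a walk turns covering into being
  Hamiltonian.\<close>

lemma permutations_of_set_walk_lists:
  assumes "finite S" "finite Y" "S \<inter> Y = {}"
  shows "permutations_of_set (S \<union> Y) = {w \<in> walk_lists Y S (card S + card Y). Y \<subseteq> set w}"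
proof (intro equalityI subsetI)
  fix w assume "w \<in> permutations_of_set (S \<union> Y)"
  then have w: "set w = S \<union> Y" "distinct w" by (auto simp: permutations_of_set_def)
  have "length w = card S + card Y"
    using distinct_card[OF w(2)] card_Un_disjoint[OF assms] w(1) by simp
  moreover have "count_list w s = 1" if "s \<in> S" for s
    using w that by (intro count_list_distinct) auto
  ultimately show "w \<in> {w \<in> walk_lists Y S (card S + card Y). Y \<subseteq> set w}"
    using w by (auto simp: walk_lists_def)
next
  fix w assume "w \<in> {w \<in> walk_lists Y S (card S + card Y). Y \<subseteq> set w}"
  then have w: "length w = card S + card Y" "set w \<subseteq> Y \<union> S" "\<forall>s\<in>S. count_list w s = 1" "Y \<subseteq> set w"
    by (auto simp: walk_lists_def)
  have "S \<subseteq> set w" using w(3) by (metis count_notin subsetI zero_neq_one)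
  then have s: "set w = S \<union> Y" using w by auto
  moreover have "distinct w"
    using w(1) card_Un_disjoint[OF assms] s by (intro card_distinct) simp
  ultimately show "w \<in> permutations_of_set (S \<union> Y)" by auto
qed

text \<open>After exchanging the sums, a walk through S and Y is counted for exactly those X that
  contain the part of Y it visits; the signs cancel unless it visits all of Y.\<close>

lemma hc_from_inclusion_exclusion:
  fixes A :: "nat \<Rightarrow> nat \<Rightarrow> nat"
  assumes "finite S" "finite Y" "S \<inter> Y = {}"
  shows "int (hc_from A (S \<union> Y) u) =
    (\<Sum>X\<in>Pow Y. (- 1) ^ card (Y - X) * int (walks A X S u (card S + card Y)))"
proof -
  let ?l = "card S + card Y"
  let ?L = "walk_lists Y S ?l"
  have finL: "finite ?L" using assms by (intro finite_walk_lists)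
  have sub: "walk_lists X S ?l = {w \<in> ?L. set w \<inter> Y \<subseteq> X}" if "X \<subseteq> Y" for X
    using that assms(3) by (auto simp: walk_lists_def)
  have "(\<Sum>X\<in>Pow Y. (- 1) ^ card (Y - X) * int (walks A X S u ?l)) =
    (\<Sum>X\<in>Pow Y. \<Sum>w\<in>?L. if set w \<inter> Y \<subseteq> X then (- 1) ^ card (Y - X) * int (wt A u w 0) else 0)"
  proof (rule sum.cong[OF refl])
    fix X assume "X \<in> Pow Y"
    then have "walks A X S u ?l = (\<Sum>w | w \<in> ?L \<and> set w \<inter> Y \<subseteq> X. wt A u w 0)"
      unfolding walks_def by (subst sub) auto
    also have "\<dots> = (\<Sum>w\<in>?L. if set w \<inter> Y \<subseteq> X then wt A u w 0 else 0)"
      by (rule sum.inter_filter[OF finL])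
    finally show "(- 1) ^ card (Y - X) * int (walks A X S u ?l) =
      (\<Sum>w\<in>?L. if set w \<inter> Y \<subseteq> X then (- 1) ^ card (Y - X) * int (wt A u w 0) else 0)"
      by (simp add: sum_distrib_left if_distrib[of int] if_distrib[of "\<lambda>x. _ * x"] cong: if_cong)
  qed
  also have "\<dots> = (\<Sum>w\<in>?L. \<Sum>X\<in>Pow Y. if set w \<inter> Y \<subseteq> X then (- 1) ^ card (Y - X) * int (wt A u w 0) else 0)"
    by (rule sum.swap)
  also have "\<dots> = (\<Sum>w\<in>?L. if Y \<subseteq> set w then int (wt A u w 0) else 0)"
  proof (rule sum.cong[OF refl])
    fix w assume "w \<in> ?L"
    have "(\<Sum>X\<in>Pow Y. if set w \<inter> Y \<subseteq> X then (- 1) ^ card (Y - X) * int (wt A u w 0) else 0) =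
       (\<Sum>X | set w \<inter> Y \<subseteq> X \<and> X \<subseteq> Y. (- 1) ^ card (Y - X)) * int (wt A u w 0)"
      by (subst sum.inter_filter[symmetric])
        (use assms(2) in \<open>auto simp: sum_distrib_right intro!: sum.cong\<close>)
    also have "\<dots> = (if Y \<subseteq> set w then int (wt A u w 0) else 0)"
      by (subst sum_alternating_between) (use assms(2) in auto)
    finally show "(\<Sum>X\<in>Pow Y. if set w \<inter> Y \<subseteq> X then (- 1) ^ card (Y - X) * int (wt A u w 0) else 0) = \<dots>" .
  qed
  also have "\<dots> = (\<Sum>w | w \<in> ?L \<and> Y \<subseteq> set w. int (wt A u w 0))"
    by (rule sum.inter_filter[symmetric, OF finL])
  also have "{w. w \<in> ?L \<and> Y \<subseteq> set w} = permutations_of_set (S \<union> Y)"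
    using permutations_of_set_walk_lists[OF assms] by simp
  finally show ?thesis by (simp add: hc_from_def)
qed

subsection \<open>Walk generating functions\<close>

text \<open>\<open>kq b A X l u v\<close> sums over the walks from u to v with at most l arcs and
  all inner vertices in X, each weighted by its multiplicity times b to the number of arcs. One
  recursion serves for b the indeterminate (\<open>pq\<close>) and for b a number, the form that the
  machine evaluates.\<close>

primrec kq :: "'a::comm_semiring_1 \<Rightarrow> (nat \<Rightarrow> nat \<Rightarrow> 'a) \<Rightarrow> nat set \<Rightarrow> nat \<Rightarrow> nat \<Rightarrow> nat \<Rightarrow> 'a" where
  "kq b A X 0 = (\<lambda>u v. 0)"
| "kq b A X (Suc l) = (\<lambda>u v. b * (A u v + (\<Sum>x\<in>X. A u x * kq b A X l x v)))"

abbreviation pq :: "(nat \<Rightarrow> nat \<Rightarrow> 'a::comm_semiring_1) \<Rightarrow> nat set \<Rightarrow> nat \<Rightarrow> nat \<Rightarrow> nat \<Rightarrow> 'a poly" where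
  "pq A X l \<equiv> kq [:0, 1:] (\<lambda>u v. [:A u v:]) X l"

lemma poly_pq: "poly (pq A X l u v) b = kq b A X l u v"
  by (induction l arbitrary: u v) (simp_all add: poly_sum algebra_simps)

lemma coeff_pq_0: "coeff (pq A X l u v) 0 = 0"
  by (cases l) simp_all

lemma coeff_pq_Suc_Suc:
  "coeff (pq A X (Suc l) u v) (Suc i) =
    (if i = 0 then A u v else 0) + (\<Sum>x\<in>X. A u x * coeff (pq A X l x v) i)"
  by (cases i) (simp_all add: coeff_sum)

text \<open>A walk with i arcs is present as soon as i <= l: the truncation affects only higher
  coefficients.\<close>

lemma coeff_pq_stable: "i \<le> l \<Longrightarrow> coeff (pq A X (Suc l) u v) i = coeff (pq A X l u v) i"
proof (induction l arbitrary: i u v)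
  case 0
  then show ?case by simp
next
  case (Suc l)
  show ?case
  proof (cases i)
    case 0
    then show ?thesis by (simp only: coeff_pq_0)
  next
    case (Suc j)
    then have "j \<le> l" using Suc.prems by simp
    then show ?thesis unfolding Suc coeff_pq_Suc_Suc by (simp only: Suc.IH)
  qed
qed

text \<open>Both sides carry the same \<open>l\<close>, unlike the defining recursion, so that one
  fixed truncation can be used from here on.\<close>

lemma coeff_pq_Suc:
  assumes "Suc i \<le> l"
  shows "coeff (pq A X l u v) (Suc i) =
    (if i = 0 then A u v else 0) + (\<Sum>x\<in>X. A u x * coeff (pq A X l x v) i)"
  using assms by (simp only: coeff_pq_stable[OF assms, symmetric] coeff_pq_Suc_Suc)

text \<open>The first factor is split at its first arc: it either reaches v at once, after which
  only h remains, or enters some x in X. In the application h generates the rest of the closed walk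
  after v.\<close>

lemma coeff_mult_pq:
  assumes "Suc i \<le> l"
  shows "coeff (pq A X l u v * h) (Suc i) =
    A u v * coeff h i + (\<Sum>x\<in>X. A u x * coeff (pq A X l x v * h) i)"
proof -
  have "coeff (pq A X l u v * h) (Suc i) =
      (\<Sum>j\<le>i. coeff (pq A X l u v) (Suc j) * coeff h (i - j))"
    by (simp add: coeff_mult sum.atMost_Suc_shift coeff_pq_0 del: sum.atMost_Suc)
  also have "\<dots> = (\<Sum>j\<le>i. (if j = 0 then A u v * coeff h (i - j) else 0) +
       (\<Sum>x\<in>X. A u x * (coeff (pq A X l x v) j * coeff h (i - j))))"
  proof (intro sum.cong refl)
    fix j assume "j \<in> {..i}"
    then have "Suc j \<le> l" using assms by simp
    then show "coeff (pq A X l u v) (Suc j) * coeff h (i - j) =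
      (if j = 0 then A u v * coeff h (i - j) else 0) +
       (\<Sum>x\<in>X. A u x * (coeff (pq A X l x v) j * coeff h (i - j)))"
      by (subst coeff_pq_Suc) (simp_all add: algebra_simps sum_distrib_left sum_distrib_right)
  qed
  also have "\<dots> = A u v * coeff h i + (\<Sum>j\<le>i. \<Sum>x\<in>X. A u x * (coeff (pq A X l x v) j * coeff h (i - j)))"
    by (simp add: sum.distrib)
  also have "(\<Sum>j\<le>i. \<Sum>x\<in>X. A u x * (coeff (pq A X l x v) j * coeff h (i - j))) =
     (\<Sum>x\<in>X. A u x * coeff (pq A X l x v * h) i)"
    by (subst sum.swap) (simp add: coeff_mult sum_distrib_left)
  finally show ?thesis .
qed

text \<open>Cutting a closed walk at its visits to \<open>S\<close> factors it into walks through \<open>X\<close>.\<close>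

lemma coeff_hc_from_pq:
  assumes "finite X" "finite S" "X \<inter> S = {}" "i \<le> l"
  shows "coeff (hc_from (pq A X l) S u) i = (case i of 0 \<Rightarrow> 0 | Suc j \<Rightarrow> walks A X S u j)"
  using assms(2-4)
\<comment> \<open>Both inductions follow the first arc: entering S shrinks S (outer induction),
  entering X keeps S but lowers i (inner induction).\<close>
proof (induction "card S" arbitrary: S u i)
  case 0
  then have [simp]: "S = {}" by simp
  show ?case using \<open>i \<le> l\<close>
  proof (induction i arbitrary: u)
    case 0
    then show ?case by (simp add: coeff_pq_0)
  next
    case (Suc i)
    have "coeff (hc_from (pq A X l) S u) (Suc i) = 
      (if i = 0 then A u 0 else 0) + (\<Sum>x\<in>X. A u x * coeff (pq A X l x 0) i)"
      using Suc.prems by (simp add: coeff_pq_Suc)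
    also have "\<dots> = (if i = 0 then A u 0 else 0) + (\<Sum>x\<in>X. A u x * (case i of 0 \<Rightarrow> 0 | Suc j \<Rightarrow> walks A X S x j))"
      using Suc.IH Suc.prems by simp
    also have "\<dots> = walks A X S u i"
      by (cases i) (simp_all add: walks_0 walks_Suc assms(1))
    finally show ?case by simp
  qed
next
  case (Suc c)
  then have fin: "finite S" and ne: "S \<noteq> {}" by auto
  have IH: "coeff (hc_from (pq A X l) (S - {v}) u) i = (case i of 0 \<Rightarrow> 0 | Suc j \<Rightarrow> walks A X (S - {v}) u j)"
    if "v \<in> S" "i \<le> l" for v u i
    using Suc.hyps(2) Suc.prems that by (intro Suc.hyps(1)) auto
  show ?case using \<open>i \<le> l\<close>
  proof (induction i arbitrary: u)
    case 0
    then show ?case by (simp add: hc_from_rec[OF fin ne] coeff_sum coeff_mult coeff_pq_0)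
  next
    case (Suc i)
    have "coeff (hc_from (pq A X l) S u) (Suc i) =
      (\<Sum>v\<in>S. A u v * coeff (hc_from (pq A X l) (S - {v}) v) i) +
      (\<Sum>v\<in>S. \<Sum>x\<in>X. A u x * coeff (pq A X l x v * hc_from (pq A X l) (S - {v}) v) i)"
      using Suc.prems
      by (simp add: hc_from_rec[OF fin ne, of _ u] coeff_sum coeff_mult_pq sum.distrib)
    also have "(\<Sum>v\<in>S. \<Sum>x\<in>X. A u x * coeff (pq A X l x v * hc_from (pq A X l) (S - {v}) v) i) =
       (\<Sum>x\<in>X. A u x * coeff (hc_from (pq A X l) S x) i)"
      by (subst sum.swap) (simp add: hc_from_rec[OF fin ne] coeff_sum sum_distrib_left)
    also have "\<dots> = (\<Sum>x\<in>X. A u x * (case i of 0 \<Rightarrow> 0 | Suc j \<Rightarrow> walks A X S x j))"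
      using Suc.IH Suc.prems by simp
    also have "(\<Sum>v\<in>S. A u v * coeff (hc_from (pq A X l) (S - {v}) v) i) =
       (\<Sum>v\<in>S. A u v * (case i of 0 \<Rightarrow> 0 | Suc j \<Rightarrow> walks A X (S - {v}) v j))"
      using IH Suc.prems by simp
    also have "(\<Sum>v\<in>S. A u v * (case i of 0 \<Rightarrow> 0 | Suc j \<Rightarrow> walks A X (S - {v}) v j)) +
        (\<Sum>x\<in>X. A u x * (case i of 0 \<Rightarrow> 0 | Suc j \<Rightarrow> walks A X S x j)) = walks A X S u i"
      using ne fin \<open>X \<inter> S = {}\<close> assms(1)
      by (cases i) (simp_all add: walks_0 walks_Suc add.commute)
    finally show ?case by simp
  qed
qed

text \<open>Evaluation at a large base \<open>B\<close> (Kronecker substitution) keeps the coefficients apart.\<close>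

lemma coeff_eq_digit:
  fixes p :: "nat poly"
  assumes "poly p 1 < B"
  shows "coeff p n = (poly p B div B ^ n) mod B"
  using assms
proof (induction p arbitrary: n)
  case 0
  then show ?case by simp
next
  case (pCons a p)
  \<comment> \<open>\<open>poly p 1\<close> is the sum of the coefficients, so its bound passes on
    to the constant coefficient and to the remaining polynomial.\<close>
  then have a: "a < B" and p: "poly p 1 < B" by auto
  show ?case
  proof (cases n)
    case 0
    then show ?thesis using a by simp
  next
    case (Suc m)
    have "(a + B * poly p B) div B ^ n = poly p B div B ^ m"
      using a Suc by (simp add: div_mult2_eq)
    then show ?thesis using pCons.IH[OF p, of m] Suc by simp
  qed
qed

text \<open>The summand 1 closes the induction: with g the bound for l, the next value is at most b
  * (n * a + n * a * (g - 1)) = b * n * a * g, and adding g to this gives the next power.\<close>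

lemma kq_le:
  fixes A :: "nat \<Rightarrow> nat \<Rightarrow> nat"
  assumes "\<And>u v. u < n \<Longrightarrow> v < n \<Longrightarrow> A u v \<le> a" "X \<subseteq> {..<n}" "u < n" "v < n"
  shows "kq b A X l u v + 1 \<le> (b * a * n + 1) ^ l"
  using assms(3,4)
proof (induction l arbitrary: u v)
  case 0
  then show ?case by simp
next
  case (Suc l)
  let ?g = "(b * a * n + 1) ^ l"
  have g: "1 \<le> ?g" by simp
  have "(\<Sum>x\<in>X. A u x * kq b A X l x v) \<le> (\<Sum>x\<in>X. a * (?g - 1))"
  proof (intro sum_mono mult_le_mono)
    fix x assume "x \<in> X"
    then have x: "x < n" using assms(2) by auto
    show "A u x \<le> a" using assms(1) Suc.prems x by simp
    show "kq b A X l x v \<le> ?g - 1" using Suc.IH[OF x Suc.prems(2)] by simp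
  qed
  also have "\<dots> \<le> n * (a * (?g - 1))"
    using card_mono[OF _ assms(2)] by (simp del: One_nat_def)
  finally have "A u v + (\<Sum>x\<in>X. A u x * kq b A X l x v) \<le> n * a + n * (a * (?g - 1))"
    using assms(1)[OF Suc.prems] Suc.prems(1)
    by (intro add_mono) (auto intro: order_trans[of _ "1 * a"] mult_le_mono)
  also have "\<dots> = n * a * ?g" using g by (simp add: algebra_simps diff_mult_distrib2)
  finally have "kq b A X (Suc l) u v + 1 \<le> b * (n * a * ?g) + 1" by simp
  also have "\<dots> \<le> b * (n * a * ?g) + ?g" using g by simp
  also have "\<dots> = (b * a * n + 1) ^ Suc l" by (simp add: algebra_simps)
  finally show ?case .
qed

text \<open>The set K is {0..<k}: vertex 0 is the base point and {1..<k} is the set visited exactly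
  once. The lower bound on B involves neither X nor k, so a single base serves for all
  subsets.\<close>

lemma hc_inclusion_exclusion:
  fixes A :: "nat \<Rightarrow> nat \<Rightarrow> nat"
  assumes "1 \<le> k" "k \<le> n" "\<And>u v. u < n \<Longrightarrow> v < n \<Longrightarrow> A u v \<le> a"
    and B: "n ^ n * (a * n + 1) ^ (n * n) < B"
  shows "int (hc A n) =
    (\<Sum>X\<in>Pow {k..<n}. (- 1) ^ card ({k..<n} - X) * int ((hc (kq B A X n) k div B ^ n) mod B))"
proof -
  have split: "{1..<n} = {1..<k} \<union> {k..<n}" using assms by auto
  have "int (hc A n) = (\<Sum>X\<in>Pow {k..<n}. (- 1) ^ card ({k..<n} - X) *
      int (walks A X {1..<k} 0 (card {1..<k} + card {k..<n})))"
    unfolding hc_def split by (rule hc_from_inclusion_exclusion) auto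
  also have "card {1..<k} + card {k..<n} = n - 1" using assms by simp
  also have "(\<Sum>X\<in>Pow {k..<n}. (- 1) ^ card ({k..<n} - X) * int (walks A X {1..<k} 0 (n - 1))) =
    (\<Sum>X\<in>Pow {k..<n}. (- 1) ^ card ({k..<n} - X) * int ((hc (kq B A X n) k div B ^ n) mod B))"
  proof (rule sum.cong[OF refl])
    fix X assume X: "X \<in> Pow {k..<n}"
    then have finX: "finite X" and Xn: "X \<subseteq> {..<n}" by (auto intro: finite_subset)
    let ?h = "hc (pq A X n) k"
    \<comment> \<open>n - 1 intermediate vertices make n arcs, hence the coefficient of index
      n.\<close>
    have "walks A X {1..<k} 0 (n - 1) = coeff ?h n"
      unfolding hc_def
      by (subst coeff_hc_from_pq) (use X finX assms in \<open>auto split: nat.split\<close>)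
    also have "\<dots> = (poly ?h B div B ^ n) mod B"
    proof (rule coeff_eq_digit)
      have "poly ?h 1 = hc (kq 1 A X n) k" by (simp add: poly_hc poly_pq del: One_nat_def)
      also have "\<dots> \<le> k ^ k * ((a * n + 1) ^ n) ^ k"
      proof (rule hc_le)
        fix u v assume "u < k" "v < k"
        then show "kq 1 A X n u v \<le> (a * n + 1) ^ n"
          using kq_le[of n A a X u v 1 n] assms Xn by simp
      qed (use assms in auto)
      also have "\<dots> \<le> n ^ n * ((a * n + 1) ^ n) ^ n"
      proof (intro mult_le_mono)
        have "k ^ k \<le> n ^ k" using assms by (intro power_mono) auto
        also have "\<dots> \<le> n ^ n" using assms by (intro power_increasing) auto
        finally show "k ^ k \<le> n ^ n" .
        show "((a * n + 1) ^ n) ^ k \<le> ((a * n + 1) ^ n) ^ n" using assms by (intro power_increasing) auto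
      qed
      also have "\<dots> = n ^ n * (a * n + 1) ^ (n * n)" by (simp add: power_mult)
      also have "\<dots> < B" by (rule B)
      finally show "poly ?h 1 < B" .
    qed
    also have "poly ?h B = hc (kq B A X n) k" by (simp add: poly_hc poly_pq del: One_nat_def)
    finally show "(- 1) ^ card ({k..<n} - X) * int (walks A X {1..<k} 0 (n - 1)) =
      (- 1) ^ card ({k..<n} - X) * int ((hc (kq B A X n) k div B ^ n) mod B)" by simp
  qed
  finally show ?thesis .
qed

section \<open>A program logic that counts steps of bounded cost\<close>

subsection \<open>Timed execution with bounded cells\<close>

definition upd :: "state \<Rightarrow> nat \<Rightarrow> nat \<Rightarrow> state" where
  "upd s r v = s\<lparr>reg := (reg s)(r := v)\<rparr>"

definition sto :: "state \<Rightarrow> nat \<Rightarrow> nat \<Rightarrow> state" where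
  "sto s a v = s\<lparr>mem := (mem s)(a := v)\<rparr>"

lemma upd_simps [simp]:
  "reg (upd s r v) r' = (if r' = r then v else reg s r')" "mem (upd s r v) = mem s"
  by (simp_all add: upd_def)

lemma sto_simps [simp]:
  "reg (sto s a v) = reg s" "mem (sto s a v) a' = (if a' = a then v else mem s a')"
  by (simp_all add: sto_def)

text \<open>A uniform bound on all cells turns logarithmic cost into a count of elementary steps;
  only intermediate values inside an expression may exceed it.\<close>

definition bd :: "nat \<Rightarrow> state \<Rightarrow> bool" where
  "bd W s \<longleftrightarrow> (\<forall>r. reg s r < 2 ^ W) \<and> (\<forall>a. mem s a < 2 ^ W)"

fun esize :: "expr \<Rightarrow> nat" where
  "esize (Lit k) = 1"
| "esize (Reg r) = 1"
| "esize (Mem a) = Suc (esize a)"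
| "esize (Add a b) = Suc (esize a + esize b)"
| "esize (Sub a b) = Suc (esize a + esize b)"
| "esize (Mul a b) = Suc (esize a + esize b)"
| "esize (Div a b) = Suc (esize a + esize b)"

fun lits_bd :: "nat \<Rightarrow> expr \<Rightarrow> bool" where
  "lits_bd W (Lit k) = (k < 2 ^ W)"
| "lits_bd W (Reg r) = True"
| "lits_bd W (Mem a) = lits_bd W a"
| "lits_bd W (Add a b) = (lits_bd W a \<and> lits_bd W b)"
| "lits_bd W (Sub a b) = (lits_bd W a \<and> lits_bd W b)"
| "lits_bd W (Mul a b) = (lits_bd W a \<and> lits_bd W b)"
| "lits_bd W (Div a b) = (lits_bd W a \<and> lits_bd W b)"

text \<open>The constant 60 exceeds the size of every expression used below.\<close>

definition ok :: "nat \<Rightarrow> expr \<Rightarrow> bool" where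
  "ok W e \<longleftrightarrow> lits_bd W e \<and> esize e \<le> 60"

text \<open>An expression with e nodes has intermediate values of at most W * e bits, hence costs at
  most W * e^2; e <= 60 gives 3600 * W, and one more W pays for the unit charged per
  statement.\<close>

definition ucost :: "nat \<Rightarrow> nat" where
  "ucost W = 3601 * W"

lemma add_less_2_power:
  fixes x y :: nat
  assumes "x < 2 ^ m" "y < 2 ^ n" "m + n < k"
  shows "x + y < 2 ^ k"
proof -
  have "x + y + 1 \<le> (x + 1) * (y + 1)" by (simp add: algebra_simps)
  also have "\<dots> \<le> 2 ^ m * 2 ^ n" using assms by (intro mult_le_mono) auto
  also have "\<dots> = 2 ^ (m + n)" by (simp add: power_add)
  also have "\<dots> \<le> 2 ^ k" using assms(3) by (intro power_increasing) auto
  finally show ?thesis by simp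
qed

lemma mult_less_2_power:
  fixes x y :: nat
  assumes "x < 2 ^ m" "y < 2 ^ n" "m + n \<le> k"
  shows "x * y < 2 ^ k"
proof -
  have "x * y < 2 ^ m * 2 ^ n" using assms(1,2) by (rule mult_strict_mono) auto
  also have "\<dots> = 2 ^ (m + n)" by (simp add: power_add)
  also have "\<dots> \<le> 2 ^ k" using assms(3) by (intro power_increasing) auto
  finally show ?thesis .
qed

lemma less_2_power_mono: "x < 2 ^ m \<Longrightarrow> m \<le> n \<Longrightarrow> x < (2::nat) ^ n"
  by (meson less_le_trans one_le_numeral power_increasing)

lemma one_two_less_2_power [simp]:
  "Suc 0 \<le> W \<Longrightarrow> Suc 0 < 2 ^ W" "2 \<le> W \<Longrightarrow> 2 < (2::nat) ^ W"
proof -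
  show "Suc 0 < 2 ^ W" if "Suc 0 \<le> W" using power_strict_increasing[of 0 W "2::nat"] that by simp
  show "2 < (2::nat) ^ W" if "2 \<le> W" using power_strict_increasing[of 1 W "2::nat"] that by simp
qed

text \<open>Bit lengths at worst add up under multiplication; the W bits granted to the node itself
  absorb the carry of an addition.\<close>

lemma val_less:
  assumes "bd W s" "lits_bd W e" "1 \<le> W"
  shows "val e s < 2 ^ (W * esize e)"
  using assms(2)
proof (induction e)
  case (Add a b)
  show ?case using Add assms(3)
    by (auto intro!: add_less_2_power[of _ "W * esize a" _ "W * esize b"] simp: algebra_simps)
next
  case (Mul a b)
  then show ?case
    by (auto intro!: mult_less_2_power[of _ "W * esize a" _ "W * esize b"] simp: algebra_simps)
next
  case (Sub a b)
  have "val (Sub a b) s \<le> val a s" by simp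
  also have "\<dots> < 2 ^ (W * esize a)" using Sub by simp
  finally show ?case by (rule less_2_power_mono) (simp add: algebra_simps)
next
  case (Div a b)
  have "val (Div a b) s \<le> val a s" by simp
  also have "\<dots> < 2 ^ (W * esize a)" using Div by simp
  finally show ?case by (rule less_2_power_mono) (simp add: algebra_simps)
next
  case (Mem a)
  have "val (Mem a) s < 2 ^ W" using assms(1) by (simp add: bd_def)
  then show ?case by (rule less_2_power_mono) simp
qed (use assms in \<open>auto simp: bd_def\<close>)

lemma len_le: "x < 2 ^ m \<Longrightarrow> 1 \<le> m \<Longrightarrow> len x \<le> m"
  by (simp add: len_def floorlog_leI)

lemma cost_le:
  assumes "bd W s" "lits_bd W e" "1 \<le> W"
  shows "cost e s \<le> W * esize e * esize e"
  using assms(2)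
proof (induction e)
  case (Lit k)
  then show ?case using assms(3) by (simp add: len_le)
next
  case (Reg r)
  then show ?case using assms(1,3) by (simp add: bd_def len_le)
next
  case (Mem a)
  have "len (val (Mem a) s) \<le> W" using assms(1,3) by (intro len_le) (simp_all add: bd_def)
  moreover have "cost a s \<le> W * esize a * esize a" using Mem by simp
  ultimately show ?case by (simp add: algebra_simps)
next
  case (Add a b)
  have "len (val (Add a b) s) \<le> W * esize (Add a b)"
    using val_less[OF assms(1) Add.prems assms(3)] assms(3) by (intro len_le) auto
  moreover have "cost a s \<le> W * esize a * esize a" "cost b s \<le> W * esize b * esize b" using Add by simp_all
  ultimately show ?case by (simp add: algebra_simps)
next
  case (Sub a b)
  have "len (val (Sub a b) s) \<le> W * esize (Sub a b)"
    using val_less[OF assms(1) Sub.prems assms(3)] assms(3) by (intro len_le) auto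
  moreover have "cost a s \<le> W * esize a * esize a" "cost b s \<le> W * esize b * esize b" using Sub by simp_all
  ultimately show ?case by (simp add: algebra_simps)
next
  case (Mul a b)
  have "len (val (Mul a b) s) \<le> W * esize (Mul a b)"
    using val_less[OF assms(1) Mul.prems assms(3)] assms(3) by (intro len_le) auto
  moreover have "cost a s \<le> W * esize a * esize a" "cost b s \<le> W * esize b * esize b" using Mul by simp_all
  ultimately show ?case by (simp add: algebra_simps)
next
  case (Div a b)
  have "len (val (Div a b) s) \<le> W * esize (Div a b)"
    using val_less[OF assms(1) Div.prems assms(3)] assms(3) by (intro len_le) auto
  moreover have "cost a s \<le> W * esize a * esize a" "cost b s \<le> W * esize b * esize b" using Div by simp_all
  ultimately show ?case by (simp add: algebra_simps)
qed

lemma cost_le_ucost: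
  assumes "bd W s" "ok W e" "1 \<le> W"
  shows "cost e s + 1 \<le> ucost W"
proof -
  have "cost e s \<le> W * (esize e * esize e)"
    using cost_le[of W s e] assms by (simp add: ok_def mult.assoc)
  also have "\<dots> \<le> W * (60 * 60)" using assms(2) by (intro mult_le_mono) (auto simp: ok_def)
  finally show ?thesis using assms(3) by (simp add: ucost_def)
qed

fun mods :: "prog \<Rightarrow> nat set" where
  "mods Skip = {}"
| "mods (Assign r e) = {r}"
| "mods (Store a b) = {}"
| "mods (Seq P Q) = mods P \<union> mods Q"
| "mods (Cond e P Q) = mods P \<union> mods Q"
| "mods (While e P) = mods P"

fun nostore :: "prog \<Rightarrow> bool" where
  "nostore Skip = True"
| "nostore (Assign r e) = True"
| "nostore (Store a b) = False"
| "nostore (Seq P Q) = (nostore P \<and> nostore Q)"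
| "nostore (Cond e P Q) = (nostore P \<and> nostore Q)"
| "nostore (While e P) = nostore P"

lemma exec_mods: "exec P s t s' \<Longrightarrow> r \<notin> mods P \<Longrightarrow> reg s' r = reg s r"
  by (induction rule: exec.induct) auto

lemma exec_nostore: "exec P s t s' \<Longrightarrow> nostore P \<Longrightarrow> mem s' = mem s"
  by (induction rule: exec.induct) auto

text \<open>The frame read off from the syntax. The sequencing and loop rules hand it to their user,
  so that invariants need to mention only what changes.\<close>

definition keeps :: "prog \<Rightarrow> state \<Rightarrow> state \<Rightarrow> bool" where
  "keeps P s s' \<longleftrightarrow> (\<forall>r. r \<notin> mods P \<longrightarrow> reg s' r = reg s r) \<and> (nostore P \<longrightarrow> mem s' = mem s)"

lemma exec_keeps: "exec P s t s' \<Longrightarrow> keeps P s s'"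
  by (simp add: keeps_def exec_mods exec_nostore)

lemma keeps_reg: "keeps P s s' \<Longrightarrow> r \<notin> mods P \<Longrightarrow> reg s' r = reg s r"
  by (simp add: keeps_def)

lemma keeps_mem: "keeps P s s' \<Longrightarrow> nostore P \<Longrightarrow> mem s' = mem s"
  by (simp add: keeps_def)

text \<open>As subtraction is truncated, the guard is nonzero exactly while the counter i is below
  the bound b.\<close>

definition For :: "nat \<Rightarrow> nat \<Rightarrow> prog \<Rightarrow> prog" where
  "For i b P = Seq (Assign i (Lit 0))
     (While (Sub (Reg b) (Reg i)) (Seq P (Assign i (Add (Reg i) (Lit 1)))))"

lemma mods_For [simp]: "mods (For i b P) = insert i (mods P)"
  by (auto simp: For_def)

lemma nostore_For [simp]: "nostore (For i b P) = nostore P"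
  by (simp add: For_def)

text \<open>Time is measured in steps of cost at most \<open>ucost W\<close>, valid as long as
  no cell ever reaches \<open>2\<^sup>W\<close>.\<close>

definition tc :: "nat \<Rightarrow> prog \<Rightarrow> state \<Rightarrow> nat \<Rightarrow> (state \<Rightarrow> bool) \<Rightarrow> bool" where
  "tc W P s j Q \<longleftrightarrow> (bd W s \<longrightarrow>
     (\<exists>t s'. exec P s t s' \<and> t \<le> j * ucost W \<and> bd W s' \<and> Q s'))"

text \<open>\<open>tc\<close> holds vacuously in unbounded states, so boundedness of the initial
  state may be assumed; this shows that values copied from its cells fit into W bits.\<close>

lemma tc_bd: "(bd W s \<Longrightarrow> tc W P s j Q) \<Longrightarrow> tc W P s j Q"
  by (auto simp: tc_def)

lemma tc_conseq:
  assumes "tc W P s j Q" "j \<le> j'" "\<And>s'. bd W s' \<Longrightarrow> keeps P s s' \<Longrightarrow> Q s' \<Longrightarrow> Q' s'"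
  shows "tc W P s j' Q'"
  unfolding tc_def
proof
  assume "bd W s"
  with assms(1) obtain t s' where e: "exec P s t s'" "t \<le> j * ucost W" "bd W s'" "Q s'"
    unfolding tc_def by auto
  then have "Q' s'" using assms(3) exec_keeps by blast
  moreover have "t \<le> j' * ucost W" using e(2) assms(2) by (meson le_trans mult_le_mono1)
  ultimately show "\<exists>t s'. exec P s t s' \<and> t \<le> j' * ucost W \<and> bd W s' \<and> Q' s'" using e by blast
qed

lemma tc_le: "tc W P s j Q \<Longrightarrow> j \<le> j' \<Longrightarrow> tc W P s j' Q"
  by (rule tc_conseq) auto

lemma tc_Seq:
  assumes "tc W P s j (\<lambda>s'. tc W P' s' j' Q)"
  shows "tc W (Seq P P') s (j + j') Q"
  unfolding tc_def
proof
  assume "bd W s"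
  with assms obtain t s' where e: "exec P s t s'" "t \<le> j * ucost W" "bd W s'" "tc W P' s' j' Q"
    unfolding tc_def[of W P] by auto
  from e(3,4) obtain t' s'' where e': "exec P' s' t' s''" "t' \<le> j' * ucost W" "bd W s''" "Q s''"
    unfolding tc_def by auto
  show "\<exists>t s'. exec (Seq P P') s t s' \<and> t \<le> (j + j') * ucost W \<and> bd W s' \<and> Q s'"
    using exec.Seq[OF e(1) e'(1)] e(2) e'(2-4) by (metis add_mono distrib_right)
qed

lemma tc_SeqI:
  assumes "tc W P s j R"
    and "\<And>s'. bd W s' \<Longrightarrow> keeps P s s' \<Longrightarrow> R s' \<Longrightarrow> tc W P' s' j' Q"
  shows "tc W (Seq P P') s (j + j') Q"
  by (rule tc_Seq, rule tc_conseq[OF assms(1) order_refl]) (rule assms(2))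

lemma tc_Cond:
  assumes "1 \<le> W" "ok W e" "val e s \<noteq> 0 \<Longrightarrow> tc W P s j Q" "val e s = 0 \<Longrightarrow> tc W P' s j Q"
  shows "tc W (Cond e P P') s (1 + j) Q"
  unfolding tc_def
proof
  assume b: "bd W s"
  note c = cost_le_ucost[OF b assms(2,1)]
  show "\<exists>t s'. exec (Cond e P P') s t s' \<and> t \<le> (1 + j) * ucost W \<and> bd W s' \<and> Q s'"
  proof (cases "val e s = 0")
    case True
    with assms(4) b obtain t s' where e: "exec P' s t s'" "t \<le> j * ucost W" "bd W s'" "Q s'"
      unfolding tc_def by auto
    show ?thesis
      using exec.CondFalse[OF True e(1), of P] e(2-4) c
      by (intro exI[of _ "cost e s + 1 + t"] exI[of _ s']) simp
  next
    case False
    with assms(3) b obtain t s' where e: "exec P s t s'" "t \<le> j * ucost W" "bd W s'" "Q s'"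
      unfolding tc_def by auto
    show ?thesis
      using exec.CondTrue[OF False e(1), of P'] e(2-4) c
      by (intro exI[of _ "cost e s + 1 + t"] exI[of _ s']) simp
  qed
qed

lemma tc_Skip: "1 \<le> W \<Longrightarrow> Q s \<Longrightarrow> tc W Skip s 1 Q"
  unfolding tc_def by (auto intro!: exI[of _ 1] exI[of _ s] exec.Skip simp: ucost_def)

lemma tc_Assign:
  assumes "1 \<le> W" "ok W e" "bd W s \<Longrightarrow> val e s < 2 ^ W" "Q (upd s r (val e s))"
  shows "tc W (Assign r e) s 1 Q"
  unfolding tc_def
proof
  assume b: "bd W s"
  have "bd W (upd s r (val e s))" using assms(3) b by (simp add: bd_def)
  then show "\<exists>t s'. exec (Assign r e) s t s' \<and> t \<le> 1 * ucost W \<and> bd W s' \<and> Q s'"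
    using exec.Assign[of r e s, folded upd_def] cost_le_ucost[OF b assms(2,1)] assms(4)
    by (metis mult_1)
qed

lemma tc_Store:
  assumes "1 \<le> W" "ok W a" "ok W e" "bd W s \<Longrightarrow> val e s < 2 ^ W" "Q (sto s (val a s) (val e s))"
  shows "tc W (Store a e) s 2 Q"
  unfolding tc_def
proof
  assume b: "bd W s"
  have "bd W (sto s (val a s) (val e s))" using assms(4) b by (simp add: bd_def)
  moreover have "cost a s + cost e s + 1 \<le> 2 * ucost W"
    using cost_le_ucost[OF b assms(2,1)] cost_le_ucost[OF b assms(3,1)] by linarith
  ultimately show "\<exists>t s'. exec (Store a e) s t s' \<and> t \<le> 2 * ucost W \<and> bd W s' \<and> Q s'"
    using exec.Store[of a e s, folded sto_def] assms(5) by blast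
qed

text \<open>\<open>Inv c\<close> speaks of the state in which the counter is c; the increment
  follows the body, hence \<open>upd s'' i (Suc c)\<close> in the step. Each round costs two steps
  beyond the body, for guard and increment, and the final 2 pays for the initial assignment and the
  failing guard.\<close>

lemma tc_For:
  assumes W: "1 \<le> W" and ib: "i \<notin> mods P" "b \<notin> mods P" "i \<noteq> b"
    and init: "Inv 0 (upd s i 0)"
    and step: "\<And>c s'. c < reg s b \<Longrightarrow> Inv c s' \<Longrightarrow> reg s' i = c \<Longrightarrow> keeps (For i b P) s s' \<Longrightarrow> bd W s' \<Longrightarrow>
      tc W P s' j (\<lambda>s''. Inv (Suc c) (upd s'' i (Suc c)))"
    and post: "\<And>s'. Inv (reg s b) s' \<Longrightarrow> reg s' i = reg s b \<Longrightarrow> keeps (For i b P) s s' \<Longrightarrow> bd W s' \<Longrightarrow> Q s'"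
  shows "tc W (For i b P) s (reg s b * (j + 2) + 2) Q"
  unfolding tc_def
proof
  assume b: "bd W s"
  let ?U = "ucost W" and ?m = "reg s b"
  have ok: "ok W (Sub (Reg b) (Reg i))" "ok W (Lit 0)" "ok W (Add (Reg i) (Lit 1))"
    using W by (auto simp: ok_def)
  let ?L = "While (Sub (Reg b) (Reg i)) (Seq P (Assign i (Add (Reg i) (Lit 1))))"
  \<comment> \<open>Here d is the number of rounds still to run.\<close>
  have loop: "\<exists>t s''. exec ?L s' t s'' \<and> t \<le> (d * (j + 2) + 1) * ?U \<and> bd W s'' \<and>
      Inv ?m s'' \<and> reg s'' i = ?m \<and> keeps (For i b P) s s''"
    if "d \<le> ?m" "Inv (?m - d) s'" "reg s' i = ?m - d" "keeps (For i b P) s s'" "bd W s'" for d s'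
    using that
  proof (induction d arbitrary: s')
    case 0
    have "val (Sub (Reg b) (Reg i)) s' = 0"
      using 0 keeps_reg[OF 0(4), of b] ib by simp
    from exec.WhileFalse[OF this] cost_le_ucost[OF 0(5) ok(1) W] 0 show ?case
      by (metis add_0 diff_zero mult_1 mult_zero_left)
  next
    case (Suc d)
    let ?c = "?m - Suc d"
    have c: "?c < ?m" "Suc ?c = ?m - d" using Suc.prems by auto
    have "val (Sub (Reg b) (Reg i)) s' = Suc d"
      using Suc.prems keeps_reg[OF Suc.prems(4), of b] ib by simp
    then have g: "val (Sub (Reg b) (Reg i)) s' \<noteq> 0" by simp
    from step[OF c(1) Suc.prems(2-5)] Suc.prems(5) obtain t1 s1 where
      s1: "exec P s' t1 s1" "t1 \<le> j * ?U" "bd W s1" "Inv (Suc ?c) (upd s1 i (Suc ?c))"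
      unfolding tc_def by auto
    have r1: "reg s1 i = ?c" using exec_mods[OF s1(1) ib(1)] Suc.prems(3) by simp
    let ?s2 = "upd s1 i (Suc ?c)"
    have a: "exec (Assign i (Add (Reg i) (Lit 1))) s1 (cost (Add (Reg i) (Lit 1)) s1 + 1) ?s2"
      using exec.Assign[of i "Add (Reg i) (Lit 1)" s1, folded upd_def] r1 by simp
    \<comment> \<open>The counter never exceeds its bound, which is itself the value of a cell, so
      it cannot overflow.\<close>
    have "Suc ?c < 2 ^ W" using b c(1) by (meson bd_def le_less_trans Suc_leI)
    then have b2: "bd W ?s2" using s1(3) by (simp add: bd_def)
    have k2: "keeps (For i b P) s ?s2"
      using Suc.prems(4) exec_keeps[OF s1(1)] by (simp add: keeps_def)
    obtain t2 s3 where s3: "exec ?L ?s2 t2 s3" "t2 \<le> (d * (j + 2) + 1) * ?U" "bd W s3"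
      "Inv ?m s3" "reg s3 i = ?m" "keeps (For i b P) s s3"
      using Suc.IH[of ?s2] Suc.prems(1) s1(4) b2 k2 c(2) by auto
    let ?t = "cost (Sub (Reg b) (Reg i)) s' + 1 + (t1 + (cost (Add (Reg i) (Lit 1)) s1 + 1)) + t2"
    have "exec ?L s' ?t s3"
      by (rule exec.WhileTrue[OF g exec.Seq[OF s1(1) a] s3(1)])
    moreover have "?t \<le> (Suc d * (j + 2) + 1) * ?U"
    proof -
      have "?t \<le> ?U + (j * ?U + ?U) + (d * (j + 2) + 1) * ?U"
        using cost_le_ucost[OF Suc.prems(5) ok(1) W] cost_le_ucost[OF s1(3) ok(3) W] s1(2) s3(2)
        by linarith
      also have "\<dots> = (Suc d * (j + 2) + 1) * ?U" by (simp add: algebra_simps)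
      finally show ?thesis .
    qed
    ultimately show ?case using s3 by blast
  qed
  let ?s0 = "upd s i 0"
  have a: "exec (Assign i (Lit 0)) s (cost (Lit 0) s + 1) ?s0"
    using exec.Assign[of i "Lit 0" s, folded upd_def] by simp
  have "\<exists>t s''. exec ?L ?s0 t s'' \<and> t \<le> (?m * (j + 2) + 1) * ?U \<and> bd W s'' \<and>
      Inv ?m s'' \<and> reg s'' i = ?m \<and> keeps (For i b P) s s''"
    by (rule loop) (use init b in \<open>auto simp: keeps_def bd_def\<close>)
  then obtain t s' where t: "exec ?L ?s0 t s'" "t \<le> (?m * (j + 2) + 1) * ?U" "bd W s'" "Inv ?m s'"
    "reg s' i = ?m" "keeps (For i b P) s s'"
    by blast
  have "exec (For i b P) s (cost (Lit 0) s + 1 + t) s'"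
    unfolding For_def by (rule exec.Seq[OF a t(1)])
  moreover have "cost (Lit 0) s + 1 + t \<le> (?m * (j + 2) + 2) * ?U"
    using cost_le_ucost[OF b ok(2) W] t(2) by (simp add: algebra_simps)
  ultimately show "\<exists>t s'. exec (For i b P) s t s' \<and> t \<le> (?m * (j + 2) + 2) * ?U \<and> bd W s' \<and> Q s'"
    using post t by blast
qed

text \<open>The machine has no remainder operation; both operands are evaluated twice, which shows
  in \<open>esize\<close>.\<close>

definition Mod :: "expr \<Rightarrow> expr \<Rightarrow> expr" where
  "Mod a b = Sub a (Mul (Div a b) b)"

lemma val_Mod [simp]: "val (Mod a b) s = val a s mod val b s"
  by (simp add: Mod_def minus_div_mult_eq_mod)

lemma ok_Mod [simp]: "lits_bd W (Mod a b) = (lits_bd W a \<and> lits_bd W b)"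
  "esize (Mod a b) = Suc (Suc (Suc (2 * esize a + 2 * esize b)))"
  by (auto simp: Mod_def)

text \<open>Register 22 is reserved for the counter of this loop; the register names introduced
  later leave it out.\<close>

definition Pow_to :: "nat \<Rightarrow> nat \<Rightarrow> nat \<Rightarrow> prog" where
  "Pow_to r b e = Seq (Assign r (Lit 1)) (For 22 e (Assign r (Mul (Reg r) (Reg b))))"

lemma mods_Pow_to [simp]: "mods (Pow_to r b e) = {22, r}"
  by (auto simp: Pow_to_def)

lemma nostore_Pow_to [simp]: "nostore (Pow_to r b e)"
  by (auto simp: Pow_to_def)

lemma tc_Pow_to:
  assumes "1 \<le> W" "distinct [22, r, b, e]" "1 \<le> reg s b" "reg s b ^ reg s e < 2 ^ W"
    and "\<And>s'. keeps (Pow_to r b e) s s' \<Longrightarrow> bd W s' \<Longrightarrow> reg s' r = reg s b ^ reg s e \<Longrightarrow> Q s'"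
  shows "tc W (Pow_to r b e) s (reg s e * 3 + 3) Q"
proof -
  have "tc W (Pow_to r b e) s (1 + (reg (upd s r 1) e * (1 + 2) + 2)) (\<lambda>s'. reg s' r = reg s b ^ reg s e)"
    unfolding Pow_to_def
  proof (rule tc_SeqI)
    show "tc W (Assign r (Lit 1)) s 1 (\<lambda>s'. s' = upd s r 1)"
      using assms(1) by (intro tc_Assign) (auto simp: ok_def)
    fix s' assume s': "s' = upd s r 1"
    show "tc W (For 22 e (Assign r (Mul (Reg r) (Reg b)))) s' (reg (upd s r 1) e * (1 + 2) + 2)
      (\<lambda>s'. reg s' r = reg s b ^ reg s e)"
      unfolding s'
    proof (rule tc_For[where Inv = "\<lambda>c s'. reg s' r = reg s b ^ c"])
      fix c s' assume c: "c < reg (upd s r 1) e" and I: "reg s' r = reg s b ^ c"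
        and k: "keeps (For 22 e (Assign r (Mul (Reg r) (Reg b)))) (upd s r 1) s'"
      have b: "reg s' b = reg s b" using keeps_reg[OF k, of b] assms(2) by auto
      \<comment> \<open>A base of at least 1 makes the final power the largest one computed.\<close>
      have "reg s b ^ Suc c \<le> reg s b ^ reg s e"
        using assms(2,3) c by (intro power_increasing) auto
      then have "reg s b ^ Suc c < 2 ^ W" using assms(4) by linarith
      then show "tc W (Assign r (Mul (Reg r) (Reg b))) s' 1 (\<lambda>s''. reg (upd s'' 22 (Suc c)) r = reg s b ^ Suc c)"
        using assms(1,2) I b by (intro tc_Assign) (auto simp: ok_def mult.commute)
    qed (use assms in auto)
  qed
  then show ?thesis
    by (rule tc_conseq) (use assms in auto)
qed

section \<open>Cyclic permutations, coded subsets and remainders\<close>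

subsection \<open>Cyclic permutations\<close>

lemma wt_eq_prod:
  "wt M u w t = (\<Prod>i<Suc (length w). M ((u # w) ! i) ((w @ [t]) ! i))"
  by (induction w arbitrary: u) (simp_all add: prod.lessThan_Suc_shift del: prod.lessThan_Suc)

lemma cycle_of_list_nth:
  assumes "distinct L" "i < length L"
  shows "cycle_of_list L (L ! i) = L ! (Suc i mod length L)"
proof -
  have "map (cycle_of_list L) L = rotate1 L" using cyclic_rotation[OF assms(1), of 1] by simp
  then have "map (cycle_of_list L) L ! i = rotate1 L ! i" by simp
  then show ?thesis using assms(2) by (simp add: nth_rotate1)
qed

lemma cycle_of_list_funpow:
  assumes "distinct L" "i < length L"
  shows "(cycle_of_list L ^^ i) (L ! 0) = L ! i"
  using assms(2)
proof (induction i)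
  case (Suc i)
  then show ?case using cycle_of_list_nth[OF assms(1), of i] by simp
qed simp

lemma cycle_of_list_cyclic_on:
  assumes "distinct L" "L \<noteq> []"
  shows "cyclic_on (cycle_of_list L) (set L)"
proof -
  have "set L \<subseteq> orbit (cycle_of_list L) (L ! 0)"
  proof
    fix v assume "v \<in> set L"
    then obtain i where i: "i < length L" "v = L ! i" by (metis in_set_conv_nth)
    have "(cycle_of_list L ^^ (i + length L)) (L ! 0) = v"
      using i cycle_of_list_funpow[OF assms(1) i(1)] cycle_is_id_root[OF assms(1)]
      by (simp add: funpow_add)
    moreover have "0 < i + length L" using assms(2) by simp
    ultimately show "v \<in> orbit (cycle_of_list L) (L ! 0)" unfolding orbit_altdef by blast
  qed
  moreover have "orbit (cycle_of_list L) (L ! 0) \<subseteq> set L"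
    by (rule permutes_orbit_subset[OF cycle_permutes]) (use assms(2) in simp)
  ultimately show ?thesis unfolding cyclic_on_def using assms(2) by (metis nth_mem length_greater_0_conv subset_antisym)
qed

text \<open>The list is the orbit of s; prescribing its head removes the choice of a
  rotation.\<close>

lemma cyclic_on_list:
  assumes "\<sigma> permutes V" "cyclic_on \<sigma> V" "s \<in> V"
  obtains L where "distinct L" "set L = V" "L \<noteq> []" "hd L = s" "cycle_of_list L = \<sigma>"
proof -
  have orb: "V = orbit \<sigma> s" using assms(2,3) by (auto simp: cyclic_on_alldef)
  have so: "s \<in> orbit \<sigma> s" using orb assms(3) by simp
  define n where "n = funpow_dist1 \<sigma> s s"
  define L where "L = map (\<lambda>k. (\<sigma> ^^ k) s) [0..<n]"
  have ns: "(\<sigma> ^^ n) s = s" unfolding n_def by (rule funpow_dist1_prop[OF so])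
  have n0: "n > 0" by (simp add: n_def)
  have set_L: "set L = V"
    using orbit_conv_funpow_dist1[OF so, folded n_def] orb by (simp add: L_def)
  have dL: "distinct L"
    using inj_on_funpow_dist1[OF so, folded n_def] by (simp add: L_def distinct_map)
  have "cycle_of_list L v = \<sigma> v" for v
  proof (cases "v \<in> V")
    case True
    then obtain i where i: "i < n" "v = (\<sigma> ^^ i) s"
      using set_L by (auto simp: L_def)
    have "cycle_of_list L (L ! i) = L ! (Suc i mod length L)"
      by (rule cycle_of_list_nth[OF dL]) (simp add: L_def i)
    also have "\<dots> = (\<sigma> ^^ Suc i) s"
      using i ns n0 by (cases "Suc i = n") (auto simp: L_def)
    finally show ?thesis using i by (simp add: L_def)
  next
    case False
    then show ?thesis
      using id_outside_supp[of v L] set_L assms(1) by (simp add: permutes_def)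
  qed
  then have "cycle_of_list L = \<sigma>" by auto
  moreover have "L \<noteq> []" "hd L = s" using n0 by (simp_all add: L_def hd_map)
  ultimately show ?thesis using that dL set_L by blast
qed

text \<open>A cyclic permutation of {1..n} corresponds to the order in which it visits the vertices
  after 1, shifted down by one since \<open>hc\<close> numbers vertices from 0.\<close>

lemma sum_cyclic_permutations:
  fixes m :: "nat \<Rightarrow> nat \<Rightarrow> nat"
  assumes n: "1 \<le> n"
  shows "(\<Sum>\<sigma> | \<sigma> permutes {1..n} \<and> cyclic_on \<sigma> {1..n}. \<Prod>v\<in>{1..n}. m v (\<sigma> v)) =
    hc (\<lambda>u v. m (u + 1) (v + 1)) n"
proof -
  let ?P = "{\<sigma>. \<sigma> permutes {1..n} \<and> cyclic_on \<sigma> {1..n}}"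
  let ?W = "permutations_of_set {1..<n}"
  define C where "C w = 1 # map Suc w" for w
  have C: "distinct (C w)" "set (C w) = {1..n}" "length (C w) = n" "length w = n - 1" if "w \<in> ?W" for w
  proof -
    have w: "set w = {1..<n}" "distinct w" using that by (auto dest: permutations_of_setD)
    show "distinct (C w)" using w by (auto simp: C_def distinct_map)
    have "Suc ` {1..<n} = {2..n}" by (auto simp: image_Suc_atLeastLessThan)
    then show "set (C w) = {1..n}" using w n by (auto simp: C_def)
    show "length w = n - 1" using length_finite_permutations_of_set[OF that] by simp
    then show "length (C w) = n" using n by (simp add: C_def)
  qed
  have bij: "bij_betw (\<lambda>w. cycle_of_list (C w)) ?W ?P"
  proof (rule bij_betwI')
    fix x y assume xy: "x \<in> ?W" "y \<in> ?W"
    show "(cycle_of_list (C x) = cycle_of_list (C y)) = (x = y)"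
    proof
      assume eq: "cycle_of_list (C x) = cycle_of_list (C y)"
      \<comment> \<open>Applying the permutation i times to vertex 1 reads off element i of the
        list, so the permutation determines the list.\<close>
      have "C x ! i = C y ! i" if "i < n" for i
        using cycle_of_list_funpow[OF C(1), of x i] cycle_of_list_funpow[OF C(1), of y i] xy that
        by (simp add: C eq) (simp add: C_def)
      then have "C x = C y" using xy by (intro nth_equalityI) (auto simp: C)
      then show "x = y" by (simp add: C_def inj_map_eq_map)
    qed auto
  next
    fix w assume w: "w \<in> ?W"
    then have "cycle_of_list (C w) permutes {1..n}" using cycle_permutes[of "C w"] C by simp
    moreover have "cyclic_on (cycle_of_list (C w)) {1..n}"
      using cycle_of_list_cyclic_on[of "C w"] C w by (simp add: C_def)
    ultimately show "cycle_of_list (C w) \<in> ?P" by simp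
  next
    fix \<sigma> assume \<sigma>: "\<sigma> \<in> ?P"
    then obtain L where L: "distinct L" "set L = {1..n}" "L \<noteq> []" "hd L = 1" "cycle_of_list L = \<sigma>"
      using cyclic_on_list[of \<sigma> "{1..n}" 1] n by auto
    then obtain L' where L': "L = 1 # L'" by (cases L) auto
    have "set L' = set L - {1}" using L(1) unfolding L' by simp
    also have "\<dots> = {2..n}" unfolding L(2) by auto
    finally have sL': "set L' = {2..n}" .
    define w where "w = map (\<lambda>x. x - 1) L'"
    have "map Suc w = L'" using sL' by (auto simp: w_def intro!: map_idI)
    then have Cw: "C w = L" by (simp add: C_def L')
    have "set w = {1..<n}"
    proof -
      have "Suc ` set w = Suc ` {1..<n}"
        using arg_cong[OF \<open>map Suc w = L'\<close>, of set] sL' by (auto simp: image_Suc_atLeastLessThan)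
      then show ?thesis by (rule inj_image_eq_iff[OF inj_Suc, THEN iffD1])
    qed
    moreover have "distinct w" using L(1) L' \<open>map Suc w = L'\<close> by (metis distinct.simps(2) distinct_map)
    ultimately have "w \<in> ?W" by auto
    then show "\<exists>w\<in>?W. \<sigma> = cycle_of_list (C w)" using Cw L by blast
  qed
  have "(\<Sum>\<sigma>\<in>?P. \<Prod>v\<in>{1..n}. m v (\<sigma> v)) = (\<Sum>w\<in>?W. \<Prod>v\<in>{1..n}. m v (cycle_of_list (C w) v))"
    by (rule sum.reindex_bij_betw[OF bij, symmetric])
  also have "\<dots> = (\<Sum>w\<in>?W. wt (\<lambda>u v. m (u + 1) (v + 1)) 0 w 0)"
  proof (rule sum.cong[OF refl])
    fix w assume w: "w \<in> ?W"
    have "(\<Prod>v\<in>{1..n}. m v (cycle_of_list (C w) v)) = (\<Prod>i<n. m (C w ! i) (cycle_of_list (C w) (C w ! i)))"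
    proof -
      have "bij_betw (\<lambda>i. C w ! i) {..<n} {1..n}"
        by (rule bij_betw_nth[OF C(1)[OF w]]) (simp_all add: C(2,3)[OF w])
      from prod.reindex_bij_betw[OF this, of "\<lambda>v. m v (cycle_of_list (C w) v)"] show ?thesis by simp
    qed
    also have "\<dots> = (\<Prod>i<n. m (C w ! i) (C w ! (Suc i mod n)))"
      using cycle_of_list_nth[OF C(1)[OF w]] C(3)[OF w] by simp
    \<comment> \<open>The wrap-around modulo n is the arc back to vertex 1, matched by the 0
      appended to w.\<close>
    also have "\<dots> = (\<Prod>i<n. m ((0 # w) ! i + 1) ((w @ [0]) ! i + 1))"
    proof (rule prod.cong[OF refl])
      fix i assume "i \<in> {..<n}"
      then have i: "i < n" by simp
      have a: "C w ! i = (0 # w) ! i + 1"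
        using i C(4)[OF w] by (cases i) (auto simp: C_def)
      have b: "C w ! (Suc i mod n) = (w @ [0]) ! i + 1"
      proof (cases "Suc i = n")
        case True
        then show ?thesis using C(4)[OF w] by (auto simp: C_def nth_append)
      next
        case False
        then have "Suc i < n" "i < n - 1" using i by auto
        then show ?thesis using C(4)[OF w] by (simp add: C_def nth_append)
      qed
      show "m (C w ! i) (C w ! (Suc i mod n)) = m ((0 # w) ! i + 1) ((w @ [0]) ! i + 1)"
        by (simp only: a b)
    qed
    also have "\<dots> = wt (\<lambda>u v. m (u + 1) (v + 1)) 0 w 0"
      unfolding wt_eq_prod using C(4)[OF w] n by simp
    finally show "(\<Prod>v\<in>{1..n}. m v (cycle_of_list (C w) v)) = wt (\<lambda>u v. m (u + 1) (v + 1)) 0 w 0" .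
  qed
  finally show ?thesis by (simp add: hc_def hc_from_def)
qed

lemma num_hamiltonian_cycles_hc:
  assumes "fin_digraph G" "verts G = {1..n}" "1 \<le> n"
  shows "num_hamiltonian_cycles G = hc (\<lambda>u v. multiplicity_of G (u + 1) (v + 1)) n"
  using num_hamiltonian_cycles_eq[OF assms(1)] sum_cyclic_permutations[OF assms(3)] assms(2) by simp

lemma num_hamiltonian_cycles_empty:
  assumes "fin_digraph G" "verts G = {}"
  shows "num_hamiltonian_cycles G = 0"
  using num_hamiltonian_cycles_eq[OF assms(1)] assms(2) by (simp add: cyclic_on_def)

subsection \<open>Subsets as numbers\<close>

text \<open>The bits of c select a subset of the vertices from k on; the program runs over the
  numbers c and never stores a set.\<close>

definition dec :: "nat \<Rightarrow> nat \<Rightarrow> nat set" where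
  "dec k c = (+) k ` set_decode c"

text \<open>This counts the vertices left out of the subset; its parity is the sign of the
  inclusion-exclusion term.\<close>

definition zeros :: "nat \<Rightarrow> nat \<Rightarrow> nat" where
  "zeros e c = card {x. x < e \<and> even (c div 2 ^ x)}"

lemma set_decode_subset: "c < 2 ^ e \<Longrightarrow> set_decode c \<subseteq> {..<e}"
proof
  fix x assume c: "c < 2 ^ e" and x: "x \<in> set_decode c"
  show "x \<in> {..<e}"
  proof (rule ccontr)
    assume "x \<notin> {..<e}"
    then have "(2::nat) ^ e \<le> 2 ^ x" by (intro power_increasing) auto
    then have "c < 2 ^ x" using c by linarith
    then have "c div 2 ^ x = 0" by simp
    then show False using x by (simp add: set_decode_def)
  qed
qed

lemma bij_betw_set_decode: "bij_betw set_decode {..<2 ^ e} (Pow {..<e})"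
proof (rule bij_betwI[where g = set_encode])
  show "set_decode \<in> {..<2 ^ e} \<rightarrow> Pow {..<e}" using set_decode_subset by auto
  show "set_encode \<in> Pow {..<e} \<rightarrow> {..<2 ^ e}"
  proof
    fix X assume "X \<in> Pow {..<e}"
    then have "set_encode X \<le> (\<Sum>i<e. 2 ^ i)"
      unfolding set_encode_def by (intro sum_mono2) auto
    also have "\<dots> < 2 ^ e" by (induction e) auto
    finally show "set_encode X \<in> {..<2 ^ e}" by simp
  qed
  show "set_encode (set_decode c) = c" for c by simp
  show "set_decode (set_encode X) = X" if "X \<in> Pow {..<e}" for X
    using that by (intro set_encode_inverse) (auto intro: finite_subset)
qed

lemma sum_Pow_dec:
  assumes "k \<le> n"
  shows "(\<Sum>X\<in>Pow {k..<n}. f X) = (\<Sum>c<2 ^ (n - k). f (dec k c))"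
proof -
  have im: "(+) k ` {..<n - k} = {k..<n}"
    using assms by (auto simp: lessThan_atLeast0)
  have "bij_betw ((`) ((+) k)) (Pow {..<n - k}) (Pow {k..<n})"
    using bij_betw_Pow[of "(+) k" "{..<n - k}" "{k..<n}"] im by (simp add: bij_betw_def)
  from bij_betw_trans[OF bij_betw_set_decode this]
  have "bij_betw (dec k) {..<2 ^ (n - k)} (Pow {k..<n})"
    by (simp add: dec_def[abs_def] comp_def)
  then show ?thesis by (rule sum.reindex_bij_betw[symmetric])
qed

lemma dec_subset: "k \<le> n \<Longrightarrow> c < 2 ^ (n - k) \<Longrightarrow> dec k c \<subseteq> {k..<n}"
  using set_decode_subset[of c "n - k"] by (auto simp: dec_def)

text \<open>The sum runs over all bit positions, with a parity test, because the machine scans the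
  bits by repeated halving.\<close>

lemma sum_dec:
  assumes "c < 2 ^ e"
  shows "(\<Sum>x\<in>dec k c. g x) = (\<Sum>x<e. if odd (c div 2 ^ x) then g (k + x) else 0)"
proof -
  have "(\<Sum>x\<in>dec k c. g x) = (\<Sum>x\<in>set_decode c. g (k + x))"
    unfolding dec_def by (subst sum.reindex) auto
  also have "set_decode c = {x \<in> {..<e}. odd (c div 2 ^ x)}"
    using set_decode_subset[OF assms] by (auto simp: set_decode_def)
  also have "(\<Sum>x\<in>{x \<in> {..<e}. odd (c div 2 ^ x)}. g (k + x)) =
      (\<Sum>x<e. if odd (c div 2 ^ x) then g (k + x) else 0)"
    by (rule sum.inter_filter) simp
  finally show ?thesis .
qed

lemma card_diff_dec:
  assumes "k \<le> n" "c < 2 ^ (n - k)"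
  shows "card ({k..<n} - dec k c) = zeros (n - k) c"
proof -
  have "{k..<n} - dec k c = (+) k ` {x. x < n - k \<and> even (c div 2 ^ x)}"
  proof (intro equalityI subsetI)
    fix y assume y: "y \<in> {k..<n} - dec k c"
    then have "y = k + (y - k)" "y - k < n - k" by auto
    moreover have "even (c div 2 ^ (y - k))"
      using y by (auto simp: dec_def set_decode_def image_iff)
    ultimately show "y \<in> (+) k ` {x. x < n - k \<and> even (c div 2 ^ x)}" by blast
  qed (auto simp: dec_def set_decode_def)
  then show ?thesis by (simp add: zeros_def card_image)
qed

definition yval :: "(nat \<Rightarrow> nat \<Rightarrow> nat) \<Rightarrow> nat \<Rightarrow> nat \<Rightarrow> nat \<Rightarrow> nat \<Rightarrow> nat" where
  "yval A n k B c = (hc (kq B A (dec k c) n) k div B ^ n) mod B"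

text \<open>Registers hold only naturals, so positive and negative terms are summed apart. The
  truncated difference is the true one, since the integer difference equals a natural
  number.\<close>

lemma hc_eq_diff:
  fixes A :: "nat \<Rightarrow> nat \<Rightarrow> nat"
  assumes "1 \<le> k" "k \<le> n" "\<And>u v. u < n \<Longrightarrow> v < n \<Longrightarrow> A u v \<le> a"
    and B: "n ^ n * (a * n + 1) ^ (n * n) < B"
  shows "hc A n =
    (\<Sum>c<2 ^ (n - k). if even (zeros (n - k) c) then yval A n k B c else 0) -
    (\<Sum>c<2 ^ (n - k). if even (zeros (n - k) c) then 0 else yval A n k B c)"
proof -
  note hc_inclusion_exclusion[OF assms]
  also have "(\<Sum>X\<in>Pow {k..<n}. (- 1) ^ card ({k..<n} - X) * int (hc (kq B A X n) k div B ^ n mod B)) =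
    (\<Sum>c<2 ^ (n - k). (- 1) ^ card ({k..<n} - dec k c) * int (yval A n k B c))"
    by (simp only: sum_Pow_dec[OF assms(2)] yval_def)
  also have "\<dots> = (\<Sum>c<2 ^ (n - k).
      int (if even (zeros (n - k) c) then yval A n k B c else 0) -
      int (if even (zeros (n - k) c) then 0 else yval A n k B c))"
    by (intro sum.cong refl) (simp add: card_diff_dec[OF assms(2)])
  also have "\<dots> = int (\<Sum>c<2 ^ (n - k). if even (zeros (n - k) c) then yval A n k B c else 0) -
    int (\<Sum>c<2 ^ (n - k). if even (zeros (n - k) c) then 0 else yval A n k B c)"
    by (simp only: sum_subtractf of_nat_sum)
  finally show ?thesis by linarith
qed

subsection \<open>Least common multiples and Chinese remaindering\<close>

primrec lcm_upto :: "nat \<Rightarrow> nat" where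
  "lcm_upto 0 = 1"
| "lcm_upto (Suc m) = lcm (lcm_upto m) (Suc m)"

lemma lcm_upto_pos: "0 < lcm_upto n"
  by (induction n) (auto simp: lcm_pos_nat)

lemma dvd_lcm_upto: "1 \<le> i \<Longrightarrow> i \<le> n \<Longrightarrow> i dvd lcm_upto n"
proof (induction n)
  case (Suc n)
  then show ?case by (cases "i = Suc n") auto
qed simp

lemma lcm_upto_le: "lcm_upto n \<le> n ^ n"
proof -
  have "lcm_upto n \<le> fact n"
  proof (induction n)
    case (Suc n)
    have "lcm_upto (Suc n) \<le> lcm_upto n * Suc n"
      unfolding lcm_upto.simps using lcm_upto_pos[of n] by (intro dvd_imp_le lcm_least dvd_triv_left dvd_triv_right) auto
    also have "\<dots> \<le> fact n * Suc n" by (rule mult_le_mono1[OF Suc])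
    also have "\<dots> = fact (Suc n)" by simp
    finally show ?case .
  qed simp
  also have "\<dots> \<le> n ^ n" using fact_le_power[of n, where 'a=nat] by simp
  finally show ?thesis .
qed

text \<open>The ratio of both sides is the beta integral of \<open>x\<^sup>a (1 - x)\<^sup>b\<close>, an integer combination
  of \<open>1, 1/2, \<dots>, 1/N\<close>.\<close>

lemma fact_dvd_lcm_upto:
  "a + b + 1 \<le> N \<Longrightarrow> fact (a + b + 1) dvd lcm_upto N * fact a * fact b"
proof (induction b arbitrary: a)
  case 0
  then have "(a + 1) * fact a dvd lcm_upto N * fact a"
    by (intro mult_dvd_mono dvd_lcm_upto) auto
  then show ?case by simp
next
  case (Suc b)
  let ?L = "lcm_upto N"
  have "fact (a + b + 1) dvd ?L * fact a * fact b" using Suc.prems by (intro Suc.IH) simp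
  then have "(a + b + 2) * fact (a + b + 1) dvd (a + b + 2) * (?L * fact a * fact b)"
    by (rule mult_dvd_mono[OF dvd_refl])
  then have 1: "fact (a + Suc b + 1) dvd (a + b + 2) * (?L * fact a * fact b)" by simp
  have "fact (Suc a + b + 1) dvd ?L * fact (Suc a) * fact b" using Suc.prems by (intro Suc.IH) simp
  then have 2: "fact (a + Suc b + 1) dvd (a + 1) * (?L * fact a * fact b)" by (simp add: algebra_simps)
  \<comment> \<open>This is the integral of x^a (1-x)^(b+1) = x^a (1-x)^b - x^(a+1) (1-x)^b, cleared
    of denominators.\<close>
  have "(a + b + 2) * (?L * fact a * fact b) - (a + 1) * (?L * fact a * fact b) =
    ?L * fact a * fact (Suc b)"
    by (simp add: diff_mult_distrib[symmetric] algebra_simps)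
  then show ?case using dvd_diff_nat[OF 1 2] by simp
qed

text \<open>With a = b = m, the integer (2m+1)!/(m!)^2 divides the lcm, and by induction it is at
  least 4^m. Hence the residues modulo all numbers up to 2m+1 determine any value below 4^m.\<close>

lemma four_power_le_lcm_upto: "4 ^ m \<le> lcm_upto (2 * m + 1)"
proof -
  have "4 ^ m * (fact m * fact m) \<le> (fact (2 * m + 1) :: nat)"
  proof (induction m)
    case (Suc m)
    have "4 ^ Suc m * (fact (Suc m) * fact (Suc m)) = 4 * (m + 1) * (m + 1) * (4 ^ m * (fact m * fact m) :: nat)"
      by (simp add: algebra_simps)
    also have "\<dots> \<le> ((2 * m + 3) * (2 * m + 2)) * fact (2 * m + 1)"
      by (rule mult_le_mono[OF _ Suc]) (simp add: algebra_simps)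
    also have "\<dots> = fact (2 * Suc m + 1)" by (simp add: algebra_simps)
    finally show ?case .
  qed simp
  also have "fact (2 * m + 1) \<le> lcm_upto (2 * m + 1) * (fact m * fact m)"
    using fact_dvd_lcm_upto[of m m "2 * m + 1"] lcm_upto_pos[of "2 * m + 1"]
    by (intro dvd_imp_le) (simp_all add: mult_2 mult.assoc del: lcm_upto.simps)
  finally show ?thesis by simp
qed

text \<open>The target is \<open>y mod lcm L m\<close>, known modulo L and modulo m. The candidate z
  starts at \<open>y mod L\<close> and moves by L; it never passes the target, and it has either met
  the residue modulo m or made at least j moves.\<close>

definition crt_inv :: "nat \<Rightarrow> nat \<Rightarrow> nat \<Rightarrow> nat \<Rightarrow> nat \<Rightarrow> bool" where
  "crt_inv L m y j z \<longleftrightarrow> z \<le> y mod lcm L m \<and> L dvd (y mod lcm L m - z) \<and>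
     (z mod m = y mod m \<or> j * L \<le> z)"

lemma mod_lcm_mod: "(y mod lcm L m) mod m = y mod m" "(y mod lcm L m) mod L = y mod (L::nat)"
  by (simp_all add: mod_mod_cancel)

lemma crt_inv_init: "crt_inv L m y 0 (y mod L)"
proof -
  have e: "y mod L = (y mod lcm L m) mod L" by (simp only: mod_lcm_mod)
  have "L dvd (y mod lcm L m - y mod L)" unfolding e by (rule dvd_minus_mod)
  moreover have "y mod L \<le> y mod lcm L m" unfolding e by (rule mod_less_eq_dividend)
  ultimately show ?thesis by (simp add: crt_inv_def)
qed

text \<open>A candidate with the wrong residue modulo m differs from the target, hence lies at least
  L below it: the move does not overshoot.\<close>

lemma crt_inv_step:
  assumes "crt_inv L m y j z"
  shows "crt_inv L m y (Suc j) (if z mod m = y mod m then z else z + L)"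
proof (cases "z mod m = y mod m")
  case False
  let ?y = "y mod lcm L m"
  have z: "z \<le> ?y" "L dvd ?y - z" "j * L \<le> z" using assms False by (auto simp: crt_inv_def)
  have "z \<noteq> ?y" using False mod_lcm_mod(1) by metis
  then have "L \<le> ?y - z" using z by (intro dvd_imp_le) auto
  moreover have "L dvd ?y - (z + L)" using z(2) dvd_diff_nat[OF z(2), of L] by (simp add: diff_diff_eq)
  ultimately show ?thesis using z False by (auto simp: crt_inv_def)
qed (use assms in \<open>auto simp: crt_inv_def\<close>)

text \<open>After m moves z would be at least \<open>m * L\<close>, beyond the target, which is
  below \<open>lcm L m\<close>; so the residue modulo m has been met.\<close>

lemma crt_inv_final:
  assumes "crt_inv L m y m z" "0 < L" "0 < m"
  shows "z = y mod lcm L m"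
proof -
  let ?y = "y mod lcm L m"
  have z: "z \<le> ?y" "L dvd ?y - z" "z mod m = y mod m \<or> m * L \<le> z"
    using assms by (auto simp: crt_inv_def)
  have pos: "0 < lcm L m" using assms by (simp add: lcm_pos_nat)
  then have lt: "?y < lcm L m" by simp
  also have "\<dots> \<le> L * m" using assms by (intro dvd_imp_le lcm_least) auto
  finally have "z mod m = y mod m" using z by (auto simp: mult.commute)
  then have "z mod m = ?y mod m" by (simp only: mod_lcm_mod)
  then have "m dvd ?y - z" using z(1) by (metis mod_eq_dvd_iff_nat)
  then have "lcm L m dvd ?y - z" using z(2) by simp
  then have "?y - z = 0" using lt by (meson dvd_imp_le less_imp_diff_less linorder_not_less neq0_conv)
  then show ?thesis using z(1) by simp
qed

text \<open>The same search for \<open>lcm L m\<close> itself among the positive multiples of L. It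
  starts at L, not at 0, which is why j moves give \<open>Suc j * L\<close>.\<close>

definition lcm_inv :: "nat \<Rightarrow> nat \<Rightarrow> nat \<Rightarrow> nat \<Rightarrow> bool" where
  "lcm_inv L m j z \<longleftrightarrow> z \<le> lcm L m \<and> L dvd z \<and> (m dvd z \<or> Suc j * L \<le> z) \<and> 0 < z"

lemma lcm_inv_init: "0 < L \<Longrightarrow> 0 < m \<Longrightarrow> lcm_inv L m 0 L"
  using dvd_imp_le[of L "lcm L m"] by (simp add: lcm_inv_def lcm_pos_nat)

lemma lcm_inv_step:
  assumes "lcm_inv L m j z"
  shows "lcm_inv L m (Suc j) (if z mod m = 0 then z else z + L)"
proof (cases "z mod m = 0")
  case False
  let ?y = "lcm L m"
  have z: "z \<le> ?y" "L dvd z" "Suc j * L \<le> z" "0 < z"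
    using assms False by (auto simp: lcm_inv_def dvd_eq_mod_eq_0)
  have "z \<noteq> ?y" using False by (metis dvd_eq_mod_eq_0 dvd_lcm2)
  moreover have "L dvd ?y - z" using z by (intro dvd_diff_nat) auto
  ultimately have "L \<le> ?y - z" using z by (intro dvd_imp_le) auto
  then show ?thesis using z False by (auto simp: lcm_inv_def)
qed (use assms in \<open>auto simp: lcm_inv_def dvd_eq_mod_eq_0\<close>)

lemma lcm_inv_final:
  assumes "lcm_inv L m m z" "0 < L" "0 < m"
  shows "z = lcm L m"
proof -
  have z: "z \<le> lcm L m" "L dvd z" "m dvd z \<or> Suc m * L \<le> z" "0 < z"
    using assms by (auto simp: lcm_inv_def)
  have "lcm L m \<le> m * L" using assms by (intro dvd_imp_le lcm_least) auto
  also have "\<dots> < Suc m * L" using assms by simp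
  finally have "m dvd z" using z by auto
  then have "lcm L m \<le> z" using z by (intro dvd_imp_le lcm_least) auto
  then show ?thesis using z by simp
qed

section \<open>The routines and their correctness\<close>

subsection \<open>Evaluating walk generating functions\<close>

lemma tc_For_eq:
  assumes "1 \<le> W" "reg s b = m" "i \<notin> mods P" "b \<notin> mods P" "i \<noteq> b"
    and "Inv 0 (upd s i 0)"
    and "\<And>c s'. c < m \<Longrightarrow> Inv c s' \<Longrightarrow> reg s' i = c \<Longrightarrow> keeps (For i b P) s s' \<Longrightarrow> bd W s' \<Longrightarrow>
      tc W P s' j (\<lambda>s''. Inv (Suc c) (upd s'' i (Suc c)))"
    and "\<And>s'. Inv m s' \<Longrightarrow> reg s' i = m \<Longrightarrow> keeps (For i b P) s s' \<Longrightarrow> bd W s' \<Longrightarrow> Q s'"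
  shows "tc W (For i b P) s (m * (j + 2) + 2) Q"
  using tc_For[of W i P b Inv s j Q] assms by auto

lemma tc_Assign_Seq:
  assumes "tc W P (upd s r v) j Q" "1 \<le> W" "ok W e" "val e s = v" "v < 2 ^ W"
  shows "tc W (Seq (Assign r e) P) s (1 + j) Q"
  by (rule tc_Seq, rule tc_Assign) (use assms in auto)

lemma bd_reg: "bd W s \<Longrightarrow> reg s r < 2 ^ W"
  by (simp add: bd_def)

lemma bd_mem: "bd W s \<Longrightarrow> mem s a < 2 ^ W"
  by (simp add: bd_def)

text \<open>Row-major addresses of a matrix, and of a stack of matrices in which l is the
  level.\<close>

lemma two_dim_index:
  fixes x v \<nu> l :: nat
  assumes "x < \<nu>" "v < \<nu>"
  shows "(x * \<nu> + v) div \<nu> = x" "(x * \<nu> + v) mod \<nu> = v" "x * \<nu> + v < \<nu> * \<nu>"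
    "(l * (\<nu> * \<nu>) + (x * \<nu> + v)) div (\<nu> * \<nu>) = l" "(l * (\<nu> * \<nu>) + (x * \<nu> + v)) mod (\<nu> * \<nu>) = x * \<nu> + v"
proof -
  show "(x * \<nu> + v) div \<nu> = x" "(x * \<nu> + v) mod \<nu> = v" using assms by auto
  have "x * \<nu> + v < (x + 1) * \<nu>" using assms by simp
  also have "\<dots> \<le> \<nu> * \<nu>" using assms by (intro mult_le_mono) auto
  finally show lt: "x * \<nu> + v < \<nu> * \<nu>" .
  then show "(l * (\<nu> * \<nu>) + (x * \<nu> + v)) div (\<nu> * \<nu>) = l" "(l * (\<nu> * \<nu>) + (x * \<nu> + v)) mod (\<nu> * \<nu>) = x * \<nu> + v"
    using assms by (auto simp: div_mult_self3)
qed

text \<open>Register names. An instance of the counting routine has size \<open>rN\<close>, its first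
  \<open>rK\<close> vertices are the ones treated by the inner program, its matrix starts at address
  \<open>rA\<close>, and scratch space starts at \<open>rQ\<close>.\<close>

abbreviation (input) rN :: nat where "rN \<equiv> 2"
abbreviation (input) rK :: nat where "rK \<equiv> 3"
abbreviation (input) rA :: nat where "rA \<equiv> 4"
abbreviation (input) rQ :: nat where "rQ \<equiv> 5"
abbreviation (input) rB :: nat where "rB \<equiv> 6"
abbreviation (input) rE :: nat where "rE \<equiv> 7"
abbreviation (input) rX :: nat where "rX \<equiv> 8"
abbreviation (input) rSq :: nat where "rSq \<equiv> 9"
abbreviation (input) rCu :: nat where "rCu \<equiv> 10"
abbreviation (input) rBn :: nat where "rBn \<equiv> 11"
abbreviation (input) rPos :: nat where "rPos \<equiv> 12"
abbreviation (input) rNeg :: nat where "rNeg \<equiv> 13"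
abbreviation (input) rS :: nat where "rS \<equiv> 14"
abbreviation (input) rT :: nat where "rT \<equiv> 15"
abbreviation (input) rU :: nat where "rU \<equiv> 16"
abbreviation (input) rV :: nat where "rV \<equiv> 17"
abbreviation (input) rAcc :: nat where "rAcc \<equiv> 18"
abbreviation (input) rBits :: nat where "rBits \<equiv> 19"
abbreviation (input) rI :: nat where "rI \<equiv> 20"
abbreviation (input) rSg :: nat where "rSg \<equiv> 21"
abbreviation (input) rY :: nat where "rY \<equiv> 23"
abbreviation (input) rTwo :: nat where "rTwo \<equiv> 24"

text \<open>This is the sum over X in the recursion of \<open>kq\<close>; the current bit of
  \<open>rBits\<close> decides whether vertex \<open>rK + rI\<close> belongs to X. The index
  \<open>rT\<close> counts entries level by level, so \<open>rT div rSq * rSq\<close> is the offset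
  of the level that is read.\<close>

definition Row :: prog where
  "Row = For rI rE (Seq
     (Cond (Mod (Reg rBits) (Lit 2))
       (Assign rAcc (Add (Reg rAcc) (Mul
         (Mem (Add (Reg rA) (Add (Mul (Reg rU) (Reg rN)) (Add (Reg rK) (Reg rI)))))
         (Mem (Add (Reg rQ) (Add (Mul (Div (Reg rT) (Reg rSq)) (Reg rSq))
           (Add (Mul (Add (Reg rK) (Reg rI)) (Reg rN)) (Reg rV))))))))
       Skip)
     (Assign rBits (Div (Reg rBits) (Lit 2))))"

lemma Row_frame [simp]: "mods Row = {rAcc, rBits, rI}" "nostore Row"
  by (auto simp: Row_def)

lemma tc_Row:
  fixes s :: state
  defines "g \<equiv> \<lambda>x. if odd (reg s rBits div 2 ^ x)
    then mem s (reg s rA + (reg s rU * reg s rN + (reg s rK + x))) *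
      mem s (reg s rQ + (reg s rT div reg s rSq * reg s rSq + ((reg s rK + x) * reg s rN + reg s rV)))
    else 0"
  assumes W: "2 \<le> W" and e: "reg s rE = e" and bnd: "reg s rAcc + (\<Sum>x<e. g x) < 2 ^ W"
  shows "tc W Row s (e * 5 + 2) (\<lambda>s'. reg s' rAcc = reg s rAcc + (\<Sum>x<e. g x))"
proof -
  let ?C = "Cond (Mod (Reg rBits) (Lit 2))
       (Assign rAcc (Add (Reg rAcc) (Mul
         (Mem (Add (Reg rA) (Add (Mul (Reg rU) (Reg rN)) (Add (Reg rK) (Reg rI)))))
         (Mem (Add (Reg rQ) (Add (Mul (Div (Reg rT) (Reg rSq)) (Reg rSq))
           (Add (Mul (Add (Reg rK) (Reg rI)) (Reg rN)) (Reg rV))))))))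
       Skip"
  let ?P = "Seq ?C
     (Assign rBits (Div (Reg rBits) (Lit 2)))"
  have "tc W (For rI rE ?P) s (e * (((1 + 1) + 1) + 2) + 2) (\<lambda>s'. reg s' rAcc = reg s rAcc + (\<Sum>x<e. g x))"
  proof (rule tc_For_eq[where Inv = "\<lambda>c s'. reg s' rAcc = reg s rAcc + (\<Sum>x<c. g x) \<and>
      reg s' rBits = reg s rBits div 2 ^ c"])
    fix c s' assume c: "c < e" and I: "reg s' rAcc = reg s rAcc + (\<Sum>x<c. g x) \<and> reg s' rBits = reg s rBits div 2 ^ c"
      and i: "reg s' rI = c" and k: "keeps (For rI rE ?P) s s'"
    have r: "reg s' rA = reg s rA" "reg s' rU = reg s rU" "reg s' rN = reg s rN" "reg s' rK = reg s rK"
      "reg s' rQ = reg s rQ" "reg s' rT = reg s rT" "reg s' rSq = reg s rSq" "reg s' rV = reg s rV"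
      using k by (simp_all add: keeps_reg)
    have m: "mem s' = mem s" using k by (rule keeps_mem) simp
    have "(\<Sum>x<Suc c. g x) \<le> (\<Sum>x<e. g x)" using c by (intro sum_mono2) auto
    then have b: "reg s rAcc + (\<Sum>x<c. g x) + g c < 2 ^ W" using bnd by simp
    have d: "reg s rBits div 2 ^ c div 2 = reg s rBits div (2 * 2 ^ c)"
      by (simp add: div_mult2_eq[symmetric] mult.commute)
    show "tc W ?P s' ((1 + 1) + 1) (\<lambda>s''. reg (upd s'' rI (Suc c)) rAcc = reg s rAcc + (\<Sum>x<Suc c. g x) \<and>
      reg (upd s'' rI (Suc c)) rBits = reg s rBits div 2 ^ Suc c)"
    proof (rule tc_SeqI)
      show "tc W ?C s' (1 + 1) (\<lambda>s''. reg s'' rAcc = reg s rAcc + (\<Sum>x<c. g x) + g c \<and> reg s'' rBits = reg s rBits div 2 ^ c)"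
        using W b I by (intro tc_Cond tc_Assign tc_Skip)
          (auto simp: ok_def i r m g_def odd_iff_mod_2_eq_one even_iff_mod_2_eq_zero)
    next
      fix s'' assume bd: "bd W s''" and I': "reg s'' rAcc = reg s rAcc + (\<Sum>x<c. g x) + g c \<and> reg s'' rBits = reg s rBits div 2 ^ c"
      have "reg s rBits div 2 ^ c div 2 < 2 ^ W"
        using bd_reg[OF bd, of rBits] I' by (metis div_le_dividend le_less_trans)
      then show "tc W (Assign rBits (Div (Reg rBits) (Lit 2))) s'' 1
        (\<lambda>s''. reg (upd s'' rI (Suc c)) rAcc = reg s rAcc + (\<Sum>x<Suc c. g x) \<and>
      reg (upd s'' rI (Suc c)) rBits = reg s rBits div 2 ^ Suc c)"
        using W I' by (intro tc_Assign) (auto simp: ok_def d)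
    qed
  qed (use W e in auto)
  then show ?thesis unfolding Row_def by (rule tc_le) simp
qed

text \<open>A single counter runs through all levels, rows and columns. The entry for
  \<open>rT\<close> is written \<open>rSq\<close> cells further up, that is, one level higher,
  because level 0 is the zero matrix.\<close>

definition Walk :: prog where
  "Walk = For rT rCu (Seq (Assign rU (Div (Mod (Reg rT) (Reg rSq)) (Reg rN)))
     (Seq (Assign rV (Mod (Reg rT) (Reg rN)))
     (Seq (Assign rAcc (Mem (Add (Reg rA) (Add (Mul (Reg rU) (Reg rN)) (Reg rV)))))
     (Seq (Assign rBits (Reg rS))
     (Seq Row
       (Store (Add (Reg rQ) (Add (Reg rSq) (Reg rT))) (Mul (Reg rAcc) (Reg rB))))))))"

lemma Walk_frame [simp]: "mods Walk = {rT, rU, rV, rAcc, rBits, rI}"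
  by (auto simp: Walk_def)

lemma kq_Suc_dec:
  assumes "c < 2 ^ e"
  shows "kq b A (dec k c) (Suc l) u v =
    (A u v + (\<Sum>x<e. if odd (c div 2 ^ x) then A u (k + x) * kq b A (dec k c) l (k + x) v else 0)) * b"
  using sum_dec[OF assms, where k = k and g = "\<lambda>x. A u x * kq b A (dec k c) l x v"]
  by (simp add: mult.commute)

text \<open>Entry \<open>(u, v)\<close> of the \<open>l\<close>-th iterate is kept at offset \<open>l \<nu>\<^sup>2 + u \<nu> + v\<close> of the scratch space.\<close>

lemma tc_Walk:
  assumes W: "2 \<le> W"
    and regs: "reg s rN = \<nu>" "reg s rK = k" "reg s rA = bA" "reg s rQ = bQ" "reg s rB = B"
      "reg s rE = \<nu> - k" "reg s rSq = \<nu> * \<nu>" "reg s rCu = \<nu> * (\<nu> * \<nu>)" "reg s rS = c"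
    and c: "c < 2 ^ (\<nu> - k)" and k: "k \<le> \<nu>" and \<nu>: "1 \<le> \<nu>" and B: "1 \<le> B"
    and A: "\<And>u v. u < \<nu> \<Longrightarrow> v < \<nu> \<Longrightarrow> mem s (bA + (u * \<nu> + v)) = A u v"
    and AQ: "bA + \<nu> * \<nu> \<le> bQ"
    and zero: "\<And>a. a < \<nu> * \<nu> \<Longrightarrow> mem s (bQ + a) = 0"
    and bnd: "\<And>l u v. l \<le> \<nu> \<Longrightarrow> u < \<nu> \<Longrightarrow> v < \<nu> \<Longrightarrow> kq B A (dec k c) l u v < 2 ^ W"
  shows "tc W Walk s (\<nu> * (\<nu> * \<nu>) * ((\<nu> - k) * 5 + 10) + 2) (\<lambda>s'.
    (\<forall>l\<le>\<nu>. \<forall>u<\<nu>. \<forall>v<\<nu>. mem s' (bQ + (l * (\<nu> * \<nu>) + (u * \<nu> + v))) = kq B A (dec k c) l u v) \<and>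
    (\<forall>a. a < bQ + \<nu> * \<nu> \<or> bQ + (\<nu> * \<nu> + \<nu> * (\<nu> * \<nu>)) \<le> a \<longrightarrow> mem s' a = mem s a))"
proof -
  let ?sq = "\<nu> * \<nu>" and ?e = "\<nu> - k"
  let ?P = "Seq (Assign rU (Div (Mod (Reg rT) (Reg rSq)) (Reg rN)))
     (Seq (Assign rV (Mod (Reg rT) (Reg rN)))
     (Seq (Assign rAcc (Mem (Add (Reg rA) (Add (Mul (Reg rU) (Reg rN)) (Reg rV)))))
     (Seq (Assign rBits (Reg rS))
     (Seq Row
       (Store (Add (Reg rQ) (Add (Reg rSq) (Reg rT))) (Mul (Reg rAcc) (Reg rB)))))))"
  define q where "q a = kq B A (dec k c) (a div ?sq) (a mod ?sq div \<nu>) (a mod \<nu>)" for a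
  have sq: "0 < ?sq" using \<nu> by simp
  have q_index: "q (l * ?sq + (u * \<nu> + v)) = kq B A (dec k c) l u v" if "u < \<nu>" "v < \<nu>" for l u v
  proof -
    have "(l * ?sq + (u * \<nu> + v)) mod \<nu> = v" using that by (simp add: mult.assoc[symmetric])
    then show ?thesis unfolding q_def by (simp only: two_dim_index[OF that])
  qed
  \<comment> \<open>The first \<open>?sq\<close> cells are level 0, which is zero beforehand; hence
    the invariant already holds for t = 0.\<close>
  define Inv where "Inv t s' \<longleftrightarrow> (\<forall>a < ?sq + t. mem s' (bQ + a) = q a) \<and>
    (\<forall>a. a < bQ + ?sq \<or> bQ + (?sq + \<nu> * ?sq) \<le> a \<longrightarrow> mem s' a = mem s a)" for t :: nat and s' :: state
  have "tc W (For rT rCu ?P) s (\<nu> * ?sq * ((1 + (1 + (1 + (1 + ((?e * 5 + 2) + 2))))) + 2) + 2) (Inv (\<nu> * ?sq))"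
  proof (rule tc_For_eq[where Inv = Inv])
    show "Inv 0 (upd s rT 0)"
      unfolding Inv_def using zero by (auto simp: q_def)
  next
    fix t s' assume t: "t < \<nu> * ?sq" and I: "Inv t s'" and rt: "reg s' rT = t"
      and kp: "keeps (For rT rCu ?P) s s'"
    define u where "u = t mod ?sq div \<nu>"
    define v where "v = t mod \<nu>"
    define l where "l = t div ?sq"
    have u: "u < \<nu>" using sq \<nu> by (simp add: u_def less_mult_imp_div_less)
    have v: "v < \<nu>" using \<nu> by (simp add: v_def)
    have v': "v = t mod ?sq mod \<nu>" by (simp add: v_def mod_mod_cancel)
    have "t mod ?sq = u * \<nu> + v" unfolding u_def v' by simp
    then have t_eq: "t = l * ?sq + (u * \<nu> + v)" unfolding l_def by (metis div_mult_mod_eq)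
    have l: "l < \<nu>" using t sq by (simp add: l_def less_mult_imp_div_less)
    have r: "reg s' rN = \<nu>" "reg s' rK = k" "reg s' rA = bA" "reg s' rQ = bQ" "reg s' rB = B"
      "reg s' rE = ?e" "reg s' rSq = ?sq" "reg s' rS = c"
      using keeps_reg[OF kp] regs by simp_all
    have mA: "mem s' (bA + (x * \<nu> + y)) = A x y" if "x < \<nu>" "y < \<nu>" for x y
    proof -
      have "bA + (x * \<nu> + y) < bQ + ?sq" using two_dim_index(3)[OF that] AQ by linarith
      then show ?thesis using I A[OF that] by (simp add: Inv_def)
    qed
    \<comment> \<open>Only level l is read; it is complete, since the entry to be written belongs to
      level l + 1.\<close>
    have mQ: "mem s' (bQ + (l * ?sq + ((k + x) * \<nu> + v))) = kq B A (dec k c) l (k + x) v" if "x < ?e" for x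
    proof -
      have x: "k + x < \<nu>" using that by simp
      have "l * ?sq + ((k + x) * \<nu> + v) < ?sq + t"
        using two_dim_index(3)[OF x v] t_eq by linarith
      then have "mem s' (bQ + (l * ?sq + ((k + x) * \<nu> + v))) = q (l * ?sq + ((k + x) * \<nu> + v))"
        using I unfolding Inv_def by blast
      then show ?thesis using q_index[OF x v] by simp
    qed
    let ?sum = "\<Sum>x<?e. if odd (c div 2 ^ x) then A u (k + x) * kq B A (dec k c) l (k + x) v else 0"
    have val: "(A u v + ?sum) * B = kq B A (dec k c) (Suc l) u v"
      by (rule kq_Suc_dec[OF c, symmetric])
    have lt: "(A u v + ?sum) * B < 2 ^ W" unfolding val using bnd[of "Suc l" u v] l u v by simp
    \<comment> \<open>Since B >= 1, the bound for the stored product also bounds the accumulator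
      before the multiplication.\<close>
    have "(A u v + ?sum) * 1 \<le> (A u v + ?sum) * B" using B by (rule mult_le_mono2)
    then have lt1: "A u v + ?sum < 2 ^ W" using lt unfolding mult_1_right by (rule le_less_trans)
    let ?s1 = "upd (upd (upd (upd s' rU u) rV v) rAcc (A u v)) rBits c"
    have q_new: "q (?sq + t) = (A u v + ?sum) * B"
    proof -
      have "?sq + t = Suc l * ?sq + (u * \<nu> + v)" using t_eq by simp
      then show ?thesis by (simp only: q_index[OF u v] val)
    qed
    show "tc W ?P s' (1 + (1 + (1 + (1 + ((?e * 5 + 2) + 2))))) (\<lambda>s''. Inv (Suc t) (upd s'' rT (Suc t)))"
    proof (rule tc_bd, rule tc_Assign_Seq[where v = u], rule tc_Assign_Seq[where v = v],
        rule tc_Assign_Seq[where v = "A u v"], rule tc_Assign_Seq[where v = c])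
      show "tc W (Seq Row (Store (Add (Reg rQ) (Add (Reg rSq) (Reg rT))) (Mul (Reg rAcc) (Reg rB)))) ?s1
         ((?e * 5 + 2) + 2) (\<lambda>s''. Inv (Suc t) (upd s'' rT (Suc t)))"
      proof (rule tc_SeqI)
        have S: "(\<Sum>x<?e. if odd (reg ?s1 rBits div 2 ^ x)
    then mem ?s1 (reg ?s1 rA + (reg ?s1 rU * reg ?s1 rN + (reg ?s1 rK + x))) *
      mem ?s1 (reg ?s1 rQ + (reg ?s1 rT div reg ?s1 rSq * reg ?s1 rSq + ((reg ?s1 rK + x) * reg ?s1 rN + reg ?s1 rV)))
    else 0) = ?sum"
          using u by (intro sum.cong refl) (simp add: r rt mA l_def[symmetric] mQ)
        have a1: "reg ?s1 rAcc = A u v" by simp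
        show "tc W Row ?s1 (?e * 5 + 2) (\<lambda>s''. reg s'' rAcc = A u v + ?sum)"
          using tc_Row[of W ?s1 ?e, unfolded S a1] W lt1 r by simp
      next
        fix s'' assume k2: "keeps Row ?s1 s''" and acc: "reg s'' rAcc = A u v + ?sum"
        have r2: "reg s'' rQ = bQ" "reg s'' rSq = ?sq" "reg s'' rT = t" "reg s'' rB = B"
          using keeps_reg[OF k2] r rt by simp_all
        have m2: "mem s'' = mem s'" using keeps_mem[OF k2] by simp
        show "tc W (Store (Add (Reg rQ) (Add (Reg rSq) (Reg rT))) (Mul (Reg rAcc) (Reg rB))) s'' 2
           (\<lambda>s''. Inv (Suc t) (upd s'' rT (Suc t)))"
        proof (rule tc_Store)
          show "val (Mul (Reg rAcc) (Reg rB)) s'' < 2 ^ W" using lt by (simp add: acc r2)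
          show "Inv (Suc t) (upd (sto s'' (val (Add (Reg rQ) (Add (Reg rSq) (Reg rT))) s'')
              (val (Mul (Reg rAcc) (Reg rB)) s'')) rT (Suc t))"
            using I t unfolding Inv_def
            by (auto simp: r2 acc m2 q_new less_Suc_eq)
        qed (use W in \<open>auto simp: ok_def\<close>)
      qed
    next
      assume bd: "bd W s'"
      show "u < 2 ^ W" "v < 2 ^ W" using u v bd_reg[OF bd, of rN] r by simp_all
      show "A u v < 2 ^ W" using mA[OF u v] bd_mem[OF bd] by metis
      show "c < 2 ^ W" using r bd_reg[OF bd] by metis
    qed (use W mA[OF u v] in \<open>auto simp: ok_def rt r u_def[symmetric] v_def[symmetric]\<close>)
  qed (use W regs in \<open>auto\<close>)
  then show ?thesis
    unfolding Walk_def
  proof (rule tc_conseq)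
    fix s' assume I: "Inv (\<nu> * ?sq) s'"
    have "mem s' (bQ + (l * ?sq + (u * \<nu> + v))) = kq B A (dec k c) l u v" if "l \<le> \<nu>" "u < \<nu>" "v < \<nu>" for l u v
    proof -
      have "l * ?sq \<le> \<nu> * ?sq" using that by (intro mult_le_mono) auto
      then have "l * ?sq + (u * \<nu> + v) < ?sq + \<nu> * ?sq" using two_dim_index(3)[OF that(2,3)] by linarith
      then show ?thesis using I q_index[OF that(2,3)] by (simp add: Inv_def)
    qed
    then show "(\<forall>l\<le>\<nu>. \<forall>u<\<nu>. \<forall>v<\<nu>. mem s' (bQ + (l * ?sq + (u * \<nu> + v))) = kq B A (dec k c) l u v) \<and>
      (\<forall>a. a < bQ + ?sq \<or> bQ + (?sq + \<nu> * ?sq) \<le> a \<longrightarrow> mem s' a = mem s a)"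
      using I by (auto simp: Inv_def)
  qed (simp add: algebra_simps)
qed

subsection \<open>Counting by inclusion and exclusion\<close>

lemma zeros_0 [simp]: "zeros 0 c = 0"
  by (simp add: zeros_def)

lemma zeros_Suc: "zeros (Suc e) c = zeros e c + (if even (c div 2 ^ e) then 1 else 0)"
proof -
  have "{x. x < Suc e \<and> even (c div 2 ^ x)} =
    (if even (c div 2 ^ e) then insert e {x. x < e \<and> even (c div 2 ^ x)} else {x. x < e \<and> even (c div 2 ^ x)})"
    by (auto simp: less_Suc_eq)
  then show ?thesis by (simp add: zeros_def)
qed

definition Sign :: prog where
  "Sign = Seq (Assign rSg (Lit 0)) (Seq (Assign rBits (Reg rS)) (For rI rE
     (Seq (Cond (Mod (Reg rBits) (Lit 2)) Skip (Assign rSg (Sub (Lit 1) (Reg rSg))))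
       (Assign rBits (Div (Reg rBits) (Lit 2))))))"

lemma Sign_frame [simp]: "mods Sign = {rSg, rBits, rI}" "nostore Sign"
  by (auto simp: Sign_def)

lemma tc_Sign:
  assumes W: "2 \<le> W" and e: "reg s rE = e" and c: "reg s rS = c"
  shows "tc W Sign s (e * 5 + 4) (\<lambda>s'. reg s' rSg = zeros e c mod 2)"
proof -
  let ?P = "Seq (Cond (Mod (Reg rBits) (Lit 2)) Skip (Assign rSg (Sub (Lit 1) (Reg rSg))))
       (Assign rBits (Div (Reg rBits) (Lit 2)))"
  let ?s0 = "upd (upd s rSg 0) rBits c"
  have "tc W Sign s (1 + (1 + (e * (((1 + 1) + 1) + 2) + 2))) (\<lambda>s'. reg s' rSg = zeros e c mod 2)"
    unfolding Sign_def
  proof (rule tc_bd, rule tc_Assign_Seq[where v = 0], rule tc_Assign_Seq[where v = c])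
    show "tc W (For rI rE ?P) ?s0 (e * (((1 + 1) + 1) + 2) + 2) (\<lambda>s'. reg s' rSg = zeros e c mod 2)"
    proof (rule tc_For_eq[where Inv = "\<lambda>i s'. reg s' rSg = zeros i c mod 2 \<and> reg s' rBits = c div 2 ^ i"])
      fix i and s' :: state assume I: "reg s' rSg = zeros i c mod 2 \<and> reg s' rBits = c div 2 ^ i"
      have d: "c div 2 ^ i div 2 = c div (2 * 2 ^ i)"
        by (simp add: div_mult2_eq[symmetric] mult.commute)
      show "tc W ?P s' ((1 + 1) + 1) (\<lambda>s''. reg (upd s'' rI (Suc i)) rSg = zeros (Suc i) c mod 2 \<and>
        reg (upd s'' rI (Suc i)) rBits = c div 2 ^ Suc i)"
      proof (rule tc_SeqI)
        have "Suc 0 - zeros i c mod 2 = (zeros i c + 1) mod 2" by presburger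
        moreover have "(zeros i c + 1) mod 2 < 2 ^ W"
          by (rule less_trans[of _ 2]) (use W in auto)
        ultimately show "tc W (Cond (Mod (Reg rBits) (Lit 2)) Skip (Assign rSg (Sub (Lit 1) (Reg rSg)))) s' (1 + 1)
          (\<lambda>s''. reg s'' rSg = zeros (Suc i) c mod 2 \<and> reg s'' rBits = c div 2 ^ i)"
          using W I by (intro tc_Cond tc_Assign tc_Skip)
            (auto simp: ok_def zeros_Suc odd_iff_mod_2_eq_one even_iff_mod_2_eq_zero)
      next
        fix s'' assume bd: "bd W s''" and I': "reg s'' rSg = zeros (Suc i) c mod 2 \<and> reg s'' rBits = c div 2 ^ i"
        have "c div 2 ^ i div 2 < 2 ^ W"
          using bd_reg[OF bd, of rBits] I' by (metis div_le_dividend le_less_trans)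
        then show "tc W (Assign rBits (Div (Reg rBits) (Lit 2))) s'' 1
          (\<lambda>s''. reg (upd s'' rI (Suc i)) rSg = zeros (Suc i) c mod 2 \<and> reg (upd s'' rI (Suc i)) rBits = c div 2 ^ Suc i)"
          using W I' by (intro tc_Assign) (auto simp: ok_def d)
      qed
    qed (use W e in auto)
  next
    assume bd: "bd W s"
    show "c < 2 ^ W" using c bd_reg[OF bd] by metis
  qed (use W c in \<open>auto simp: ok_def\<close>)
  then show ?thesis by (rule tc_le) simp
qed

text \<open>Only level 0 of the scratch space has to be cleared: the other levels are written before
  they are read, and level 0 is never overwritten, so one clearing serves for all subsets.\<close>

definition Init :: prog where
  "Init = Seq (Assign rE (Sub (Reg rN) (Reg rK)))
    (Seq (Assign rTwo (Lit 2))
    (Seq (Assign rSq (Mul (Reg rN) (Reg rN)))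
    (Seq (Assign rCu (Mul (Reg rN) (Reg rSq)))
    (Seq (Assign rPos (Lit 0))
    (Seq (Assign rNeg (Lit 0))
    (Seq (Pow_to rX rTwo rE)
    (Seq (Pow_to rBn rB rN)
      (For rT rSq (Store (Add (Reg rQ) (Reg rT)) (Lit 0))))))))))"

lemma Init_frame [simp]: "mods Init = {rE, rTwo, rSq, rCu, rPos, rNeg, rX, rBn, rT, 22}"
  by (auto simp: Init_def)

lemma tc_Init:
  assumes W: "2 \<le> W" and regs: "reg s rN = \<nu>" "reg s rK = k" "reg s rQ = bQ" "reg s rB = B"
    and B: "1 \<le> B" and bnd: "B ^ \<nu> < 2 ^ W" "2 ^ (\<nu> - k) < (2::nat) ^ W" "\<nu> * (\<nu> * \<nu>) < 2 ^ W"
  shows "tc W Init s (\<nu> * \<nu> * 4 + \<nu> * 6 + 14) (\<lambda>s'. reg s' rE = \<nu> - k \<and> reg s' rSq = \<nu> * \<nu> \<and>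
    reg s' rCu = \<nu> * (\<nu> * \<nu>) \<and> reg s' rPos = 0 \<and> reg s' rNeg = 0 \<and> reg s' rX = 2 ^ (\<nu> - k) \<and> reg s' rBn = B ^ \<nu> \<and>
    (\<forall>a < \<nu> * \<nu>. mem s' (bQ + a) = 0) \<and> (\<forall>a. a < bQ \<or> bQ + \<nu> * \<nu> \<le> a \<longrightarrow> mem s' a = mem s a))"
    (is "tc W Init s ?j ?Q")
proof -
  let ?e = "\<nu> - k"
  let ?s1 = "upd (upd (upd (upd (upd (upd s rE ?e) rTwo 2) rSq (\<nu> * \<nu>)) rCu (\<nu> * (\<nu> * \<nu>))) rPos 0) rNeg 0"
  let ?Z = "For rT rSq (Store (Add (Reg rQ) (Reg rT)) (Lit 0))"
  have sqW: "\<nu> * \<nu> < 2 ^ W"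
  proof (cases "\<nu> = 0")
    case False
    then have "\<nu> * \<nu> \<le> \<nu> * (\<nu> * \<nu>)" by simp
    then show ?thesis using bnd(3) by linarith
  qed simp
  have "tc W Init s (1 + (1 + (1 + (1 + (1 + (1 + ((?e * 3 + 3) + ((\<nu> * 3 + 3) + (\<nu> * \<nu> * (2 + 2) + 2))))))))) ?Q"
    unfolding Init_def
  proof (rule tc_bd, rule tc_Assign_Seq[where v = ?e], rule tc_Assign_Seq[where v = 2],
      rule tc_Assign_Seq[where v = "\<nu> * \<nu>"], rule tc_Assign_Seq[where v = "\<nu> * (\<nu> * \<nu>)"],
      rule tc_Assign_Seq[where v = 0], rule tc_Assign_Seq[where v = 0])
    show "tc W (Seq (Pow_to rX rTwo rE) (Seq (Pow_to rBn rB rN) ?Z)) ?s1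
      ((?e * 3 + 3) + ((\<nu> * 3 + 3) + (\<nu> * \<nu> * (2 + 2) + 2))) ?Q"
    proof (rule tc_SeqI)
      show "tc W (Pow_to rX rTwo rE) ?s1 (?e * 3 + 3) (\<lambda>s'. reg s' rX = 2 ^ ?e)"
        using tc_Pow_to[of W rX rTwo rE ?s1 "\<lambda>s'. reg s' rX = 2 ^ ?e"] W bnd(2) by simp
    next
      fix s2 assume k2: "keeps (Pow_to rX rTwo rE) ?s1 s2" and x2: "reg s2 rX = 2 ^ ?e"
      note r2 = keeps_reg[OF k2] and m2 = keeps_mem[OF k2]
      show "tc W (Seq (Pow_to rBn rB rN) ?Z) s2 ((\<nu> * 3 + 3) + (\<nu> * \<nu> * (2 + 2) + 2)) ?Q"
      proof (rule tc_SeqI)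
        show "tc W (Pow_to rBn rB rN) s2 (\<nu> * 3 + 3) (\<lambda>s'. reg s' rBn = B ^ \<nu>)"
          using tc_Pow_to[of W rBn rB rN s2 "\<lambda>s'. reg s' rBn = B ^ \<nu>"] W bnd(1) B r2 regs by simp
      next
        fix s3 assume k3: "keeps (Pow_to rBn rB rN) s2 s3" and x3: "reg s3 rBn = B ^ \<nu>"
        note r3 = keeps_reg[OF k3] and m3 = keeps_mem[OF k3]
        show "tc W ?Z s3 (\<nu> * \<nu> * (2 + 2) + 2) ?Q"
        proof (rule tc_For_eq[where Inv = "\<lambda>t s'. (\<forall>a < t. mem s' (bQ + a) = 0) \<and>
            (\<forall>a. a < bQ \<or> bQ + \<nu> * \<nu> \<le> a \<longrightarrow> mem s' a = mem s a)"])
          fix t s' assume t: "t < \<nu> * \<nu>" and I: "(\<forall>a < t. mem s' (bQ + a) = 0) \<and>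
            (\<forall>a. a < bQ \<or> bQ + \<nu> * \<nu> \<le> a \<longrightarrow> mem s' a = mem s a)"
            and rt: "reg s' rT = t" and k4: "keeps ?Z s3 s'"
          have q: "reg s' rQ = bQ" using keeps_reg[OF k4] r3 r2 regs by simp
          show "tc W (Store (Add (Reg rQ) (Reg rT)) (Lit 0)) s' 2 (\<lambda>s'.
             (\<forall>a < Suc t. mem (upd s' rT (Suc t)) (bQ + a) = 0) \<and>
            (\<forall>a. a < bQ \<or> bQ + \<nu> * \<nu> \<le> a \<longrightarrow> mem (upd s' rT (Suc t)) a = mem s a))"
            using W t I by (intro tc_Store) (auto simp: ok_def rt q less_Suc_eq)
        next
          fix s' assume I: "(\<forall>a < \<nu> * \<nu>. mem s' (bQ + a) = 0) \<and>
            (\<forall>a. a < bQ \<or> bQ + \<nu> * \<nu> \<le> a \<longrightarrow> mem s' a = mem s a)" and k4: "keeps ?Z s3 s'"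
          show "?Q s'" using I keeps_reg[OF k4] r3 r2 x2 x3 regs by simp
        qed (use W r2 r3 m2 m3 in auto)
      qed
    qed
  next
    assume bd: "bd W s"
    show "?e < 2 ^ W" using regs bd_reg[OF bd, of rN] by (meson diff_le_self le_less_trans)
  qed (use W regs sqW bnd in \<open>auto simp: ok_def\<close>)
  then show ?thesis by (rule tc_le) simp
qed

text \<open>\<open>F\<close> has to turn the last level of walk values, found at
  \<open>rQ + rCu\<close>, into the weighted count for its leading block of \<open>rK\<close> rows
  and columns. It is a parameter because the routine is used twice: for table entries with
  \<open>rK\<close> = 1, and for the input with table lookup.\<close>

definition Ham :: "prog \<Rightarrow> prog" where
  "Ham F = Seq Init (Seq
     (For rS rX (Seq Walk (Seq Sign (Seq F
       (Seq (Assign rY (Mod (Div (Reg rY) (Reg rBn)) (Reg rB)))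
         (Cond (Reg rSg) (Assign rNeg (Add (Reg rNeg) (Reg rY))) (Assign rPos (Add (Reg rPos) (Reg rY)))))))))
     (Assign rPos (Sub (Reg rPos) (Reg rNeg))))"

lemma mods_Ham: "mods (Ham F) \<subseteq> {7..24} \<union> mods F"
  by (auto simp: Ham_def)

text \<open>\<open>Fspec\<close> is the contract of the inner routine: cells outside the scratch
  space, where its table may live, are as at the start. \<open>jF\<close> is its cost per
  subset.\<close>

lemma tc_Ham:
  assumes W: "2 \<le> W"
    and regs: "reg s rN = \<nu>" "reg s rK = k" "reg s rA = bA" "reg s rQ = bQ" "reg s rB = B"
    and k: "1 \<le> k" "k \<le> \<nu>"
    and A: "\<And>u v. u < \<nu> \<Longrightarrow> v < \<nu> \<Longrightarrow> mem s (bA + (u * \<nu> + v)) = A u v"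
    and AQ: "bA + \<nu> * \<nu> \<le> bQ"
    and Aa: "\<And>u v. u < \<nu> \<Longrightarrow> v < \<nu> \<Longrightarrow> A u v \<le> a"
    and B: "\<nu> ^ \<nu> * (a * \<nu> + 1) ^ (\<nu> * \<nu>) < B"
    and bnd: "(B * a * \<nu> + 1) ^ \<nu> < 2 ^ W" "B ^ \<nu> < 2 ^ W" "2 ^ \<nu> * B < 2 ^ W" "\<nu> * (\<nu> * \<nu>) < 2 ^ W"
    and F: "mods F \<subseteq> {23..34}" "nostore F"
    and Fspec: "\<And>c s'. c < 2 ^ (\<nu> - k) \<Longrightarrow> (\<And>r. r \<notin> {7..34} \<Longrightarrow> reg s' r = reg s r) \<Longrightarrow>
      reg s' rCu = \<nu> * (\<nu> * \<nu>) \<Longrightarrow>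
      (\<And>a. a < bQ \<or> bQ + (\<nu> * \<nu> + \<nu> * (\<nu> * \<nu>)) \<le> a \<Longrightarrow> mem s' a = mem s a) \<Longrightarrow>
      (\<And>u v. u < \<nu> \<Longrightarrow> v < \<nu> \<Longrightarrow> mem s' (bQ + (\<nu> * (\<nu> * \<nu>) + (u * \<nu> + v))) = kq B A (dec k c) \<nu> u v) \<Longrightarrow>
      tc W F s' jF (\<lambda>s''. reg s'' rY = hc (kq B A (dec k c) \<nu>) k)"
  shows "tc W (Ham F) s (2 ^ (\<nu> - k) * (\<nu> * (\<nu> * \<nu>) * (\<nu> * 5 + 10) + \<nu> * 5 + jF + 11) +
      \<nu> * \<nu> * 4 + \<nu> * 6 + 17) (\<lambda>s'. reg s' rPos = hc A \<nu> \<and>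
    (\<forall>a. a < bQ \<or> bQ + (\<nu> * \<nu> + \<nu> * (\<nu> * \<nu>)) \<le> a \<longrightarrow> mem s' a = mem s a))"
proof -
  let ?e = "\<nu> - k" and ?sq = "\<nu> * \<nu>"
  let ?cu = "\<nu> * ?sq"
  let ?pos = "\<lambda>m. \<Sum>c<m. if even (zeros ?e c) then yval A \<nu> k B c else 0"
  let ?neg = "\<lambda>m. \<Sum>c<m. if even (zeros ?e c) then 0 else yval A \<nu> k B c"
  let ?fin = "Seq (Assign rY (Mod (Div (Reg rY) (Reg rBn)) (Reg rB)))
         (Cond (Reg rSg) (Assign rNeg (Add (Reg rNeg) (Reg rY))) (Assign rPos (Add (Reg rPos) (Reg rY))))"
  let ?body = "Seq Walk (Seq Sign (Seq F ?fin))"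
  let ?out = "\<lambda>s'. \<forall>a. a < bQ \<or> bQ + (?sq + ?cu) \<le> a \<longrightarrow> mem s' a = mem s a"
  let ?zero = "\<lambda>s'. \<forall>a<?sq. mem s' (bQ + a) = 0"
  let ?I = "\<lambda>s'. reg s' rE = \<nu> - k \<and> reg s' rSq = \<nu> * \<nu> \<and>
    reg s' rCu = \<nu> * (\<nu> * \<nu>) \<and> reg s' rPos = 0 \<and> reg s' rNeg = 0 \<and> reg s' rX = 2 ^ (\<nu> - k) \<and> reg s' rBn = B ^ \<nu> \<and>
    (\<forall>a < \<nu> * \<nu>. mem s' (bQ + a) = 0) \<and> (\<forall>a. a < bQ \<or> bQ + \<nu> * \<nu> \<le> a \<longrightarrow> mem s' a = mem s a)"
  have \<nu>: "1 \<le> \<nu>" using k by simp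
  have B1: "1 \<le> B" using B by simp
  have ypos: "yval A \<nu> k B c < B" for c using B1 by (simp add: yval_def)
  \<comment> \<open>Each term is a digit in base B, so partial sums are at most
    \<open>2 ^ \<nu> * B\<close>.\<close>
  have sum_less: "?pos m < 2 ^ W" "?neg m < 2 ^ W" if "m \<le> 2 ^ ?e" for m
  proof -
    have le: "m * B < 2 ^ W"
    proof -
      have "m * B \<le> 2 ^ ?e * B" using that by simp
      also have "\<dots> \<le> 2 ^ \<nu> * B" by (intro mult_le_mono1 power_increasing) auto
      finally show ?thesis using bnd(3) by linarith
    qed
    have "?pos m \<le> (\<Sum>c<m. B)" by (intro sum_mono) (use ypos in \<open>auto intro: less_imp_le\<close>)
    then show "?pos m < 2 ^ W" using le by simp
    have "?neg m \<le> (\<Sum>c<m. B)" by (intro sum_mono) (use ypos in \<open>auto intro: less_imp_le\<close>)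
    then show "?neg m < 2 ^ W" using le by simp
  qed
  have eW: "2 ^ ?e < (2::nat) ^ W"
  proof -
    have "2 ^ ?e \<le> (2::nat) ^ \<nu>" by (intro power_increasing) auto
    also have "\<dots> \<le> 2 ^ \<nu> * B" using B1 by simp
    finally show ?thesis using bnd(3) by linarith
  qed
  have kqW: "kq B A (dec k c) l u v < 2 ^ W" if "c < 2 ^ ?e" "l \<le> \<nu>" "u < \<nu>" "v < \<nu>" for c l u v
  proof -
    have "dec k c \<subseteq> {..<\<nu>}" using dec_subset[OF k(2) that(1)] by auto
    then have "kq B A (dec k c) l u v + 1 \<le> (B * a * \<nu> + 1) ^ l"
      using kq_le[of \<nu> A a "dec k c" u v B l] Aa that by simp
    also have "\<dots> \<le> (B * a * \<nu> + 1) ^ \<nu>" using that by (intro power_increasing) auto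
    finally show ?thesis using bnd(1) by linarith
  qed
  define Inv where "Inv c s' \<longleftrightarrow> reg s' rPos = ?pos c \<and> reg s' rNeg = ?neg c \<and> ?out s' \<and> ?zero s'"
    for c :: nat and s' :: state
  let ?jX = "(?cu * (?e * 5 + 10) + 2) + ((?e * 5 + 4) + (jF + (1 + (1 + 1))))"
  have "tc W (Ham F) s ((?sq * 4 + \<nu> * 6 + 14) + ((2 ^ ?e * (?jX + 2) + 2) + 1))
    (\<lambda>s'. reg s' rPos = hc A \<nu> \<and> ?out s')"
    unfolding Ham_def
  proof (rule tc_SeqI)
    show "tc W Init s (?sq * 4 + \<nu> * 6 + 14) ?I"
      by (rule tc_Init) (use W regs B1 bnd eW in auto)
  next
    fix s1 assume k1: "keeps Init s s1" and i1: "?I s1"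
    note r1 = keeps_reg[OF k1]
    show "tc W (Seq (For rS rX ?body) (Assign rPos (Sub (Reg rPos) (Reg rNeg)))) s1
      ((2 ^ ?e * (?jX + 2) + 2) + 1) (\<lambda>s'. reg s' rPos = hc A \<nu> \<and> ?out s')"
    proof (rule tc_SeqI)
      show "tc W (For rS rX ?body) s1 (2 ^ ?e * (?jX + 2) + 2) (Inv (2 ^ ?e))"
      proof (rule tc_For_eq[where Inv = Inv])
        show "Inv 0 (upd s1 rS 0)" using i1 by (auto simp: Inv_def)
      next
        fix c s2 assume c: "c < 2 ^ ?e" and I: "Inv c s2" and rS: "reg s2 rS = c"
          and k2: "keeps (For rS rX ?body) s1 s2"
        have ks: "mods (For rS rX ?body) \<subseteq> {12..34}" using F(1) by auto
        have g2: "reg s2 r = reg s1 r" if "r \<notin> {12..34}" for r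
          using keeps_reg[OF k2] ks that by blast
        have r2: "reg s2 rN = \<nu>" "reg s2 rK = k" "reg s2 rA = bA" "reg s2 rQ = bQ" "reg s2 rB = B"
          "reg s2 rE = ?e" "reg s2 rSq = ?sq" "reg s2 rCu = ?cu" "reg s2 rBn = B ^ \<nu>"
          using i1 r1 regs by (simp_all add: g2)
        show "tc W ?body s2 ?jX (\<lambda>s'. Inv (Suc c) (upd s' rS (Suc c)))"
        proof (rule tc_SeqI)
          show "tc W Walk s2 (?cu * (?e * 5 + 10) + 2) (\<lambda>s'.
            (\<forall>l\<le>\<nu>. \<forall>u<\<nu>. \<forall>v<\<nu>. mem s' (bQ + (l * (\<nu> * \<nu>) + (u * \<nu> + v))) = kq B A (dec k c) l u v) \<and>
            (\<forall>a. a < bQ + \<nu> * \<nu> \<or> bQ + (\<nu> * \<nu> + \<nu> * (\<nu> * \<nu>)) \<le> a \<longrightarrow> mem s' a = mem s2 a))"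
          proof (rule tc_Walk[OF W r2(1-8) rS c k(2) \<nu> B1])
            fix u v assume uv: "u < \<nu>" "v < \<nu>"
            have "bA + (u * \<nu> + v) < bQ" using two_dim_index(3)[OF uv] AQ by linarith
            then show "mem s2 (bA + (u * \<nu> + v)) = A u v" using I A[OF uv] by (simp add: Inv_def)
          qed (use AQ I kqW c in \<open>auto simp: Inv_def\<close>)
        next
          fix s3 assume k3: "keeps Walk s2 s3"
            and q3: "(\<forall>l\<le>\<nu>. \<forall>u<\<nu>. \<forall>v<\<nu>. mem s3 (bQ + (l * (\<nu> * \<nu>) + (u * \<nu> + v))) = kq B A (dec k c) l u v) \<and>
            (\<forall>a. a < bQ + \<nu> * \<nu> \<or> bQ + (\<nu> * \<nu> + \<nu> * (\<nu> * \<nu>)) \<le> a \<longrightarrow> mem s3 a = mem s2 a)"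
          note r3 = keeps_reg[OF k3]
          have o3: "?out s3" using q3 I by (auto simp: Inv_def)
          have z3: "?zero s3" using q3 I by (auto simp: Inv_def)
          show "tc W (Seq Sign (Seq F ?fin)) s3 ((?e * 5 + 4) + (jF + (1 + (1 + 1)))) (\<lambda>s'. Inv (Suc c) (upd s' rS (Suc c)))"
          proof (rule tc_SeqI)
            show "tc W Sign s3 (?e * 5 + 4) (\<lambda>s'. reg s' rSg = zeros ?e c mod 2)"
              by (rule tc_Sign[OF W]) (simp_all add: r3 r2 rS)
          next
            fix s4 assume k4: "keeps Sign s3 s4" and sg: "reg s4 rSg = zeros ?e c mod 2"
            note r4 = keeps_reg[OF k4]
            have m4: "mem s4 = mem s3" using keeps_mem[OF k4] by simp
            show "tc W (Seq F ?fin) s4 (jF + (1 + (1 + 1))) (\<lambda>s'. Inv (Suc c) (upd s' rS (Suc c)))"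
            proof (rule tc_SeqI)
              show "tc W F s4 jF (\<lambda>s''. reg s'' rY = hc (kq B A (dec k c) \<nu>) k)"
              proof (rule Fspec[OF c])
                show "reg s4 r = reg s r" if "r \<notin> {7..34}" for r
                proof -
                  have "reg s4 r = reg s3 r" by (rule r4) (use that in auto)
                  also have "\<dots> = reg s2 r" by (rule r3) (use that in auto)
                  also have "\<dots> = reg s1 r" by (rule g2) (use that in auto)
                  also have "\<dots> = reg s r" by (rule r1) (use that in auto)
                  finally show ?thesis .
                qed
                show "reg s4 rCu = ?cu" by (simp add: r4 r3 r2)
              qed (use q3 o3 m4 in auto)
            next
              fix s5 assume b5: "bd W s5" and k5: "keeps F s4 s5" and y5: "reg s5 rY = hc (kq B A (dec k c) \<nu>) k"
              have g5: "reg s5 r = reg s4 r" if "r \<notin> {23..34}" for r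
                using keeps_reg[OF k5] F(1) that by blast
              have m5: "mem s5 = mem s3" using keeps_mem[OF k5 F(2)] m4 by simp
              have r5: "reg s5 rB = B" "reg s5 rBn = B ^ \<nu>" "reg s5 rSg = zeros ?e c mod 2"
                "reg s5 rPos = ?pos c" "reg s5 rNeg = ?neg c"
                using I by (simp_all add: g5 r4 r3 r2 sg Inv_def)
              have yW: "yval A \<nu> k B c < 2 ^ W"
                using ypos[of c] bd_reg[OF b5, of rB] r5 by simp
              have l1: "?pos c + (if even (zeros ?e c) then yval A \<nu> k B c else 0) < 2 ^ W"
                "?neg c + (if even (zeros ?e c) then 0 else yval A \<nu> k B c) < 2 ^ W"
                using sum_less[of "Suc c"] c by simp_all
              show "tc W ?fin s5 (1 + (1 + 1)) (\<lambda>s'. Inv (Suc c) (upd s' rS (Suc c)))"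
              proof (rule tc_Assign_Seq[where v = "yval A \<nu> k B c"])
                show "val (Mod (Div (Reg rY) (Reg rBn)) (Reg rB)) s5 = yval A \<nu> k B c"
                  by (simp add: r5 y5 yval_def)
                show "tc W (Cond (Reg rSg) (Assign rNeg (Add (Reg rNeg) (Reg rY))) (Assign rPos (Add (Reg rPos) (Reg rY))))
                  (upd s5 rY (yval A \<nu> k B c)) (1 + 1) (\<lambda>s'. Inv (Suc c) (upd s' rS (Suc c)))"
                  using W l1 o3 z3 by (intro tc_Cond tc_Assign)
                    (auto simp: ok_def r5 Inv_def m5 even_iff_mod_2_eq_zero odd_iff_mod_2_eq_one split: if_splits)
              qed (use W yW in \<open>auto simp: ok_def\<close>)
            qed
          qed
        qed
      qed (use W F(1) i1 in auto)
    next
      fix s6 assume b6: "bd W s6" and I: "Inv (2 ^ ?e) s6"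
      have "hc A \<nu> = ?pos (2 ^ ?e) - ?neg (2 ^ ?e)"
        using hc_eq_diff[OF k Aa B] by simp
      moreover have "?pos (2 ^ ?e) - ?neg (2 ^ ?e) < 2 ^ W"
        using sum_less(1)[of "2 ^ ?e"] by (meson diff_le_self le_less_trans order_refl)
      ultimately show "tc W (Assign rPos (Sub (Reg rPos) (Reg rNeg))) s6 1 (\<lambda>s'. reg s' rPos = hc A \<nu> \<and> ?out s')"
        using W I by (intro tc_Assign) (auto simp: ok_def Inv_def)
    qed
  qed
  then show ?thesis
  proof (rule tc_le)
    have "?jX + 2 \<le> ?cu * (\<nu> * 5 + 10) + \<nu> * 5 + jF + 11"
    proof -
      have "?cu * (?e * 5 + 10) \<le> ?cu * (\<nu> * 5 + 10)" by (intro mult_le_mono2) simp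
      moreover have "?e \<le> \<nu>" by simp
      ultimately show ?thesis by linarith
    qed
    then have "2 ^ ?e * (?jX + 2) \<le> 2 ^ ?e * (?cu * (\<nu> * 5 + 10) + \<nu> * 5 + jF + 11)"
      by (rule mult_le_mono2)
    then show "(?sq * 4 + \<nu> * 6 + 14) + ((2 ^ ?e * (?jX + 2) + 2) + 1) \<le>
      2 ^ ?e * (?cu * (\<nu> * 5 + 10) + \<nu> * 5 + jF + 11) + ?sq * 4 + \<nu> * 6 + 17"
      by linarith
  qed
qed

subsection \<open>Digits\<close>

lemma digit_sum_less:
  fixes d :: "nat \<Rightarrow> nat"
  assumes "\<And>t. t < T \<Longrightarrow> d t < N"
  shows "(\<Sum>t<T. d t * N ^ t) < N ^ T"
  using assms
proof (induction T)
  case (Suc T)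
  have "(\<Sum>t<Suc T. d t * N ^ t) < N ^ T + d T * N ^ T" using Suc by simp
  also have "\<dots> = (d T + 1) * N ^ T" by simp
  also have "\<dots> \<le> N * N ^ T" using Suc.prems[of T] by (intro mult_le_mono1) auto
  finally show ?case by simp
qed simp

lemma digit_sum_div_mod:
  fixes d :: "nat \<Rightarrow> nat"
  assumes "\<And>t. t < T \<Longrightarrow> d t < N" "i < T"
  shows "(\<Sum>t<T. d t * N ^ t) div N ^ i mod N = d i"
  using assms
proof (induction T arbitrary: d i)
  case (Suc T)
  let ?r = "\<Sum>t<T. d (Suc t) * N ^ t"
  have d0: "d 0 < N" using Suc.prems by simp
  have eq: "(\<Sum>t<Suc T. d t * N ^ t) = d 0 + N * ?r"
    unfolding sum.lessThan_Suc_shift by (simp add: sum_distrib_left mult.commute mult.left_commute)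
  show ?case
  proof (cases i)
    case 0
    then show ?thesis using d0 eq by simp
  next
    case (Suc j)
    have "(d 0 + N * ?r) div N ^ i = ?r div N ^ j" using d0 Suc by (simp add: div_mult2_eq)
    moreover have "?r div N ^ j mod N = d (Suc j)"
      using Suc.prems Suc by (intro Suc.IH) auto
    ultimately show ?thesis using eq Suc by simp
  qed
qed simp

lemma wt_mod: "wt (\<lambda>u v. M u v mod m) u w t mod m = wt M u w t mod (m::nat)"
proof (induction w arbitrary: u)
  case (Cons v w)
  have "wt (\<lambda>u v. M u v mod m) u (v # w) t mod m = (M u v mod m) * (wt (\<lambda>u v. M u v mod m) v w t mod m) mod m"
    by (simp add: mod_mult_right_eq)
  also have "\<dots> = wt M u (v # w) t mod m" unfolding Cons by (simp add: mod_mult_eq)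
  finally show ?case .
qed simp

lemma hc_mod: "hc (\<lambda>u v. M u v mod m) k mod m = hc M k mod (m::nat)"
proof -
  have "hc (\<lambda>u v. M u v mod m) k mod m =
      (\<Sum>w\<in>permutations_of_set {1..<k}. wt (\<lambda>u v. M u v mod m) 0 w 0 mod m) mod m"
    by (simp add: hc_def hc_from_def mod_sum_eq)
  also have "\<dots> = hc M k mod m" unfolding wt_mod by (simp add: hc_def hc_from_def mod_sum_eq)
  finally show ?thesis .
qed

lemma lcm_upto_mono: "m \<le> n \<Longrightarrow> lcm_upto m \<le> lcm_upto n"
proof (induction n rule: dec_induct)
  case (step n)
  have "lcm_upto n \<le> lcm_upto (Suc n)" using lcm_upto_pos[of "Suc n"] by (intro dvd_imp_le) auto
  then show ?case using step by simp
qed simp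

subsection \<open>Chinese remaindering with table lookup\<close>

abbreviation (input) rL :: nat where "rL \<equiv> 24"
abbreviation (input) rMc :: nat where "rMc \<equiv> 25"
abbreviation (input) rMo :: nat where "rMo \<equiv> 26"
abbreviation (input) rIdx :: nat where "rIdx \<equiv> 27"
abbreviation (input) rPw :: nat where "rPw \<equiv> 28"
abbreviation (input) rTc :: nat where "rTc \<equiv> 29"
abbreviation (input) rR :: nat where "rR \<equiv> 30"
abbreviation (input) rJ :: nat where "rJ \<equiv> 31"
abbreviation (input) rL2 :: nat where "rL2 \<equiv> 32"
abbreviation (input) rMod :: nat where "rMod \<equiv> 35"
abbreviation (input) rTab :: nat where "rTab \<equiv> 36"
abbreviation (input) rKk :: nat where "rKk \<equiv> 37"

text \<open>The digits are residues modulo \<open>rMo\<close>, yet the base is always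
  \<open>rMod\<close>, the largest modulus: thus one table serves for all moduli.\<close>

definition Index :: prog where
  "Index = Seq (Assign rIdx (Lit 0)) (Seq (Assign rPw (Lit 1)) (For rTc rKk
     (Seq (Assign rIdx (Add (Reg rIdx) (Mul (Mod (Mem (Add (Reg rQ) (Add (Reg rCu)
           (Add (Mul (Div (Reg rTc) (Reg rK)) (Reg rN)) (Mod (Reg rTc) (Reg rK)))))) (Reg rMo)) (Reg rPw))))
       (Assign rPw (Mul (Reg rPw) (Reg rMod))))))"

lemma Index_frame [simp]: "mods Index = {rIdx, rPw, rTc}" "nostore Index"
  by (auto simp: Index_def)

lemma tc_Index:
  assumes W: "2 \<le> W"
    and regs: "reg s rN = \<nu>" "reg s rK = k" "reg s rQ = bQ" "reg s rCu = cu" "reg s rMod = N" "reg s rMo = m"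
      "reg s rKk = k * k"
    and M: "\<And>u v. u < k \<Longrightarrow> v < k \<Longrightarrow> mem s (bQ + (cu + (u * \<nu> + v))) = M u v"
    and m: "1 \<le> m" "m \<le> N" and bnd: "N ^ (k * k) < 2 ^ W" and k: "1 \<le> k"
  shows "tc W Index s (k * k * 4 + 4)
    (\<lambda>s'. reg s' rIdx = (\<Sum>t<k * k. (M (t div k) (t mod k) mod m) * N ^ t))"
proof -
  let ?P = "Seq (Assign rIdx (Add (Reg rIdx) (Mul (Mod (Mem (Add (Reg rQ) (Add (Reg rCu)
           (Add (Mul (Div (Reg rTc) (Reg rK)) (Reg rN)) (Mod (Reg rTc) (Reg rK)))))) (Reg rMo)) (Reg rPw))))
       (Assign rPw (Mul (Reg rPw) (Reg rMod)))"
  let ?d = "\<lambda>t. M (t div k) (t mod k) mod m"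
  let ?S = "\<lambda>T. \<Sum>t<T. ?d t * N ^ t"
  have d: "?d t < N" for t using mod_less_divisor[of m] m by (meson less_le_trans zero_less_one)
  have N: "1 \<le> N" using m by simp
  have pW: "N ^ t < 2 ^ W" if "t \<le> k * k" for t
  proof -
    have "N ^ t \<le> N ^ (k * k)" using that N by (intro power_increasing) auto
    then show ?thesis using bnd by (rule le_less_trans)
  qed
  have SW: "?S T < 2 ^ W" if "T \<le> k * k" for T
    using digit_sum_less[of T ?d N] d pW[OF that] by (meson less_trans)
  let ?s0 = "upd (upd s rIdx 0) rPw 1"
  have "tc W Index s (1 + (1 + (k * k * ((1 + 1) + 2) + 2))) (\<lambda>s'. reg s' rIdx = ?S (k * k))"
    unfolding Index_def
  proof (rule tc_Assign_Seq[where v = 0], rule tc_Assign_Seq[where v = 1])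
    show "tc W (For rTc rKk ?P) ?s0 (k * k * ((1 + 1) + 2) + 2) (\<lambda>s'. reg s' rIdx = ?S (k * k))"
    proof (rule tc_For_eq[where Inv = "\<lambda>t s'. reg s' rIdx = ?S t \<and> reg s' rPw = N ^ t"])
      fix t and s' :: state assume t: "t < k * k" and I: "reg s' rIdx = ?S t \<and> reg s' rPw = N ^ t"
        and rt: "reg s' rTc = t" and k1: "keeps (For rTc rKk ?P) ?s0 s'"
      have r: "reg s' rN = \<nu>" "reg s' rK = k" "reg s' rQ = bQ" "reg s' rCu = cu" "reg s' rMod = N" "reg s' rMo = m"
        using keeps_reg[OF k1] regs by simp_all
      have mem: "mem s' = mem s" using keeps_mem[OF k1] by simp
      have uv: "t div k < k" "t mod k < k" using t k by (simp_all add: less_mult_imp_div_less)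
      have S: "?S t + ?d t * N ^ t = ?S (Suc t)" by simp
      have P: "N ^ t * N = N ^ Suc t" by simp
      show "tc W ?P s' (1 + 1) (\<lambda>s''. reg (upd s'' rTc (Suc t)) rIdx = ?S (Suc t) \<and> reg (upd s'' rTc (Suc t)) rPw = N ^ Suc t)"
      proof (rule tc_Assign_Seq[where v = "?S (Suc t)"])
        show "tc W (Assign rPw (Mul (Reg rPw) (Reg rMod))) (upd s' rIdx (?S (Suc t))) 1
           (\<lambda>s''. reg (upd s'' rTc (Suc t)) rIdx = ?S (Suc t) \<and> reg (upd s'' rTc (Suc t)) rPw = N ^ Suc t)"
          using W I pW[of "Suc t"] t by (intro tc_Assign) (auto simp: ok_def r mult.commute)
        show "?S (Suc t) < 2 ^ W" using SW[of "Suc t"] t by simp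
        show "val (Add (Reg rIdx) (Mul (Mod (Mem (Add (Reg rQ) (Add (Reg rCu)
           (Add (Mul (Div (Reg rTc) (Reg rK)) (Reg rN)) (Mod (Reg rTc) (Reg rK)))))) (Reg rMo)) (Reg rPw))) s' = ?S (Suc t)"
          using I by (simp add: r rt mem M[OF uv])
      qed (use W in \<open>auto simp: ok_def\<close>)
    qed (use W regs in auto)
  qed (use W in \<open>auto simp: ok_def\<close>)
  then show ?thesis by (rule tc_le) simp
qed

text \<open>In round m, \<open>rL\<close> advances from lcm(1, ..., m-1) to lcm(1, ..., m), and
  \<open>rY\<close> from the residue modulo the former to the residue modulo the latter. The sum of
  both truncated differences in the guard tests for inequality. Linear search is affordable because
  m is at most N.\<close>

definition Crt :: prog where
  "Crt = Seq (Assign rY (Lit 0)) (Seq (Assign rL (Lit 1)) (For rMc rMod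
     (Seq (Assign rMo (Add (Reg rMc) (Lit 1)))
     (Seq Index
     (Seq (Assign rR (Mod (Mem (Add (Reg rTab) (Reg rIdx))) (Reg rMo)))
     (Seq (For rJ rMo (Cond (Add (Sub (Mod (Reg rY) (Reg rMo)) (Reg rR)) (Sub (Reg rR) (Mod (Reg rY) (Reg rMo))))
         (Assign rY (Add (Reg rY) (Reg rL))) Skip))
     (Seq (Assign rL2 (Reg rL))
     (Seq (For rJ rMo (Cond (Mod (Reg rL2) (Reg rMo)) (Assign rL2 (Add (Reg rL2) (Reg rL))) Skip))
       (Assign rL (Reg rL2))))))))))"

lemma Crt_frame [simp]: "mods Crt = {rY, rL, rMc, rMo, rR, rJ, rL2, rIdx, rPw, rTc}" "nostore Crt"
  by (auto simp: Crt_def)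

text \<open>As the wanted value is below \<open>lcm_upto N\<close>, its last residue is the value
  itself.\<close>

lemma tc_Crt:
  assumes W: "2 \<le> W"
    and regs: "reg s rN = \<nu>" "reg s rK = k" "reg s rQ = bQ" "reg s rCu = cu" "reg s rMod = N"
      "reg s rKk = k * k" "reg s rTab = bT"
    and M: "\<And>u v. u < k \<Longrightarrow> v < k \<Longrightarrow> mem s (bQ + (cu + (u * \<nu> + v))) = M u v"
    and tab: "\<And>x. x < N ^ (k * k) \<Longrightarrow> mem s (bT + x) = hc (\<lambda>u v. x div N ^ (u * k + v) mod N) k"
    and bnd: "N ^ (k * k) < 2 ^ W" "lcm_upto N < 2 ^ W" and k: "1 \<le> k" and y: "hc M k < lcm_upto N"
  shows "tc W Crt s (N * (k * k * 4 + N * 8 + 14) + 4) (\<lambda>s'. reg s' rY = hc M k)"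
proof -
  let ?y = "hc M k"
  let ?P4 = "For rJ rMo (Cond (Mod (Reg rL2) (Reg rMo)) (Assign rL2 (Add (Reg rL2) (Reg rL))) Skip)"
  let ?P3 = "For rJ rMo (Cond (Add (Sub (Mod (Reg rY) (Reg rMo)) (Reg rR)) (Sub (Reg rR) (Mod (Reg rY) (Reg rMo))))
         (Assign rY (Add (Reg rY) (Reg rL))) Skip)"
  let ?P2 = "Seq (Assign rR (Mod (Mem (Add (Reg rTab) (Reg rIdx))) (Reg rMo)))
     (Seq ?P3 (Seq (Assign rL2 (Reg rL)) (Seq ?P4 (Assign rL (Reg rL2)))))"
  let ?P1 = "Seq Index ?P2"
  let ?P = "Seq (Assign rMo (Add (Reg rMc) (Lit 1))) ?P1"
  let ?s0 = "upd (upd s rY 0) rL 1"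
  let ?jP = "1 + ((k * k * 4 + 4) + (1 + ((N * 4 + 2) + (1 + ((N * 4 + 2) + 1)))))"
  have "tc W Crt s (1 + (1 + (N * (?jP + 2) + 2))) (\<lambda>s'. reg s' rY = ?y)"
    unfolding Crt_def
  proof (rule tc_Assign_Seq[where v = 0], rule tc_Assign_Seq[where v = 1])
    show "tc W (For rMc rMod ?P) ?s0 (N * (?jP + 2) + 2) (\<lambda>s'. reg s' rY = ?y)"
    proof (rule tc_For_eq[where Inv = "\<lambda>c s'. reg s' rY = ?y mod lcm_upto c \<and> reg s' rL = lcm_upto c"])
      fix c and s1 :: state
      assume c: "c < N" and I: "reg s1 rY = ?y mod lcm_upto c \<and> reg s1 rL = lcm_upto c"
        and rc: "reg s1 rMc = c" and k1: "keeps (For rMc rMod ?P) ?s0 s1" and b1: "bd W s1"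
      let ?m = "Suc c" and ?L = "lcm_upto c"
      have Lpos: "0 < ?L" by (rule lcm_upto_pos)
      have LW: "lcm ?L ?m < 2 ^ W"
        using lcm_upto_mono[of ?m N] c bnd(2) by simp
      have r1: "reg s1 rN = \<nu>" "reg s1 rK = k" "reg s1 rQ = bQ" "reg s1 rCu = cu" "reg s1 rMod = N"
        "reg s1 rKk = k * k" "reg s1 rTab = bT"
        using keeps_reg[OF k1] regs by simp_all
      have m1: "mem s1 = mem s" using keeps_mem[OF k1] by simp
      let ?s2 = "upd s1 rMo ?m"
      let ?x = "\<Sum>t<k * k. (M (t div k) (t mod k) mod ?m) * N ^ t"
      have dig: "M (t div k) (t mod k) mod ?m < N" for t
        by (rule less_le_trans[OF mod_less_divisor]) (use c in auto)
      have xlt: "?x < N ^ (k * k)" using dig by (intro digit_sum_less) auto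
      \<comment> \<open>The table holds the count for the reduced matrix as a number, not its
        residue; hence the further reduction modulo \<open>?m\<close>.\<close>
      have tx: "mem s (bT + ?x) mod ?m = ?y mod ?m"
      proof -
        have "mem s (bT + ?x) = hc (\<lambda>u v. ?x div N ^ (u * k + v) mod N) k" by (rule tab[OF xlt])
        also have "\<dots> = hc (\<lambda>u v. M u v mod ?m) k"
        proof (rule hc_cong)
          fix u v assume uv: "u < k" "v < k"
          have "?x div N ^ (u * k + v) mod N = M ((u * k + v) div k) ((u * k + v) mod k) mod ?m"
            by (rule digit_sum_div_mod) (use dig two_dim_index(3)[OF uv] in auto)
          then show "?x div N ^ (u * k + v) mod N = M u v mod ?m"
            by (simp only: two_dim_index[OF uv])
        qed (use k in simp)
        finally show ?thesis by (simp only: hc_mod)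
      qed
      show "tc W ?P s1 ?jP (\<lambda>s''. reg (upd s'' rMc ?m) rY = ?y mod lcm_upto ?m \<and> reg (upd s'' rMc ?m) rL = lcm_upto ?m)"
      proof (rule tc_Assign_Seq[where v = ?m], rule tc_SeqI)
        show "tc W Index ?s2 (k * k * 4 + 4) (\<lambda>s'. reg s' rIdx = ?x)"
          by (rule tc_Index[OF W]) (use r1 m1 M c bnd k in auto)
      next
        fix s3 assume b3: "bd W s3" and k3: "keeps Index ?s2 s3" and x3: "reg s3 rIdx = ?x"
        have r3: "reg s3 rMo = ?m" "reg s3 rY = ?y mod ?L" "reg s3 rL = ?L" "reg s3 rTab = bT"
          using keeps_reg[OF k3] r1 I by simp_all
        have m3: "mem s3 = mem s" using keeps_mem[OF k3] m1 by simp
        let ?s4 = "upd s3 rR (?y mod ?m)"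
        show "tc W ?P2 s3 (1 + ((N * 4 + 2) + (1 + ((N * 4 + 2) + 1))))
          (\<lambda>s''. reg (upd s'' rMc ?m) rY = ?y mod lcm_upto ?m \<and> reg (upd s'' rMc ?m) rL = lcm_upto ?m)"
        proof (rule tc_Assign_Seq[where v = "?y mod ?m"], rule tc_SeqI)
          have "tc W ?P3 ?s4 (?m * ((1 + 1) + 2) + 2) (\<lambda>s'. reg s' rY = ?y mod lcm ?L ?m)"
          proof (rule tc_For_eq[where Inv = "\<lambda>j s'. crt_inv ?L ?m ?y j (reg s' rY)"])
            show "crt_inv ?L ?m ?y 0 (reg (upd ?s4 rJ 0) rY)" using crt_inv_init[of ?L ?m ?y] r3 by simp
          next
            fix j and s' :: state assume j: "j < ?m" and I: "crt_inv ?L ?m ?y j (reg s' rY)" and k': "keeps ?P3 ?s4 s'"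
            have r': "reg s' rMo = ?m" "reg s' rL = ?L" "reg s' rR = ?y mod ?m"
              using keeps_reg[OF k'] r3 by simp_all
            note I2 = crt_inv_step[OF I]
            have "(if reg s' rY mod ?m = ?y mod ?m then reg s' rY else reg s' rY + ?L) < 2 ^ W"
            proof -
              have "(if reg s' rY mod ?m = ?y mod ?m then reg s' rY else reg s' rY + ?L) \<le> ?y mod lcm ?L ?m"
                using I2 by (simp add: crt_inv_def)
              also have "\<dots> < lcm ?L ?m" using Lpos by (simp add: lcm_pos_nat)
              finally show ?thesis using LW by linarith
            qed
            moreover have "(a - b + (b - a) = 0) \<longleftrightarrow> a = (b::nat)" for a b by auto
            ultimately show "tc W (Cond (Add (Sub (Mod (Reg rY) (Reg rMo)) (Reg rR)) (Sub (Reg rR) (Mod (Reg rY) (Reg rMo))))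
              (Assign rY (Add (Reg rY) (Reg rL))) Skip) s' (1 + 1) (\<lambda>s''. crt_inv ?L ?m ?y (Suc j) (reg (upd s'' rJ (Suc j)) rY))"
              using W I2 by (intro tc_Cond tc_Assign tc_Skip) (auto simp: ok_def r' split: if_splits)
          next
            fix s' :: state assume "crt_inv ?L ?m ?y ?m (reg s' rY)"
            then show "reg s' rY = ?y mod lcm ?L ?m" using Lpos by (rule crt_inv_final) simp
          qed (use W r3 in auto)
          then show "tc W ?P3 ?s4 (N * 4 + 2) (\<lambda>s'. reg s' rY = ?y mod lcm ?L ?m)"
            by (rule tc_le) (use c in simp)
        next
          fix s5 assume b5: "bd W s5" and k5: "keeps ?P3 ?s4 s5" and y5: "reg s5 rY = ?y mod lcm ?L ?m"
          have r5: "reg s5 rMo = ?m" "reg s5 rL = ?L"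
            using keeps_reg[OF k5] r3 by simp_all
          let ?s6 = "upd s5 rL2 ?L"
          show "tc W (Seq (Assign rL2 (Reg rL)) (Seq ?P4 (Assign rL (Reg rL2)))) s5 (1 + ((N * 4 + 2) + 1))
            (\<lambda>s''. reg (upd s'' rMc ?m) rY = ?y mod lcm_upto ?m \<and> reg (upd s'' rMc ?m) rL = lcm_upto ?m)"
          proof (rule tc_Assign_Seq[where v = ?L], rule tc_SeqI)
            have "tc W ?P4 ?s6 (?m * ((1 + 1) + 2) + 2) (\<lambda>s'. reg s' rL2 = lcm ?L ?m)"
            proof (rule tc_For_eq[where Inv = "\<lambda>j s'. lcm_inv ?L ?m j (reg s' rL2)"])
              show "lcm_inv ?L ?m 0 (reg (upd ?s6 rJ 0) rL2)" using lcm_inv_init[of ?L ?m] Lpos by simp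
            next
              fix j and s' :: state assume j: "j < ?m" and I: "lcm_inv ?L ?m j (reg s' rL2)" and k': "keeps ?P4 ?s6 s'"
              have r': "reg s' rMo = ?m" "reg s' rL = ?L"
                using keeps_reg[OF k'] r5 by simp_all
              note I2 = lcm_inv_step[OF I]
              have "(if reg s' rL2 mod ?m = 0 then reg s' rL2 else reg s' rL2 + ?L) < 2 ^ W"
                using I2 LW unfolding lcm_inv_def by linarith
              then show "tc W (Cond (Mod (Reg rL2) (Reg rMo)) (Assign rL2 (Add (Reg rL2) (Reg rL))) Skip) s' (1 + 1)
                (\<lambda>s''. lcm_inv ?L ?m (Suc j) (reg (upd s'' rJ (Suc j)) rL2))"
                using W I2 by (intro tc_Cond tc_Assign tc_Skip) (auto simp: ok_def r' split: if_splits)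
            next
              fix s' :: state assume "lcm_inv ?L ?m ?m (reg s' rL2)"
              then show "reg s' rL2 = lcm ?L ?m" using Lpos by (rule lcm_inv_final) simp
            qed (use W r5 in auto)
            then show "tc W ?P4 ?s6 (N * 4 + 2) (\<lambda>s'. reg s' rL2 = lcm ?L ?m)"
              by (rule tc_le) (use c in simp)
          next
            fix s7 assume k7: "keeps ?P4 ?s6 s7" and l7: "reg s7 rL2 = lcm ?L ?m"
            have "reg s7 rY = ?y mod lcm ?L ?m" using keeps_reg[OF k7] y5 by simp
            then show "tc W (Assign rL (Reg rL2)) s7 1
              (\<lambda>s''. reg (upd s'' rMc ?m) rY = ?y mod lcm_upto ?m \<and> reg (upd s'' rMc ?m) rL = lcm_upto ?m)"
              using W l7 LW by (intro tc_Assign) (auto simp: ok_def)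
          next
            show "?L < 2 ^ W" using bd_reg[OF b5, of rL] r5 by simp
          qed (use W r5 in \<open>auto simp: ok_def\<close>)
        next
          have "mem s (bT + ?x) < 2 ^ W" using bd_mem[OF b3] unfolding m3 .
          then show "?y mod ?m < 2 ^ W"
            unfolding tx[symmetric] by (rule le_less_trans[OF mod_less_eq_dividend])
        qed (use W r3 x3 m3 tx in \<open>auto simp: ok_def\<close>)
      next
        show "?m < 2 ^ W" using c bd_reg[OF b1, of rMod] r1 by simp
      qed (use W rc in \<open>auto simp: ok_def\<close>)
    next
      fix s' :: state assume "reg s' rY = ?y mod lcm_upto N \<and> reg s' rL = lcm_upto N"
      then show "reg s' rY = ?y" using y by simp
    qed (use W regs in auto)
  qed (use W in \<open>auto simp: ok_def\<close>)
  then show ?thesis by (rule tc_le) simp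
qed

subsection \<open>Parameters\<close>

lemma le_two_power: "k + 1 \<le> (2::nat) ^ k"
  by (induction k) auto

lemma self_power_le: "\<nu> ^ \<nu> \<le> (2::nat) ^ (\<nu> * \<nu>)"
proof -
  have "\<nu> ^ \<nu> \<le> (2 ^ \<nu>) ^ \<nu>" using le_two_power[of \<nu>] by (intro power_mono) auto
  then show ?thesis by (simp add: power_mult)
qed

lemma affine_le_two_power: "2 ^ e * \<nu> + 1 \<le> (2::nat) ^ (e + \<nu>)"
proof -
  have "2 ^ e * \<nu> + 1 \<le> 2 ^ e * (\<nu> + 1)" by simp
  also have "\<dots> \<le> 2 ^ e * 2 ^ \<nu>" using le_two_power by (intro mult_le_mono2)
  finally show ?thesis by (simp add: power_add)
qed

text \<open>The sizes used by the algorithm: \<open>p\<close> is a power of two slightly larger than \<open>n\<close>, entries are at most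
  \<open>2\<^bsup>p^d\<^esup>\<close>, the Kronecker base is \<open>2\<^bsup>p^(d+3)\<^esup>\<close>, the moduli range up to \<open>N = p\<^bsup>d+8\<^esup>\<close>, and
  no cell exceeds \<open>2\<^bsup>N^2\<^esup>\<close>.\<close>

locale params =
  fixes n p lg d :: nat
  assumes n: "1 \<le> n" and np: "n + 2 \<le> p" and p: "p = 2 ^ lg" and d: "3 \<le> d"
begin

definition "a = (2::nat) ^ (p ^ d)"
definition "B = (2::nat) ^ (p ^ (d + 3))"
definition "N = p ^ (d + 8)"
definition "W = N * N"

lemma p4: "4 \<le> p"
proof -
  have "lg \<noteq> 0" "lg \<noteq> 1" using n np p by (auto intro!: Nat.gr0I)
  then have "(2::nat) ^ 2 \<le> 2 ^ lg" by (intro power_increasing) auto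
  then show ?thesis using p by simp
qed

text \<open>Up to four terms of size p^i fit into the next power of p; this is how sums are absorbed
  in the size bounds.\<close>

lemma four_power_step: "4 * p ^ i \<le> p ^ Suc i"
  using p4 by simp

lemma p_power_mono: "i \<le> j \<Longrightarrow> p ^ i \<le> p ^ j"
  using p4 by (intro power_increasing) auto

lemma p_power_pos: "0 < p ^ i"
  using p4 by simp

lemma less_two_power_W: "x \<le> N \<Longrightarrow> x < 2 ^ W"
proof -
  assume "x \<le> N"
  also have "N < 2 ^ N" using le_two_power[of N] by simp
  also have "\<dots> \<le> 2 ^ W" using p_power_pos[of "d + 8"] by (intro power_increasing) (auto simp: W_def N_def)
  finally show ?thesis .
qed

lemma two_power_less_W: "e \<le> N \<Longrightarrow> 2 ^ e < (2::nat) ^ W"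
proof -
  assume e: "e \<le> N"
  have "4 * p ^ (d + 7) \<le> N" unfolding N_def using four_power_step[of "d + 7"] by (simp add: add.commute)
  then have "4 \<le> N" using p_power_pos[of "d + 7"] by linarith
  then have "N * 4 \<le> W" unfolding W_def by (intro mult_le_mono2)
  then have "e < W" using e \<open>4 \<le> N\<close> by linarith
  then show ?thesis by simp
qed

lemma N_self_power_less: "N ^ N < 2 ^ W"
proof -
  have "N ^ N < (2 ^ N) ^ N"
    using le_two_power[of N] p_power_pos[of "d + 8"] by (intro power_strict_mono) (auto simp: N_def)
  then show ?thesis by (simp add: power_mult W_def)
qed

lemma W_ge: "2 \<le> W"
proof -
  have "4 * p ^ (d + 7) \<le> N" unfolding N_def using four_power_step[of "d + 7"] by (simp add: add.commute)
  then have "4 \<le> N" using p_power_pos[of "d + 7"] by linarith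
  then have "2 * 1 \<le> N * N" by (intro mult_le_mono) auto
  then show ?thesis by (simp add: W_def)
qed

lemma square_le_N: "\<nu> \<le> n \<Longrightarrow> \<nu> * \<nu> \<le> N"
proof -
  assume "\<nu> \<le> n"
  then have "\<nu> * \<nu> \<le> p * p" using np by (intro mult_le_mono) auto
  also have "\<dots> = p ^ 2" by (simp add: power2_eq_square)
  also have "\<dots> \<le> N" unfolding N_def by (rule p_power_mono) simp
  finally show ?thesis .
qed

lemma cube_le_N: "\<nu> \<le> n \<Longrightarrow> \<nu> * (\<nu> * \<nu>) \<le> N"
proof -
  assume "\<nu> \<le> n"
  then have "\<nu> * (\<nu> * \<nu>) \<le> p * (p * p)" using np by (intro mult_le_mono) auto
  also have "\<dots> = p ^ 3" by (simp add: power3_eq_cube)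
  also have "\<dots> \<le> N" unfolding N_def by (rule p_power_mono) simp
  finally show ?thesis .
qed

lemma addr_le_N: "n * n + n * n + (n * n + n * (n * n)) \<le> N"
proof -
  have "n * n \<le> p * p" "n * (n * n) \<le> p * (p * p)" using np by (auto intro!: mult_le_mono)
  moreover have "p * p \<le> p * (p * p)" using p4 by simp
  ultimately have "n * n + n * n + (n * n + n * (n * n)) \<le> 4 * (p * (p * p))" by linarith
  also have "\<dots> = 4 * p ^ 3" by (simp add: power3_eq_cube)
  also have "\<dots> \<le> p ^ 4" using four_power_step[of 3] by simp
  also have "\<dots> \<le> N" unfolding N_def by (rule p_power_mono) simp
  finally show ?thesis .
qed

lemma N_power_less: "k \<le> n \<Longrightarrow> N ^ (k * k) < 2 ^ W"
proof -
  assume "k \<le> n"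
  then have "N ^ (k * k) \<le> N ^ N"
    using square_le_N p_power_pos[of "d + 8"] by (intro power_increasing) (auto simp: N_def)
  then show ?thesis using N_self_power_less by (rule le_less_trans)
qed

lemma lcm_upto_less: "lcm_upto N < 2 ^ W"
  using lcm_upto_le[of N] N_self_power_less by (rule le_less_trans)

text \<open>The left side has about (1 + p^d + \<nu>) * \<nu>^2 bits; the first factor is at most
  p^(d+1) and the second is below p^2, hence the exponent d + 3 in B.\<close>

lemma B_large: "\<nu> \<le> n \<Longrightarrow> \<nu> ^ \<nu> * (a * \<nu> + 1) ^ (\<nu> * \<nu>) < B"
proof -
  assume \<nu>: "\<nu> \<le> n"
  let ?e = "p ^ d"
  have "\<nu> ^ \<nu> * (a * \<nu> + 1) ^ (\<nu> * \<nu>) \<le> 2 ^ (\<nu> * \<nu>) * (2 ^ (?e + \<nu>)) ^ (\<nu> * \<nu>)"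
    unfolding a_def by (intro mult_le_mono self_power_le power_mono affine_le_two_power) auto
  also have "\<dots> = 2 ^ (\<nu> * \<nu> + (?e + \<nu>) * (\<nu> * \<nu>))" by (simp add: power_add power_mult)
  also have "\<nu> * \<nu> + (?e + \<nu>) * (\<nu> * \<nu>) < p ^ (d + 3)"
  proof -
    have "p ^ 1 \<le> ?e" using d by (intro p_power_mono) simp
    then have "1 + ?e + \<nu> \<le> 4 * ?e" using \<nu> np by simp
    then have "1 + ?e + \<nu> \<le> p ^ Suc d" using four_power_step[of d] by linarith
    moreover have "\<nu> * \<nu> < p * p" using \<nu> np by (intro mult_strict_mono) auto
    ultimately have "(1 + ?e + \<nu>) * (\<nu> * \<nu>) < p ^ Suc d * (p * p)"
      using p_power_pos[of "Suc d"] by (rule le_less_trans[OF mult_le_mono1 mult_less_mono2])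
    then show ?thesis by (simp add: algebra_simps power_add power3_eq_cube)
  qed
  then have "(2::nat) ^ (\<nu> * \<nu> + (?e + \<nu>) * (\<nu> * \<nu>)) < B"
    unfolding B_def by (intro power_strict_increasing) auto
  finally show ?thesis .
qed

text \<open>B contributes p^(d+3) bits; joining \<open>a\<close> and \<nu> to it costs one power of
  p, and the exponent \<nu> costs another.\<close>

lemma entry_bound: "\<nu> \<le> n \<Longrightarrow> (B * a * \<nu> + 1) ^ \<nu> \<le> 2 ^ (p ^ (d + 5))"
proof -
  assume \<nu>: "\<nu> \<le> n"
  let ?b = "p ^ (d + 3)" and ?e = "p ^ d"
  have "(B * a * \<nu> + 1) ^ \<nu> \<le> (2 ^ (?b + ?e + \<nu>)) ^ \<nu>"
    using affine_le_two_power[of "?b + ?e" \<nu>]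
    by (intro power_mono) (auto simp: B_def a_def power_add)
  also have "\<dots> = 2 ^ ((?b + ?e + \<nu>) * \<nu>)" by (simp add: power_mult)
  also have "\<dots> \<le> 2 ^ (p ^ (d + 5))"
  proof (rule power_increasing)
    have "?e \<le> ?b" by (intro p_power_mono) simp
    moreover have "p \<le> ?b" using p_power_mono[of 1 "d + 3"] by simp
    ultimately have "?b + ?e + \<nu> \<le> 4 * ?b" using \<nu> np by linarith
    also have "\<dots> \<le> p ^ (d + 4)" using four_power_step[of "d + 3"] by (simp add: add.commute)
    finally have "(?b + ?e + \<nu>) * \<nu> \<le> p ^ (d + 4) * p" using \<nu> np by (intro mult_le_mono) auto
    then show "(?b + ?e + \<nu>) * \<nu> \<le> p ^ (d + 5)" by (simp add: mult.commute add.commute flip: power_Suc)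
  qed simp
  finally show ?thesis .
qed

lemma entry_less: "\<nu> \<le> n \<Longrightarrow> (B * a * \<nu> + 1) ^ \<nu> < 2 ^ W"
  by (rule le_less_trans[OF entry_bound two_power_less_W]) (simp_all add: N_def p_power_mono)

lemma B_power_less: "\<nu> \<le> n \<Longrightarrow> B ^ \<nu> < 2 ^ W"
proof -
  assume \<nu>: "\<nu> \<le> n"
  have "B ^ \<nu> = 2 ^ (p ^ (d + 3) * \<nu>)" by (simp add: B_def power_mult)
  also have "\<dots> < 2 ^ W"
  proof (rule two_power_less_W)
    have "p ^ (d + 3) * \<nu> \<le> p ^ (d + 3) * p" using \<nu> np by (intro mult_le_mono2) auto
    also have "\<dots> = p ^ (d + 4)" by (simp add: mult.commute add.commute flip: power_Suc)
    also have "\<dots> \<le> N" unfolding N_def by (rule p_power_mono) simp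
    finally show "p ^ (d + 3) * \<nu> \<le> N" .
  qed
  finally show ?thesis .
qed

lemma power_B_less: "\<nu> \<le> n \<Longrightarrow> 2 ^ \<nu> * B < 2 ^ W"
proof -
  assume \<nu>: "\<nu> \<le> n"
  have "2 ^ \<nu> * B = 2 ^ (\<nu> + p ^ (d + 3))" by (simp add: B_def power_add)
  also have "\<dots> < 2 ^ W"
  proof (rule two_power_less_W)
    have "p ^ 1 \<le> p ^ (d + 3)" by (rule p_power_mono) simp
    then have "\<nu> + p ^ (d + 3) \<le> 4 * p ^ (d + 3)" using \<nu> np by simp
    also have "\<dots> \<le> p ^ (d + 4)" using four_power_step[of "d + 3"] by (simp add: add.commute)
    also have "\<dots> \<le> N" unfolding N_def by (rule p_power_mono) simp
    finally show "\<nu> + p ^ (d + 3) \<le> N" .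
  qed
  finally show ?thesis .
qed

text \<open>The exponent d + 8 of N originates here: k^k times the k-th power of the entry bound is
  below 4^(p^(d+7)), and \<open>four_power_le_lcm_upto\<close> then asks for moduli up to 2 *
  p^(d+7) + 1.\<close>

lemma hc_less_lcm_upto:
  assumes "1 \<le> k" "k \<le> n" "\<And>u v. u < k \<Longrightarrow> v < k \<Longrightarrow> M u v \<le> (2::nat) ^ (p ^ (d + 5))"
  shows "hc M k < lcm_upto N"
proof -
  have "hc M k \<le> k ^ k * (2 ^ (p ^ (d + 5))) ^ k" using assms by (intro hc_le) auto
  also have "\<dots> \<le> 2 ^ (k * k) * (2 ^ (p ^ (d + 5))) ^ k" by (intro mult_le_mono1 self_power_le)
  also have "\<dots> = 2 ^ (k * k + p ^ (d + 5) * k)" by (simp add: power_add power_mult)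
  also have "\<dots> < 4 ^ (p ^ (d + 7))"
  proof -
    have "k * k \<le> p * p" using assms np by (intro mult_le_mono) auto
    also have "\<dots> = p ^ 2" by (simp add: power2_eq_square)
    also have "\<dots> \<le> p ^ (d + 6)" by (rule p_power_mono) simp
    finally have "k * k \<le> p ^ (d + 6)" .
    moreover have "p ^ (d + 5) * k \<le> p ^ (d + 5) * p" using assms np by (intro mult_le_mono2) auto
    moreover have "p ^ (d + 5) * p = p ^ (d + 6)" by (simp add: mult.commute add.commute flip: power_Suc)
    moreover have "4 * p ^ (d + 6) \<le> p ^ (d + 7)" using four_power_step[of "d + 6"] by (simp add: add.commute)
    ultimately have "k * k + p ^ (d + 5) * k < 2 * p ^ (d + 7)"
      using p_power_pos[of "d + 6"] by linarith
    then have "(2::nat) ^ (k * k + p ^ (d + 5) * k) < 2 ^ (2 * p ^ (d + 7))"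
      by (intro power_strict_increasing) auto
    then show ?thesis by (simp add: power_mult)
  qed
  also have "\<dots> \<le> lcm_upto (2 * p ^ (d + 7) + 1)" by (rule four_power_le_lcm_upto)
  also have "\<dots> \<le> lcm_upto N"
  proof (rule lcm_upto_mono)
    have "4 * p ^ (d + 7) \<le> N" unfolding N_def using four_power_step[of "d + 7"] by (simp add: add.commute)
    then show "2 * p ^ (d + 7) + 1 \<le> N" using p_power_pos[of "d + 7"] by linarith
  qed
  finally show ?thesis .
qed

lemma d_le: "2 * (d + 8) \<le> p ^ d"
proof -
  have "2 * (d + 8) \<le> 4 ^ d" using d by (induction d rule: dec_induct) auto
  also have "\<dots> \<le> p ^ d" using p4 by (intro power_mono) auto
  finally show ?thesis .
qed

lemma lg_less: "lg < p"
  using p le_two_power[of lg] by simp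

text \<open>Matrices in the table have entries below N; bounding N by \<open>a\<close> lets the same
  Kronecker base B serve for them.\<close>

lemma N_le_a: "N \<le> a"
proof -
  have "d + 8 \<le> 4 ^ (d - 1)" using d
  proof (induction d rule: dec_induct)
    case (step m)
    then obtain m' where "m = Suc m'" by (cases m) auto
    with step show ?case by simp
  qed simp
  also have "\<dots> \<le> p ^ (d - 1)" using p4 by (intro power_mono) auto
  finally have "lg * (d + 8) \<le> p * p ^ (d - 1)" using lg_less by (intro mult_le_mono) auto
  also have "\<dots> = p ^ d" using d by (simp add: power_eq_if)
  finally have "(2::nat) ^ (lg * (d + 8)) \<le> 2 ^ (p ^ d)" by (intro power_increasing) auto
  moreover have "p ^ (d + 8) = 2 ^ (lg * (d + 8))" unfolding p power_mult ..
  ultimately show ?thesis by (simp add: a_def N_def)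
qed

lemma p_le_N: "p \<le> N"
  unfolding N_def using p_power_mono[of 1 "d + 8"] by simp

lemma small_le_N: "2 * (d + 8) \<le> N" "d + 8 \<le> N" "d + 3 \<le> N"
  "2 * (d + 8) * lg \<le> N" "p ^ (d + 3) \<le> N"
proof -
  have "p ^ d \<le> N" unfolding N_def by (rule p_power_mono) simp
  then show "2 * (d + 8) \<le> N" using d_le by linarith
  then show "d + 8 \<le> N" by (rule order_trans[rotated]) simp
  then show "d + 3 \<le> N" by (rule order_trans[rotated]) simp
  have "2 * (d + 8) * lg \<le> p ^ d * p" using lg_less d_le by (intro mult_le_mono) auto
  also have "\<dots> = p ^ (d + 1)" by (simp add: mult.commute)
  also have "\<dots> \<le> N" unfolding N_def by (rule p_power_mono) simp
  finally show "2 * (d + 8) * lg \<le> N" .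
  show "p ^ (d + 3) \<le> N" unfolding N_def by (rule p_power_mono) simp
qed

end

subsection \<open>The table of small instances\<close>

abbreviation (input) rIx :: nat where "rIx \<equiv> 40"
abbreviation (input) rSz :: nat where "rSz \<equiv> 41"
abbreviation (input) rDig :: nat where "rDig \<equiv> 42"
abbreviation (input) rW :: nat where "rW \<equiv> 43"

text \<open>With a single vertex in K the inner matrix is 1 x 1, and its count is its only entry;
  nothing remains to be computed.\<close>

definition Load :: prog where
  "Load = Assign rY (Mem (Add (Reg rQ) (Reg rCu)))"

lemma Load_frame [simp]: "mods Load = {rY}" "nostore Load"
  by (auto simp: Load_def)

text \<open>The inverse of the packing in \<open>Index\<close>: a table index is unpacked into a
  matrix in row-major order.\<close>

definition Digits :: prog where
  "Digits = Seq (Assign rDig (Reg rIx)) (For rW rKk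
     (Seq (Store (Add (Reg rA) (Reg rW)) (Mod (Reg rDig) (Reg rMod))) (Assign rDig (Div (Reg rDig) (Reg rMod)))))"

lemma Digits_frame [simp]: "mods Digits = {rDig, rW}"
  by (auto simp: Digits_def)

lemma tc_Digits:
  assumes W: "2 \<le> W" and regs: "reg s rA = bA" "reg s rIx = x" "reg s rMod = N" "reg s rKk = K"
    and N: "1 \<le> N"
  shows "tc W Digits s (K * 5 + 3) (\<lambda>s'. (\<forall>t<K. mem s' (bA + t) = x div N ^ t mod N) \<and>
    (\<forall>a. a < bA \<or> bA + K \<le> a \<longrightarrow> mem s' a = mem s a))" (is "tc W Digits s _ ?Q")
proof -
  let ?P = "Seq (Store (Add (Reg rA) (Reg rW)) (Mod (Reg rDig) (Reg rMod))) (Assign rDig (Div (Reg rDig) (Reg rMod)))"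
  let ?s0 = "upd s rDig x"
  let ?Inv = "\<lambda>T s'. (\<forall>t<T. mem s' (bA + t) = x div N ^ t mod N) \<and>
        (\<forall>a. a < bA \<or> bA + K \<le> a \<longrightarrow> mem s' a = mem s a) \<and> reg s' rDig = x div N ^ T"
  have "tc W Digits s (1 + (K * ((2 + 1) + 2) + 2)) ?Q"
    unfolding Digits_def
  proof (rule tc_bd, rule tc_Assign_Seq[where v = x])
    show "tc W (For rW rKk ?P) ?s0 (K * ((2 + 1) + 2) + 2) ?Q"
    proof (rule tc_For_eq[where Inv = ?Inv])
      fix T and s1 :: state
      assume T: "T < K" and I: "?Inv T s1"
        and rw: "reg s1 rW = T" and k1: "keeps (For rW rKk ?P) ?s0 s1" and b1: "bd W s1"
      have r1: "reg s1 rA = bA" "reg s1 rMod = N" using keeps_reg[OF k1] regs by simp_all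
      have q: "x div N ^ T < 2 ^ W" using I bd_reg[OF b1] by metis
      then have q1: "x div N ^ T mod N < 2 ^ W" by (rule le_less_trans[OF mod_less_eq_dividend])
      have q2: "x div N ^ T div N < 2 ^ W" using q by (rule le_less_trans[OF div_le_dividend])
      have d: "x div N ^ T div N = x div (N * N ^ T)" by (simp add: div_mult2_eq[symmetric] mult.commute)
      let ?s2 = "sto s1 (bA + T) (x div N ^ T mod N)"
      show "tc W ?P s1 (2 + 1) (\<lambda>s'. ?Inv (Suc T) (upd s' rW (Suc T)))"
      proof (rule tc_SeqI)
        show "tc W (Store (Add (Reg rA) (Reg rW)) (Mod (Reg rDig) (Reg rMod))) s1 2 (\<lambda>s'. s' = ?s2)"
          using W I q1 by (intro tc_Store) (auto simp: ok_def r1 rw)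
      next
        fix s2 assume s2: "s2 = ?s2"
        show "tc W (Assign rDig (Div (Reg rDig) (Reg rMod))) s2 1
          (\<lambda>s'. ?Inv (Suc T) (upd s' rW (Suc T)))"
          unfolding s2 using W I T q2 by (intro tc_Assign) (auto simp: ok_def r1 rw d less_Suc_eq)
      qed
    qed (use W regs in auto)
  next
    assume "bd W s"
    then show "x < 2 ^ W" using bd_reg[of W s rIx] regs by simp
  qed (use W regs in \<open>auto simp: ok_def\<close>)
  then show ?thesis by (rule tc_le) simp
qed

lemma hc_1 [simp]: "hc M (Suc 0) = M 0 0"
  by (simp add: hc_def)

definition Table :: prog where
  "Table = For rIx rSz (Seq Digits (Seq (Ham Load) (Store (Add (Reg rTab) (Reg rIx)) (Reg rPos))))"

lemma mods_Table: "mods Table \<subseteq> {7..34} \<union> {40, 42, 43}"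
  using mods_Ham[of Load] by (auto simp: Table_def Load_def)

definition ham_steps :: "nat \<Rightarrow> nat \<Rightarrow> nat \<Rightarrow> nat" where
  "ham_steps \<nu> k j = 2 ^ (\<nu> - k) * (\<nu> * (\<nu> * \<nu>) * (\<nu> * 5 + 10) + \<nu> * 5 + j + 11) + \<nu> * \<nu> * 4 + \<nu> * 6 + 17"

text \<open>\<open>AQ\<close> and \<open>QT\<close> keep matrix, scratch space and table apart.
  Preserving the cells below \<open>bA\<close> protects the input of the main computation, which is
  stored there.\<close>

lemma tc_Table:
  assumes W: "2 \<le> W"
    and regs: "reg s rN = k" "reg s rK = 1" "reg s rA = bA" "reg s rQ = bQ" "reg s rB = B" "reg s rMod = N"
      "reg s rKk = k * k" "reg s rSz = N ^ (k * k)" "reg s rTab = bT"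
    and k: "1 \<le> k" and N: "1 \<le> N" "N \<le> a"
    and AQ: "bA + k * k \<le> bQ" and QT: "bQ + (k * k + k * (k * k)) \<le> bT"
    and B: "k ^ k * (a * k + 1) ^ (k * k) < B"
    and bnd: "(B * a * k + 1) ^ k < 2 ^ W" "B ^ k < 2 ^ W" "2 ^ k * B < 2 ^ W" "k * (k * k) < 2 ^ W"
  shows "tc W Table s (N ^ (k * k) * (k * k * 5 + ham_steps k 1 1 + 7) + 2) (\<lambda>s'.
    (\<forall>x<N ^ (k * k). mem s' (bT + x) = hc (\<lambda>u v. x div N ^ (u * k + v) mod N) k) \<and>
    (\<forall>a<bA. mem s' a = mem s a))" (is "tc W Table s _ ?Q")
proof -
  let ?P = "Seq Digits (Seq (Ham Load) (Store (Add (Reg rTab) (Reg rIx)) (Reg rPos)))"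
  let ?K = "k * k"
  let ?Inv = "\<lambda>X s'. (\<forall>x<X. mem s' (bT + x) = hc (\<lambda>u v. x div N ^ (u * k + v) mod N) k) \<and>
    (\<forall>a<bA. mem s' a = mem s a)"
  have mods_P: "mods (For rIx rSz ?P) \<subseteq> {7..34} \<union> {40, 42, 43}"
    using mods_Table by (simp add: Table_def)
  have "tc W (For rIx rSz ?P) s (N ^ ?K * ((?K * 5 + 3) + (ham_steps k 1 1 + 2) + 2) + 2) ?Q"
  proof (rule tc_For_eq[where Inv = ?Inv])
    fix X and s1 :: state
    assume X: "X < N ^ ?K" and I: "?Inv X s1" and rx: "reg s1 rIx = X" and k1: "keeps (For rIx rSz ?P) s s1"
    have g1: "reg s1 r = reg s r" if "r \<notin> {7..34} \<union> {40, 42, 43}" for r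
      using keeps_reg[OF k1] mods_P that by blast
    have r1: "reg s1 rN = k" "reg s1 rK = 1" "reg s1 rA = bA" "reg s1 rQ = bQ" "reg s1 rB = B" "reg s1 rMod = N"
      "reg s1 rKk = k * k" "reg s1 rTab = bT"
      by (simp_all add: g1 regs del: One_nat_def)
    let ?M = "\<lambda>u v. X div N ^ (u * k + v) mod N"
    show "tc W ?P s1 ((?K * 5 + 3) + (ham_steps k 1 1 + 2)) (\<lambda>s'.
      ?Inv (Suc X) (upd s' rIx (Suc X)))"
    proof (rule tc_SeqI)
      show "tc W Digits s1 (?K * 5 + 3) (\<lambda>s'. (\<forall>t<?K. mem s' (bA + t) = X div N ^ t mod N) \<and>
         (\<forall>a. a < bA \<or> bA + ?K \<le> a \<longrightarrow> mem s' a = mem s1 a))"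
        by (rule tc_Digits[OF W r1(3) rx r1(6,7) N(1)])
    next
      fix s2 assume k2: "keeps Digits s1 s2" and d2: "(\<forall>t<?K. mem s2 (bA + t) = X div N ^ t mod N) \<and>
         (\<forall>a. a < bA \<or> bA + ?K \<le> a \<longrightarrow> mem s2 a = mem s1 a)"
      note g2 = keeps_reg[OF k2]
      have r2: "reg s2 rN = k" "reg s2 rK = 1" "reg s2 rA = bA" "reg s2 rQ = bQ" "reg s2 rB = B"
        by (simp_all add: g2 r1 del: One_nat_def)
      show "tc W (Seq (Ham Load) (Store (Add (Reg rTab) (Reg rIx)) (Reg rPos))) s2 (ham_steps k 1 1 + 2) (\<lambda>s'.
        ?Inv (Suc X) (upd s' rIx (Suc X)))"
      proof (rule tc_SeqI)
        show "tc W (Ham Load) s2 (ham_steps k 1 1) (\<lambda>s'. reg s' rPos = hc ?M k \<and>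
           (\<forall>a. a < bQ \<or> bQ + (k * k + k * (k * k)) \<le> a \<longrightarrow> mem s' a = mem s2 a))"
          unfolding ham_steps_def
        proof (rule tc_Ham[where A = ?M and a = a, OF W r2])
          fix u v assume uv: "u < k" "v < k"
          show "mem s2 (bA + (u * k + v)) = ?M u v" using d2 two_dim_index(3)[OF uv] by simp
          have "?M u v < N" using N by simp
          then show "?M u v \<le> a" using N by linarith
        next
          fix c and s' :: state
          assume gg: "\<And>r. r \<notin> {7..34} \<Longrightarrow> reg s' r = reg s2 r" and cu: "reg s' rCu = k * (k * k)"
            and q: "\<And>u v. u < k \<Longrightarrow> v < k \<Longrightarrow> mem s' (bQ + (k * (k * k) + (u * k + v))) = kq B ?M (dec 1 c) k u v"
          have "reg s' rQ = bQ" using gg r2 by simp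
          moreover have "mem s' (bQ + k * (k * k)) = kq B ?M (dec 1 c) k 0 0" using q[of 0 0] k by simp
          ultimately show "tc W Load s' 1 (\<lambda>s''. reg s'' rY = hc (kq B ?M (dec 1 c) k) 1)"
            unfolding Load_def using W bd_mem[of W s' "bQ + k * (k * k)"]
            by (intro tc_Assign) (auto simp: ok_def cu)
        qed (use k AQ B bnd in \<open>auto simp: Load_def\<close>)
      next
        fix s3 assume b3: "bd W s3" and k3: "keeps (Ham Load) s2 s3" and h3: "reg s3 rPos = hc ?M k \<and>
           (\<forall>a. a < bQ \<or> bQ + (k * k + k * (k * k)) \<le> a \<longrightarrow> mem s3 a = mem s2 a)"
        have g3: "reg s3 r = reg s2 r" if "r \<notin> {7..24}" for r
        proof (rule keeps_reg[OF k3])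
          have "mods (Ham Load) \<subseteq> {7..24}" using mods_Ham[of Load] by auto
          then show "r \<notin> mods (Ham Load)" using that by blast
        qed
        have r3: "reg s3 rTab = bT" "reg s3 rIx = X"
          by (simp_all add: g3 g2 r1 rx)
        have hW: "hc ?M k < 2 ^ W" using h3 bd_reg[OF b3] by metis
        have old: "mem s3 (bT + x) = mem s1 (bT + x)" for x
        proof -
          have "bQ + (k * k + k * (k * k)) \<le> bT + x" "bA + ?K \<le> bT + x" using QT AQ by linarith+
          then show ?thesis using h3 d2 by simp
        qed
        have low: "mem s3 a' = mem s a'" if "a' < bA" for a'
          using that h3 d2 I AQ by simp
        show "tc W (Store (Add (Reg rTab) (Reg rIx)) (Reg rPos)) s3 2 (\<lambda>s'.
          ?Inv (Suc X) (upd s' rIx (Suc X)))"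
          using W I h3 hW low AQ QT
          by (intro tc_Store) (auto simp: ok_def r3 old less_Suc_eq)
      qed
    qed
  next
    show "rIx \<notin> mods ?P" "rSz \<notin> mods ?P" using mods_Ham[of Load] by (auto simp: Load_def)
  qed (use W regs in auto)
  then show ?thesis unfolding Table_def by (rule tc_le) (simp add: algebra_simps)
qed

subsection \<open>Choosing the parameters\<close>

abbreviation (input) rP :: nat where "rP \<equiv> 44"
abbreviation (input) rLg :: nat where "rLg \<equiv> 45"
abbreviation (input) rNn :: nat where "rNn \<equiv> 46"
abbreviation (input) rTmp :: nat where "rTmp \<equiv> 47"
abbreviation (input) rEx :: nat where "rEx \<equiv> 48"
abbreviation (input) rSmall :: nat where "rSmall \<equiv> 39"
abbreviation (input) rLoop :: nat where "rLoop \<equiv> 49"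

text \<open>For a power of two the logarithm is an exact integer, so the table size can be
  controlled in integer arithmetic. Doubling n + 2 times is more than enough.\<close>

definition Find_p :: prog where
  "Find_p = Seq (Assign rP (Lit 1)) (Seq (Assign rLg (Lit 0)) (Seq (Assign rNn (Add (Reg 0) (Lit 2)))
     (For rLoop rNn (Cond (Sub (Reg rNn) (Reg rP))
       (Seq (Assign rP (Mul (Reg rP) (Lit 2))) (Assign rLg (Add (Reg rLg) (Lit 1)))) Skip))))"

lemma Find_p_frame [simp]: "mods Find_p = {rP, rLg, rNn, rLoop}" "nostore Find_p"
  by (auto simp: Find_p_def)

lemma tc_Find_p:
  assumes W: "2 \<le> W" and n: "reg s 0 = n" and bnd: "2 * (n + 2) \<le> 2 ^ W"
  shows "tc W Find_p s (n * 5 + 15) (\<lambda>s'. \<exists>lg. reg s' rP = 2 ^ lg \<and> reg s' rLg = lg \<and> n + 2 \<le> 2 ^ lg \<and> 2 ^ lg < 2 * (n + 2))"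
    (is "tc W Find_p s _ ?Q")
proof -
  let ?P = "Cond (Sub (Reg rNn) (Reg rP))
       (Seq (Assign rP (Mul (Reg rP) (Lit 2))) (Assign rLg (Add (Reg rLg) (Lit 1)))) Skip"
  let ?s0 = "upd (upd (upd s rP 1) rLg 0) rNn (n + 2)"
  let ?Inv = "\<lambda>i s'. reg s' rP = 2 ^ reg s' rLg \<and> 2 ^ reg s' rLg < 2 * (n + 2) \<and>
        (n + 2 \<le> 2 ^ reg s' rLg \<or> reg s' rLg = i)"
  have "tc W Find_p s (1 + (1 + (1 + ((n + 2) * ((1 + (1 + 1)) + 2) + 2)))) ?Q"
    unfolding Find_p_def
  proof (rule tc_Assign_Seq[where v = 1], rule tc_Assign_Seq[where v = 0], rule tc_Assign_Seq[where v = "n + 2"])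
    show "tc W (For rLoop rNn ?P) ?s0 ((n + 2) * ((1 + (1 + 1)) + 2) + 2) ?Q"
    proof (rule tc_For_eq[where Inv = ?Inv])
      fix i and s1 :: state
      assume I: "reg s1 rP = 2 ^ reg s1 rLg \<and> 2 ^ reg s1 rLg < 2 * (n + 2) \<and>
        (n + 2 \<le> 2 ^ reg s1 rLg \<or> reg s1 rLg = i)" and k1: "keeps (For rLoop rNn ?P) ?s0 s1"
      have nn: "reg s1 rNn = n + 2" using keeps_reg[OF k1, of rNn] by simp
      let ?lg = "reg s1 rLg"
      have l: "?lg + 1 \<le> 2 ^ ?lg" by (rule le_two_power)
      show "tc W ?P s1 (1 + (1 + 1)) (\<lambda>s'. ?Inv (Suc i) (upd s' rLoop (Suc i)))"
      proof (rule tc_Cond)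
        assume "val (Sub (Reg rNn) (Reg rP)) s1 \<noteq> 0"
        then have lt: "2 ^ ?lg < n + 2" using I nn by simp
        then have lt2: "2 * 2 ^ ?lg < 2 * (n + 2)" by simp
        have lt3: "2 * 2 ^ ?lg < (2::nat) ^ W" using lt2 bnd by linarith
        have lt4: "?lg + 1 < 2 ^ W" using l lt3 by linarith
        have i: "?lg = i" using I lt by linarith
        show "tc W (Seq (Assign rP (Mul (Reg rP) (Lit 2))) (Assign rLg (Add (Reg rLg) (Lit 1)))) s1 (1 + 1)
          (\<lambda>s'. ?Inv (Suc i) (upd s' rLoop (Suc i)))"
        proof (rule tc_Assign_Seq[where v = "2 * 2 ^ ?lg"])
          show "tc W (Assign rLg (Add (Reg rLg) (Lit 1))) (upd s1 rP (2 * 2 ^ ?lg)) 1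
            (\<lambda>s'. ?Inv (Suc i) (upd s' rLoop (Suc i)))"
            using W lt2 lt4 i by (intro tc_Assign) (auto simp: ok_def)
        qed (use W I lt3 in \<open>auto simp: ok_def\<close>)
      next
        assume "val (Sub (Reg rNn) (Reg rP)) s1 = 0"
        then have "n + 2 \<le> 2 ^ ?lg" using I nn by simp
        then have "tc W Skip s1 1 (\<lambda>s'. ?Inv (Suc i) (upd s' rLoop (Suc i)))"
          using W I by (intro tc_Skip) auto
        then show "tc W Skip s1 (1 + 1) (\<lambda>s'. ?Inv (Suc i) (upd s' rLoop (Suc i)))"
          by (rule tc_le) simp
      qed (use W in \<open>auto simp: ok_def\<close>)
    next
      fix s1 :: state
      assume I: "reg s1 rP = 2 ^ reg s1 rLg \<and> 2 ^ reg s1 rLg < 2 * (n + 2) \<and>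
        (n + 2 \<le> 2 ^ reg s1 rLg \<or> reg s1 rLg = n + 2)"
      then have "n + 2 \<le> 2 ^ reg s1 rLg" using le_two_power[of "n + 2"] by auto
      then show "?Q s1" using I by simp
    qed (use W in auto)
  next
    show "n + 2 < 2 ^ W" by (rule less_le_trans[OF _ bnd]) simp
  qed (use W n in \<open>auto simp: ok_def\<close>)
  then show ?thesis by (rule tc_le) simp
qed

text \<open>With D = d + 8 the table has N^(k^2) = 2^(D * lg * k^2) entries; the factor 2 in
  \<open>2 * D\<close> aims at 2^(n/2). The guard holds exactly if k + 1 still satisfies the
  inequality.\<close>

definition Find_k :: "nat \<Rightarrow> prog" where
  "Find_k D = Seq (Assign rSmall (Lit 1)) (Seq (Assign rTmp (Mul (Lit (2 * D)) (Reg rLg)))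
     (For rLoop 0 (Cond (Sub (Add (Reg 0) (Lit 1))
         (Mul (Reg rTmp) (Mul (Add (Reg rSmall) (Lit 1)) (Add (Reg rSmall) (Lit 1)))))
       (Assign rSmall (Add (Reg rSmall) (Lit 1))) Skip)))"

lemma Find_k_frame [simp]: "mods (Find_k D) = {rSmall, rTmp, rLoop}" "nostore (Find_k D)"
  by (auto simp: Find_k_def)

lemma tc_Find_k:
  assumes W: "2 \<le> W" and regs: "reg s 0 = n" "reg s rLg = lg" and n: "1 \<le> n"
    and D: "1 \<le> D" "1 \<le> lg" and bnd: "2 * D < 2 ^ W" "2 * D * lg < 2 ^ W" "n + 2 < 2 ^ W"
  shows "tc W (Find_k D) s (n * 4 + 4) (\<lambda>s'. 1 \<le> reg s' rSmall \<and> reg s' rSmall \<le> n \<and>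
    (reg s' rSmall = 1 \<or> 2 * D * lg * (reg s' rSmall * reg s' rSmall) \<le> n) \<and>
    n < 2 * D * lg * ((reg s' rSmall + 1) * (reg s' rSmall + 1)))" (is "tc W _ s _ ?Q")
proof -
  let ?g = "Sub (Add (Reg 0) (Lit 1)) (Mul (Reg rTmp) (Mul (Add (Reg rSmall) (Lit 1)) (Add (Reg rSmall) (Lit 1))))"
  let ?P = "Cond ?g (Assign rSmall (Add (Reg rSmall) (Lit 1))) Skip"
  let ?c = "2 * D * lg"
  let ?s0 = "upd (upd s rSmall 1) rTmp ?c"
  have c: "1 \<le> ?c" using D by (simp add: Suc_le_eq)
  have small: "x \<le> n" if "x = 1 \<or> ?c * (x * x) \<le> n" for x
  proof (cases "x = 1")
    case False
    have "x \<le> x * x" by (cases x) auto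
    also have "\<dots> \<le> ?c * (x * x)" using mult_le_mono1[OF c, of "x * x"] by (simp only: mult_1_left)
    finally show ?thesis using that False by linarith
  qed (use n in simp)
  \<comment> \<open>Either the search has stopped at the maximal value, or it has advanced in every
    round; n advances would lead to n + 1, which \<open>small\<close> excludes.\<close>
  let ?Inv = "\<lambda>i s'. 1 \<le> reg s' rSmall \<and> (reg s' rSmall = 1 \<or> ?c * (reg s' rSmall * reg s' rSmall) \<le> n) \<and>
        (n < ?c * ((reg s' rSmall + 1) * (reg s' rSmall + 1)) \<or> reg s' rSmall = i + 1)"
  have "tc W (Find_k D) s (1 + (1 + (n * ((1 + 1) + 2) + 2))) ?Q"
    unfolding Find_k_def
  proof (rule tc_Assign_Seq[where v = 1], rule tc_Assign_Seq[where v = ?c])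
    show "tc W (For rLoop 0 ?P) ?s0 (n * ((1 + 1) + 2) + 2) ?Q"
    proof (rule tc_For_eq[where Inv = ?Inv])
      fix i and s1 :: state
      assume i: "i < n" and I: "?Inv i s1" and k1: "keeps (For rLoop 0 ?P) ?s0 s1"
      have r1: "reg s1 0 = n" "reg s1 rTmp = ?c" using keeps_reg[OF k1] regs by simp_all
      let ?x = "reg s1 rSmall"
      have x: "?x \<le> n" using I small by blast
      show "tc W ?P s1 (1 + 1) (\<lambda>s'. ?Inv (Suc i) (upd s' rLoop (Suc i)))"
      proof (rule tc_Cond)
        assume "val ?g s1 \<noteq> 0"
        then have g: "?c * ((?x + 1) * (?x + 1)) \<le> n" using r1 by simp
        then have xi: "?x = i + 1" using I by linarith
        let ?s2 = "upd s1 rSmall (?x + 1)"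
        have "?Inv (Suc i) (upd ?s2 rLoop (Suc i))" using g xi by simp
        then show "tc W (Assign rSmall (Add (Reg rSmall) (Lit 1))) s1 1 (\<lambda>s'. ?Inv (Suc i) (upd s' rLoop (Suc i)))"
          using W x bnd by (intro tc_Assign) (auto simp: ok_def)
      next
        assume "val ?g s1 = 0"
        then have g: "n < ?c * ((?x + 1) * (?x + 1))" using r1 by simp
        have "?Inv (Suc i) (upd s1 rLoop (Suc i))" using g I by simp
        then show "tc W Skip s1 1 (\<lambda>s'. ?Inv (Suc i) (upd s' rLoop (Suc i)))"
          using W by (intro tc_Skip) auto
      qed (use W in \<open>auto simp: ok_def\<close>)
    next
      fix s1 :: state assume I: "?Inv n s1"
      then have "reg s1 rSmall \<le> n" using small by blast
      then show "?Q s1" using I by auto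
    qed (use W regs in auto)
  qed (use W regs bnd in \<open>auto simp: ok_def\<close>)
  then show ?thesis by (rule tc_le) simp
qed

subsection \<open>The main program\<close>

text \<open>The interval from m to 2m, right end excluded, contains only one power of two; so the
  exponent found by the program is the \<open>lg\<close> of the analysis.\<close>

lemma log_unique:
  assumes "m \<le> 2 ^ i" "2 ^ i < 2 * m" "m \<le> 2 ^ j" "2 ^ j < 2 * (m::nat)"
  shows "i = j"
proof -
  have "\<not> x < y" if "m \<le> 2 ^ x" "2 ^ y < 2 * m" for x y
  proof
    assume "x < y"
    then have "(2::nat) ^ Suc x \<le> 2 ^ y" by (intro power_increasing) auto
    then show False using that by simp
  qed
  then show ?thesis using assms by (meson linorder_neqE_nat)
qed

text \<open>\<open>k_small\<close> bounds the table, with k = 1 as the fallback for small n, and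
  \<open>k_large\<close> makes k maximal, hence of order sqrt(n / log n). Together with
  \<open>p_less\<close> they determine p and k, by which the values that the program finds are
  identified.\<close>

locale small_params = params +
  fixes k :: nat
  assumes p_less: "p < 2 * (n + 2)"
    and k: "1 \<le> k" "k \<le> n"
    and k_small: "k = 1 \<or> 2 * (d + 8) * lg * (k * k) \<le> n"
    and k_large: "n < 2 * (d + 8) * lg * ((k + 1) * (k + 1))"
begin

lemma k_unique:
  assumes "1 \<le> k'" "k' = 1 \<or> 2 * (d + 8) * lg * (k' * k') \<le> n" "n < 2 * (d + 8) * lg * ((k' + 1) * (k' + 1))"
  shows "k' = k"
proof -
  have *: "\<not> x < y" if "1 \<le> x" "n < 2 * (d + 8) * lg * ((x + 1) * (x + 1))"
      "y = 1 \<or> 2 * (d + 8) * lg * (y * y) \<le> n" for x y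
  proof
    assume "x < y"
    then have "2 * (d + 8) * lg * ((x + 1) * (x + 1)) \<le> 2 * (d + 8) * lg * (y * y)"
      by (intro mult_le_mono2 mult_le_mono) auto
    moreover have "y \<noteq> 1" using that(1) \<open>x < y\<close> by simp
    ultimately show False using that by linarith
  qed
  have "\<not> k' < k" by (rule *[OF assms(1,3) k_small])
  moreover have "\<not> k < k'" by (rule *[OF k(1) k_large assms(2)])
  ultimately show ?thesis by simp
qed

lemma lg_pos: "1 \<le> lg"
  using np n p by (cases lg) auto

end

text \<open>Memory layout: the input in the first n^2 cells, the matrix of the table phase in the
  next n^2, then n^2 + n^3 cells of scratch space, then the table. As k <= n, both phases fit into
  the same scratch space. The last two assignments prepare the table phase.\<close>

definition Setup :: "nat \<Rightarrow> prog" where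
  "Setup d = Seq Find_p (Seq (Find_k (d + 8))
    (Seq (Assign rEx (Lit (d + 8))) (Seq (Pow_to rMod rP rEx)
    (Seq (Assign rEx (Lit (d + 3))) (Seq (Pow_to rTmp rP rEx)
    (Seq (Assign rTwo (Lit 2)) (Seq (Pow_to rB rTwo rTmp)
    (Seq (Assign rKk (Mul (Reg rSmall) (Reg rSmall))) (Seq (Pow_to rSz rMod rKk)
    (Seq (Assign rA (Mul (Reg 0) (Reg 0)))
    (Seq (Assign rQ (Add (Reg rA) (Reg rA)))
    (Seq (Assign rTab (Add (Reg rQ) (Add (Reg rA) (Mul (Reg 0) (Reg rA)))))
    (Seq (Assign rN (Reg rSmall)) (Assign rK (Lit 1)))))))))))))))"

lemma Setup_frame [simp]: "0 \<notin> mods (Setup d)" "nostore (Setup d)"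
  by (auto simp: Setup_def)

context small_params
begin

definition "setup_steps = n * 9 + (d + 8) * 3 + (d + 3) * 3 + p ^ (d + 3) * 3 + k * k * 3 + 40"

lemma tc_Setup:
  assumes n0: "reg s 0 = n"
  shows "tc W (Setup d) s setup_steps (\<lambda>s'. reg s' rN = k \<and> reg s' rK = 1 \<and> reg s' rA = n * n \<and>
    reg s' rQ = n * n + n * n \<and> reg s' rB = B \<and> reg s' rMod = N \<and> reg s' rKk = k * k \<and> reg s' rSz = N ^ (k * k) \<and>
    reg s' rTab = n * n + n * n + (n * n + n * (n * n)) \<and> reg s' rSmall = k)" (is "tc W _ s _ ?Q")
proof -
  note W = W_ge
  have W1: "1 \<le> W" using W by simp
  have two_n: "2 * (n + 2) \<le> 2 ^ W"
  proof -
    have "2 * p ^ 1 \<le> p ^ Suc 1" using four_power_step[of 1] by linarith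
    also have "\<dots> \<le> N" unfolding N_def by (rule p_power_mono) simp
    finally have "2 * p \<le> N" by simp
    then have "2 * (n + 2) \<le> N" using np by simp
    then show ?thesis using less_two_power_W[of "2 * (n + 2)"] by simp
  qed
  have kk: "k * k \<le> N" by (rule square_le_N[OF k(2)])
  have addr: "n * n + n * n + (n * n + n * (n * n)) < 2 ^ W" by (rule less_two_power_W[OF addr_le_N])
  have N1: "1 \<le> N" using p_power_pos[of "d + 8"] by (simp add: N_def)
  let ?T4 = "Seq (Assign rA (Mul (Reg 0) (Reg 0)))
    (Seq (Assign rQ (Add (Reg rA) (Reg rA)))
    (Seq (Assign rTab (Add (Reg rQ) (Add (Reg rA) (Mul (Reg 0) (Reg rA)))))
    (Seq (Assign rN (Reg rSmall)) (Assign rK (Lit 1)))))"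
  let ?T3 = "Seq (Assign rKk (Mul (Reg rSmall) (Reg rSmall))) (Seq (Pow_to rSz rMod rKk) ?T4)"
  let ?T2 = "Seq (Assign rTwo (Lit 2)) (Seq (Pow_to rB rTwo rTmp) ?T3)"
  let ?T1 = "Seq (Assign rEx (Lit (d + 3))) (Seq (Pow_to rTmp rP rEx) ?T2)"
  let ?T0 = "Seq (Assign rEx (Lit (d + 8))) (Seq (Pow_to rMod rP rEx) ?T1)"
  let ?j4 = "1 + (1 + (1 + (1 + 1)))"
  let ?j3 = "1 + ((k * k * 3 + 3) + ?j4)"
  let ?j2 = "1 + ((p ^ (d + 3) * 3 + 3) + ?j3)"
  let ?j1 = "1 + (((d + 3) * 3 + 3) + ?j2)"
  let ?j0 = "1 + (((d + 8) * 3 + 3) + ?j1)"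
  have "tc W (Setup d) s ((n * 5 + 15) + ((n * 4 + 4) + ?j0)) ?Q"
    unfolding Setup_def
  proof (rule tc_SeqI, rule tc_Find_p[OF W n0 two_n])
    fix s1 assume k1: "keeps Find_p s s1" and "\<exists>lg. reg s1 rP = 2 ^ lg \<and> reg s1 rLg = lg \<and> n + 2 \<le> 2 ^ lg \<and> 2 ^ lg < 2 * (n + 2)"
    then obtain lg' where l: "reg s1 rP = 2 ^ lg'" "reg s1 rLg = lg'" "n + 2 \<le> 2 ^ lg'" "2 ^ lg' < 2 * (n + 2)" by blast
    have "lg' = lg" using log_unique[OF l(3,4), of lg] np p p_less by simp
    then have r1: "reg s1 rP = p" "reg s1 rLg = lg" "reg s1 0 = n"
      using l p keeps_reg[OF k1, of 0] n0 by simp_all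
    show "tc W (Seq (Find_k (d + 8)) ?T0) s1 ((n * 4 + 4) + ?j0) ?Q"
    proof (rule tc_SeqI, rule tc_Find_k[OF W r1(3,2) n _ lg_pos])
      fix s2 assume k2: "keeps (Find_k (d + 8)) s1 s2" and q2: "1 \<le> reg s2 rSmall \<and> reg s2 rSmall \<le> n \<and>
        (reg s2 rSmall = 1 \<or> 2 * (d + 8) * lg * (reg s2 rSmall * reg s2 rSmall) \<le> n) \<and>
        n < 2 * (d + 8) * lg * ((reg s2 rSmall + 1) * (reg s2 rSmall + 1))"
      have r2: "reg s2 rP = p" "reg s2 0 = n" "reg s2 rSmall = k"
        using r1 keeps_reg[OF k2] q2 k_unique[of "reg s2 rSmall"] by simp_all
      show "tc W ?T0 s2 ?j0 ?Q"
      proof (rule tc_Assign_Seq[where v = "d + 8"], rule tc_SeqI)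
        let ?u = "upd s2 rEx (d + 8)"
        show "tc W (Pow_to rMod rP rEx) ?u ((d + 8) * 3 + 3) (\<lambda>s'. reg s' rMod = N)"
          using tc_Pow_to[of W rMod rP rEx ?u "\<lambda>s'. reg s' rMod = N"] W1 r2 p4 less_two_power_W[OF order_refl]
          by (simp add: N_def)
      next
        fix s3 assume k3: "keeps (Pow_to rMod rP rEx) (upd s2 rEx (d + 8)) s3" and n3: "reg s3 rMod = N"
        have r3: "reg s3 rP = p" "reg s3 0 = n" "reg s3 rSmall = k"
          using r2 keeps_reg[OF k3] by simp_all
        show "tc W ?T1 s3 ?j1 ?Q"
        proof (rule tc_Assign_Seq[where v = "d + 3"], rule tc_SeqI)
          let ?u = "upd s3 rEx (d + 3)"
          show "tc W (Pow_to rTmp rP rEx) ?u ((d + 3) * 3 + 3) (\<lambda>s'. reg s' rTmp = p ^ (d + 3))"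
            using tc_Pow_to[of W rTmp rP rEx ?u "\<lambda>s'. reg s' rTmp = p ^ (d + 3)"] W1 r3 p4
              less_two_power_W[OF small_le_N(5)] by simp
        next
          fix s4 assume k4: "keeps (Pow_to rTmp rP rEx) (upd s3 rEx (d + 3)) s4" and t4: "reg s4 rTmp = p ^ (d + 3)"
          have r4: "reg s4 0 = n" "reg s4 rSmall = k" "reg s4 rMod = N"
            using r3 n3 keeps_reg[OF k4] by simp_all
          show "tc W ?T2 s4 ?j2 ?Q"
          proof (rule tc_Assign_Seq[where v = 2], rule tc_SeqI)
            let ?u = "upd s4 rTwo 2"
            have BW: "2 ^ (p ^ (d + 3)) < (2::nat) ^ W" by (rule two_power_less_W[OF small_le_N(5)])
            show "tc W (Pow_to rB rTwo rTmp) ?u (p ^ (d + 3) * 3 + 3) (\<lambda>s'. reg s' rB = B)"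
              using tc_Pow_to[of W rB rTwo rTmp ?u "\<lambda>s'. reg s' rB = B"] W1 t4 BW by (simp add: B_def)
          next
            fix s5 assume k5: "keeps (Pow_to rB rTwo rTmp) (upd s4 rTwo 2) s5" and b5: "reg s5 rB = B"
            have r5: "reg s5 0 = n" "reg s5 rSmall = k" "reg s5 rMod = N"
              using r4 keeps_reg[OF k5] by simp_all
            show "tc W ?T3 s5 ?j3 ?Q"
            proof (rule tc_Assign_Seq[where v = "k * k"], rule tc_SeqI)
              let ?u = "upd s5 rKk (k * k)"
              show "tc W (Pow_to rSz rMod rKk) ?u (k * k * 3 + 3) (\<lambda>s'. reg s' rSz = N ^ (k * k))"
                using tc_Pow_to[of W rSz rMod rKk ?u "\<lambda>s'. reg s' rSz = N ^ (k * k)"] W1 r5 N1 N_power_less[OF k(2)]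
                by simp
            next
              fix s6 assume bd6: "bd W s6" and k6: "keeps (Pow_to rSz rMod rKk) (upd s5 rKk (k * k)) s6"
                and z6: "reg s6 rSz = N ^ (k * k)"
              have r6: "reg s6 0 = n" "reg s6 rSmall = k" "reg s6 rMod = N" "reg s6 rKk = k * k" "reg s6 rB = B"
                using r5 b5 keeps_reg[OF k6] by simp_all
              have kW: "k < 2 ^ W" using bd_reg[OF bd6, of rSmall] r6 by simp
              show "tc W ?T4 s6 ?j4 ?Q"
              proof (rule tc_Assign_Seq[where v = "n * n"], rule tc_Assign_Seq[where v = "n * n + n * n"],
                  rule tc_Assign_Seq[where v = "n * n + n * n + (n * n + n * (n * n))"], rule tc_Assign_Seq[where v = k],
                  rule tc_Assign)
                show "n * n < 2 ^ W" "n * n + n * n < 2 ^ W" "n * n + n * n + (n * n + n * (n * n)) < 2 ^ W"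
                  using addr by linarith+
              qed (use W kW r6 z6 in \<open>auto simp: ok_def\<close>)
            qed (use W r5 less_two_power_W[OF kk] in \<open>auto simp: ok_def\<close>)
          qed (use W in \<open>auto simp: ok_def\<close>)
        qed (use W less_two_power_W[OF small_le_N(3)] in \<open>auto simp: ok_def\<close>)
      qed (use W less_two_power_W[OF small_le_N(2)] in \<open>auto simp: ok_def\<close>)
    next
      show "2 * (d + 8) < 2 ^ W" by (rule less_two_power_W[OF small_le_N(1)])
      show "2 * (d + 8) * lg < 2 ^ W" by (rule less_two_power_W[OF small_le_N(4)])
      show "n + 2 < 2 ^ W" by (rule less_le_trans[OF _ two_n]) simp
    qed simp
  qed
  then show ?thesis by (rule tc_le) (simp add: setup_steps_def)
qed

end

text \<open>For n = 0 register 0 already holds the answer 0, as no permutation of the empty set is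
  cyclic. Otherwise the size is switched from k to n between the two phases.\<close>

definition Main :: "nat \<Rightarrow> prog" where
  "Main d = Cond (Reg 0) (Seq (Setup d) (Seq Table
    (Seq (Assign rN (Reg 0)) (Seq (Assign rK (Reg rSmall)) (Seq (Assign rA (Lit 0))
    (Seq (Ham Crt) (Assign 0 (Reg rPos)))))))) Skip"

context small_params
begin

definition "main_steps = 1 + (setup_steps + ((N ^ (k * k) * (k * k * 5 + ham_steps k 1 1 + 7) + 2) +
  (1 + (1 + (1 + (ham_steps n k (N * (k * k * 4 + N * 8 + 14) + 4) + 1))))))"

lemma tc_Main:
  assumes n0: "reg s 0 = n" and A: "\<And>u v. u < n \<Longrightarrow> v < n \<Longrightarrow> mem s (u * n + v) = A u v"
    and Aa: "\<And>u v. u < n \<Longrightarrow> v < n \<Longrightarrow> A u v \<le> a"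
  shows "tc W (Main d) s main_steps (\<lambda>s'. reg s' 0 = hc A n)"
proof -
  note W = W_ge
  let ?Q = "\<lambda>s'. reg s' 0 = hc A n"
  let ?bT = "n * n + n * n + (n * n + n * (n * n))" and ?bQ = "n * n + n * n"
  let ?jF = "N * (k * k * 4 + N * 8 + 14) + 4"
  let ?T = "Seq (Assign rN (Reg 0)) (Seq (Assign rK (Reg rSmall)) (Seq (Assign rA (Lit 0))
    (Seq (Ham Crt) (Assign 0 (Reg rPos)))))"
  let ?tab = "\<lambda>s'. \<forall>x<N ^ (k * k). mem s' (?bT + x) = hc (\<lambda>u v. x div N ^ (u * k + v) mod N) k"
  have N1: "1 \<le> N" using p_power_pos[of "d + 8"] by (simp add: N_def)
  have kn: "k * k \<le> n * n" "k * (k * k) \<le> n * (n * n)" using k(2) by (auto intro!: mult_le_mono)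
  have "tc W (Seq (Setup d) (Seq Table ?T)) s (setup_steps + ((N ^ (k * k) * (k * k * 5 + ham_steps k 1 1 + 7) + 2) +
    (1 + (1 + (1 + (ham_steps n k ?jF + 1)))))) ?Q"
  proof (rule tc_SeqI, rule tc_Setup[OF n0])
    fix s1 assume k1: "keeps (Setup d) s s1" and q1: "reg s1 rN = k \<and> reg s1 rK = 1 \<and> reg s1 rA = n * n \<and>
    reg s1 rQ = ?bQ \<and> reg s1 rB = B \<and> reg s1 rMod = N \<and> reg s1 rKk = k * k \<and> reg s1 rSz = N ^ (k * k) \<and>
    reg s1 rTab = ?bT \<and> reg s1 rSmall = k"
    have m1: "mem s1 = mem s" using keeps_mem[OF k1] by simp
    have n1: "reg s1 0 = n" using keeps_reg[OF k1, of 0] n0 by simp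
    show "tc W (Seq Table ?T) s1 ((N ^ (k * k) * (k * k * 5 + ham_steps k 1 1 + 7) + 2) +
      (1 + (1 + (1 + (ham_steps n k ?jF + 1))))) ?Q"
    proof (rule tc_SeqI)
      show "tc W Table s1 (N ^ (k * k) * (k * k * 5 + ham_steps k 1 1 + 7) + 2) (\<lambda>s'. ?tab s' \<and>
        (\<forall>x<n * n. mem s' x = mem s1 x))"
        by (rule tc_Table[where a = a and B = B and bQ = "?bQ"])
          (use W q1 k N1 N_le_a kn B_large[OF k(2)] entry_less[OF k(2)] B_power_less[OF k(2)]
            power_B_less[OF k(2)] less_two_power_W[OF cube_le_N[OF k(2)]] in auto)
    next
      fix s2 assume b2: "bd W s2" and k2: "keeps Table s1 s2" and q2: "?tab s2 \<and> (\<forall>x<n * n. mem s2 x = mem s1 x)"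
      have g2: "reg s2 r = reg s1 r" if "r \<notin> {7..34} \<union> {40, 42, 43}" for r
        using keeps_reg[OF k2] mods_Table that by blast
      have r2: "reg s2 0 = n" "reg s2 rSmall = k" "reg s2 rQ = ?bQ" "reg s2 rB = B" "reg s2 rMod = N"
        "reg s2 rKk = k * k" "reg s2 rTab = ?bT"
        using q1 n1 by (simp_all add: g2)
      let ?s3 = "upd (upd (upd s2 rN n) rK k) rA 0"
      show "tc W ?T s2 (1 + (1 + (1 + (ham_steps n k ?jF + 1)))) ?Q"
      proof (rule tc_Assign_Seq[where v = n], rule tc_Assign_Seq[where v = k], rule tc_Assign_Seq[where v = 0],
          rule tc_SeqI)
        show "tc W (Ham Crt) ?s3 (ham_steps n k ?jF) (\<lambda>s'. reg s' rPos = hc A n \<and>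
          (\<forall>x. x < ?bQ \<or> ?bQ + (n * n + n * (n * n)) \<le> x \<longrightarrow> mem s' x = mem ?s3 x))"
          unfolding ham_steps_def
        proof (rule tc_Ham[where A = A and a = a and B = B and bA = 0, OF W])
          fix u v assume uv: "u < n" "v < n"
          show "mem ?s3 (0 + (u * n + v)) = A u v"
            using q2 m1 A[OF uv] two_dim_index(3)[OF uv] by simp
        next
          fix c and s' :: state
          assume c: "c < 2 ^ (n - k)" and g: "\<And>r. r \<notin> {7..34} \<Longrightarrow> reg s' r = reg ?s3 r"
            and cu: "reg s' rCu = n * (n * n)"
            and out: "\<And>x. x < ?bQ \<or> ?bQ + (n * n + n * (n * n)) \<le> x \<Longrightarrow> mem s' x = mem ?s3 x"
            and q: "\<And>u v. u < n \<Longrightarrow> v < n \<Longrightarrow> mem s' (?bQ + (n * (n * n) + (u * n + v))) = kq B A (dec k c) n u v"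
          have sub: "dec k c \<subseteq> {..<n}" using dec_subset[OF k(2) c] by auto
          show "tc W Crt s' ?jF (\<lambda>s''. reg s'' rY = hc (kq B A (dec k c) n) k)"
          proof (rule tc_Crt[OF W _ _ _ cu])
            show "hc (kq B A (dec k c) n) k < lcm_upto N"
            proof (rule hc_less_lcm_upto[OF k])
              fix u v assume uv: "u < k" "v < k"
              have "kq B A (dec k c) n u v + 1 \<le> (B * a * n + 1) ^ n"
                by (rule kq_le[OF Aa sub]) (use uv k(2) in auto)
              also have "\<dots> \<le> 2 ^ (p ^ (d + 5))" by (rule entry_bound) simp
              finally show "kq B A (dec k c) n u v \<le> 2 ^ (p ^ (d + 5))" by simp
            qed
            show "mem s' (?bT + x) = hc (\<lambda>u v. x div N ^ (u * k + v) mod N) k" if "x < N ^ (k * k)" for x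
              using q2 that by (subst out) auto
          qed (use g r2 q k N_power_less[OF k(2)] lcm_upto_less in auto)
        qed (use r2 k Aa B_large[of n] entry_less[of n] B_power_less[of n]
            power_B_less[of n] less_two_power_W[OF cube_le_N[of n]] in auto)
      next
        fix s4 assume b4: "bd W s4" and q4: "reg s4 rPos = hc A n \<and>
          (\<forall>x. x < ?bQ \<or> ?bQ + (n * n + n * (n * n)) \<le> x \<longrightarrow> mem s4 x = mem ?s3 x)"
        have "hc A n < 2 ^ W" using q4 bd_reg[OF b4] by metis
        then show "tc W (Assign 0 (Reg rPos)) s4 1 ?Q"
          using W q4 by (intro tc_Assign) (auto simp: ok_def)
      next
        show "n < 2 ^ W" "k < 2 ^ W" using r2 bd_reg[OF b2, of 0] bd_reg[OF b2, of rSmall] by simp_all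
      qed (use W r2 in \<open>auto simp: ok_def\<close>)
    qed
  qed
  then show ?thesis unfolding Main_def main_steps_def
    by (intro tc_Cond) (use W n n0 in \<open>auto simp: ok_def\<close>)
qed

subsection \<open>Running time\<close>

lemma N_large: "1000 \<le> N"
proof -
  have "(1000::nat) \<le> 4 ^ 8" by simp
  also have "\<dots> \<le> p ^ 8" using p4 by (intro power_mono) auto
  also have "\<dots> \<le> N" unfolding N_def by (rule p_power_mono) simp
  finally show ?thesis .
qed

text \<open>Since N >= 1000, constants and lower terms are absorbed by further powers of N, all of
  them polynomial in n.\<close>

lemma ham_steps_le:
  assumes "\<nu> \<le> n" "j \<le> N ^ 3"
  shows "ham_steps \<nu> i j \<le> 2 ^ (\<nu> - i) * N ^ 5"
proof -
  note NL = N_large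
  have N4: "16 * N ^ 3 \<le> N ^ 4" "16 * N ^ 4 \<le> N ^ 5" using NL by (simp_all add: power_eq_if)
  have N3: "N ^ 2 \<le> N ^ 3" "N \<le> N ^ 3" "1 \<le> N ^ 3" using NL by (simp_all add: power_eq_if)
  have \<nu>N: "\<nu> \<le> p" using assms np by simp
  have "p * 16 \<le> N"
  proof -
    have "p * 16 \<le> p ^ 1 * p ^ 2" using p4 mult_le_mono[of 4 p 4 p] by (simp add: power2_eq_square)
    also have "\<dots> = p ^ 3" by (simp add: power_eq_if)
    also have "\<dots> \<le> N" unfolding N_def by (rule p_power_mono) simp
    finally show ?thesis .
  qed
  then have small: "\<nu> * 5 + 10 \<le> N" "\<nu> * 5 + 11 \<le> N" "\<nu> * 6 + 17 \<le> 2 * N" using \<nu>N p4 NL by linarith+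
  have sq: "\<nu> * \<nu> * 4 \<le> 4 * N" using square_le_N[OF assms(1)] by simp
  have "\<nu> * (\<nu> * \<nu>) * (\<nu> * 5 + 10) \<le> N * N"
    by (intro mult_le_mono cube_le_N assms small)
  also have "\<dots> \<le> N ^ 3" using N3 by (simp add: power2_eq_square)
  finally have "\<nu> * (\<nu> * \<nu>) * (\<nu> * 5 + 10) + \<nu> * 5 + j + 11 \<le> 3 * N ^ 3"
    using small(2) assms(2) N3 by linarith
  then have "2 ^ (\<nu> - i) * (\<nu> * (\<nu> * \<nu>) * (\<nu> * 5 + 10) + \<nu> * 5 + j + 11) \<le> 2 ^ (\<nu> - i) * (3 * N ^ 3)"
    by (rule mult_le_mono2)
  moreover have "\<nu> * \<nu> * 4 + \<nu> * 6 + 17 \<le> 2 ^ (\<nu> - i) * (6 * N ^ 3)"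
  proof -
    have "\<nu> * \<nu> * 4 + \<nu> * 6 + 17 \<le> 1 * (6 * N ^ 3)" using sq small N3 by linarith
    also have "\<dots> \<le> 2 ^ (\<nu> - i) * (6 * N ^ 3)" by (intro mult_le_mono1) simp
    finally show ?thesis .
  qed
  ultimately have "ham_steps \<nu> i j \<le> 2 ^ (\<nu> - i) * (9 * N ^ 3)"
    unfolding ham_steps_def by linarith
  also have "\<dots> \<le> 2 ^ (\<nu> - i) * N ^ 5" using N4 by (intro mult_le_mono2) linarith
  finally show ?thesis .
qed

text \<open>The first summand is the table, N^(k^2) entries with at most 2^k subsets each; the
  second is the main computation over 2^(n-k) subsets.\<close>

lemma main_steps_le: "main_steps \<le> N ^ 8 * (N ^ (k * k) * 2 ^ k + 2 ^ (n - k))"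
proof -
  note NL = N_large
  let ?X = "N ^ (k * k) * 2 ^ k" and ?Y = "2 ^ (n - k) :: nat"
  have X1: "1 \<le> ?X" using NL by simp
  have pw: "16 * N ^ i \<le> N ^ Suc i" "1 \<le> N ^ i" for i using NL by simp_all
  note pws = pw(1)[of 2] pw(1)[of 3] pw(1)[of 4] pw(1)[of 5] pw(1)[of 6] pw(1)[of 7]
  have kk: "k * k \<le> N" by (rule square_le_N[OF k(2)])
  have "setup_steps \<le> N ^ 3"
  proof -
    have "n \<le> N" using np p_le_N by linarith
    then have "setup_steps \<le> 9 * N + N * 3 + N * 3 + N * 3 + N * 3 + N"
      unfolding setup_steps_def using small_le_N(2,3,5) kk NL by (simp add: algebra_simps)
    also have "\<dots> \<le> N * N" using mult_le_mono1[of 1000 N N] NL by linarith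
    also have "\<dots> \<le> N ^ 3" using NL by (simp add: power3_eq_cube)
    finally show ?thesis .
  qed
  moreover have "ham_steps k 1 1 \<le> 2 ^ k * N ^ 5"
  proof -
    have "ham_steps k 1 1 \<le> 2 ^ (k - 1) * N ^ 5" by (rule ham_steps_le[OF k(2)]) (use NL in simp)
    also have "\<dots> \<le> 2 ^ k * N ^ 5" by (intro mult_le_mono1 power_increasing) auto
    finally show ?thesis .
  qed
  moreover have "ham_steps n k (N * (k * k * 4 + N * 8 + 14) + 4) \<le> ?Y * N ^ 5"
  proof (rule ham_steps_le)
    have "k * k * 4 + N * 8 + 14 \<le> 13 * N" using kk NL by linarith
    then have "N * (k * k * 4 + N * 8 + 14) \<le> N * (13 * N)" by (rule mult_le_mono2)
    also have "N * (13 * N) = 13 * N ^ 2" by (simp add: power2_eq_square)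
    finally have "N * (k * k * 4 + N * 8 + 14) \<le> 13 * N ^ 2" .
    moreover have "4 \<le> N ^ 2" using NL mult_le_mono[of 2 N 2 N] by (simp add: power2_eq_square)
    ultimately have "N * (k * k * 4 + N * 8 + 14) + 4 \<le> 14 * N ^ 2" by linarith
    also have "\<dots> \<le> N ^ 3" using pws(1) by (simp add: numeral_3_eq_3)
    finally show "N * (k * k * 4 + N * 8 + 14) + 4 \<le> N ^ 3" .
  qed simp
  moreover have "N ^ (k * k) * (k * k * 5 + ham_steps k 1 1 + 7) \<le> ?X * N ^ 6"
  proof -
    have "k * k * 5 + ham_steps k 1 1 + 7 \<le> 2 ^ k * N ^ 6"
    proof -
      have "k * k * 5 + 7 \<le> 6 * N" using kk NL by linarith
      also have "\<dots> \<le> 6 * N ^ 5" using NL by (simp add: power_eq_if)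
      also have "\<dots> \<le> 2 ^ k * (6 * N ^ 5)" by simp
      finally have "k * k * 5 + ham_steps k 1 1 + 7 \<le> 2 ^ k * (6 * N ^ 5) + 2 ^ k * N ^ 5"
        using \<open>ham_steps k 1 1 \<le> 2 ^ k * N ^ 5\<close> by linarith
      also have "\<dots> = 2 ^ k * (7 * N ^ 5)" by simp
      also have "\<dots> \<le> 2 ^ k * N ^ 6" using pws(4) by (intro mult_le_mono2) (simp add: eval_nat_numeral)
      finally show ?thesis .
    qed
    then have "N ^ (k * k) * (k * k * 5 + ham_steps k 1 1 + 7) \<le> N ^ (k * k) * (2 ^ k * N ^ 6)" by (rule mult_le_mono2)
    then show ?thesis by (simp add: mult.assoc)
  qed
  ultimately have "main_steps \<le> N ^ 3 + ?X * N ^ 6 + ?Y * N ^ 5 + 7"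
    unfolding main_steps_def by linarith
  also have "\<dots> \<le> ?X * N ^ 8 + ?Y * N ^ 8"
  proof -
    have "N ^ 5 \<le> N ^ 8" "N ^ 3 \<le> N ^ 6" using NL by (auto intro!: power_increasing)
    then have "?Y * N ^ 5 \<le> ?Y * N ^ 8" "N ^ 3 \<le> ?X * N ^ 6" "7 \<le> ?X * N ^ 6"
    proof -
      show "?Y * N ^ 5 \<le> ?Y * N ^ 8" if "N ^ 5 \<le> N ^ 8" using that by (rule mult_le_mono2)
      have "1 * N ^ 6 \<le> ?X * N ^ 6" using X1 by (rule mult_le_mono1)
      then show "N ^ 3 \<le> ?X * N ^ 6" if "N ^ 3 \<le> N ^ 6" using that by linarith
      have "7 \<le> N ^ 1" using NL by simp
      also have "\<dots> \<le> N ^ 6" using NL by (intro power_increasing) auto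
      finally show "7 \<le> ?X * N ^ 6" using \<open>1 * N ^ 6 \<le> ?X * N ^ 6\<close> by linarith
    qed
    moreover have "3 * (?X * N ^ 6) \<le> ?X * N ^ 8"
    proof -
      have "3 * N ^ 6 \<le> N ^ 6 * N ^ 2" using NL mult_le_mono[of 2 N 2 N] by (simp add: power2_eq_square)
      also have "\<dots> = N ^ 8" by (simp flip: power_add)
      finally have "?X * (3 * N ^ 6) \<le> ?X * N ^ 8" by (rule mult_le_mono2)
      then show ?thesis by (simp only: mult.left_commute)
    qed
    ultimately show ?thesis by linarith
  qed
  finally show ?thesis by (simp add: algebra_simps)
qed

text \<open>The exponent 13 is made up of 8 from the number of steps, 3 from the cost of a step, 1
  from the table size and 1 from the remaining factor 4. The table size is at most N * 2^(n/2),
  where the factor N covers k = 1.\<close>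

lemma total_le: "main_steps * ucost W \<le> N ^ 13 * (2 ^ (n div 2 + k) + 2 ^ (n - k))"
proof -
  let ?X = "N ^ (k * k) * 2 ^ k" and ?Y = "2 ^ (n - k) :: nat"
  note NL = N_large
  have "ucost W \<le> N ^ 3 * 4"
    unfolding ucost_def W_def using NL by (simp add: power3_eq_cube)
  then have "ucost W * 1 \<le> N ^ 3 * 4" by simp
  then have U: "main_steps * ucost W \<le> (N ^ 8 * (?X + ?Y)) * (N ^ 3 * 4)"
    using main_steps_le by (intro mult_le_mono) auto
  have "N ^ (k * k) \<le> N * 2 ^ (n div 2)"
  proof (cases "k = 1")
    case False
    then have "(d + 8) * lg * (k * k) \<le> n div 2" using k_small by linarith
    then have "lg * (d + 8) * (k * k) \<le> n div 2" by (simp add: mult.commute)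
    then have "(2::nat) ^ (lg * (d + 8) * (k * k)) \<le> 2 ^ (n div 2)" by (intro power_increasing) auto
    moreover have "N ^ (k * k) = 2 ^ (lg * (d + 8) * (k * k))"
    proof -
      have "(2 ^ lg) ^ (d + 8) = p ^ (d + 8)" using p by simp
      then show ?thesis unfolding N_def power_mult by simp
    qed
    ultimately have "1 * N ^ (k * k) \<le> N * 2 ^ (n div 2)" using NL by (intro mult_le_mono) auto
    then show ?thesis by simp
  qed simp
  then have "?X \<le> N * 2 ^ (n div 2) * 2 ^ k" by (rule mult_le_mono1)
  moreover have "?Y \<le> N * ?Y" using NL by simp
  ultimately have "?X + ?Y \<le> N * 2 ^ (n div 2) * 2 ^ k + N * ?Y" by (rule add_mono)
  also have "\<dots> = N * (2 ^ (n div 2 + k) + ?Y)" by (simp add: algebra_simps power_add)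
  finally have "?X + ?Y \<le> N * (2 ^ (n div 2 + k) + ?Y)" .
  then have "(N ^ 8 * (?X + ?Y)) * (N ^ 3 * 4) \<le> (N ^ 8 * (N * (2 ^ (n div 2 + k) + ?Y))) * (N ^ 3 * 4)"
    by (intro mult_le_mono1 mult_le_mono2)
  also have "\<dots> = (N ^ 12 * 4) * (2 ^ (n div 2 + k) + ?Y)" by (simp add: eval_nat_numeral algebra_simps)
  finally have "main_steps * ucost W \<le> (N ^ 12 * 4) * (2 ^ (n div 2 + k) + ?Y)" using U by linarith
  also have "\<dots> \<le> N ^ 13 * (2 ^ (n div 2 + k) + ?Y)"
  proof (rule mult_le_mono1)
    have "N ^ 12 * 4 \<le> N ^ 12 * N" using NL by (intro mult_le_mono2) simp
    then show "N ^ 12 * 4 \<le> N ^ 13" by (simp flip: power_Suc2)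
  qed
  finally show ?thesis .
qed

end

subsection \<open>Asymptotics\<close>

text \<open>The base n + 2 is at least 2 even for n = 0, so its powers can absorb the coefficients
  of b.\<close>

lemma poly_le_power:
  fixes b :: "real poly"
  shows "\<exists>d\<ge>3. \<forall>n::nat. poly b (real n) \<le> real ((n + 2) ^ d)"
proof -
  define C where "C = (\<Sum>i\<le>degree b. \<bar>coeff b i\<bar>)"
  obtain m :: nat where m: "C < 2 ^ m"
    using real_arch_pow[of 2 C] by auto
  let ?d = "degree b + m + 3"
  have "poly b (real n) \<le> real ((n + 2) ^ ?d)" for n :: nat
  proof -
    have x: "1 \<le> real (n + 2)" by simp
    have "poly b (real n) \<le> (\<Sum>i\<le>degree b. \<bar>coeff b i\<bar> * real (n + 2) ^ degree b)"
      unfolding poly_altdef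
    proof (rule sum_mono)
      fix i assume i: "i \<in> {..degree b}"
      have "coeff b i * real n ^ i \<le> \<bar>coeff b i\<bar> * real n ^ i" by (intro mult_right_mono) auto
      also have "real n ^ i \<le> real (n + 2) ^ i" by (intro power_mono) auto
      also have "real (n + 2) ^ i \<le> real (n + 2) ^ degree b" using i by (intro power_increasing) auto
      finally show "coeff b i * real n ^ i \<le> \<bar>coeff b i\<bar> * real (n + 2) ^ degree b"
        by (simp add: mult_left_mono)
    qed
    also have "\<dots> = C * real (n + 2) ^ degree b" by (simp add: C_def sum_distrib_right)
    also have "\<dots> \<le> real (n + 2) ^ m * real (n + 2) ^ degree b"
    proof (rule mult_right_mono)
      have "(2::real) ^ m \<le> real (n + 2) ^ m" by (intro power_mono) auto
      then show "C \<le> real (n + 2) ^ m" using m by linarith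
    qed simp
    also have "\<dots> = real (n + 2) ^ (degree b + m)" by (simp add: power_add mult.commute)
    also have "\<dots> \<le> real (n + 2) ^ ?d" using x by (intro power_increasing) auto
    finally show ?thesis by simp
  qed
  then show ?thesis by (intro exI[of _ ?d]) auto
qed

lemma small_params_exist:
  assumes n: "1 \<le> n" and d: "3 \<le> d"
  shows "\<exists>lg k. small_params n (2 ^ lg) lg d k"
proof -
  define lg where "lg = (LEAST i. n + 2 \<le> 2 ^ i)"
  have ex: "n + 2 \<le> 2 ^ (n + 2)" using le_two_power[of "n + 2"] by simp
  have lg: "n + 2 \<le> 2 ^ lg" unfolding lg_def by (rule LeastI[of _ "n + 2"]) (rule ex)
  have lg0: "lg \<noteq> 0"
  proof
    assume "lg = 0"
    then show False using lg by simp
  qed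
  then obtain l where l: "lg = Suc l" by (cases lg) auto
  have "\<not> n + 2 \<le> 2 ^ l" using not_less_Least[of l "\<lambda>i. n + 2 \<le> 2 ^ i"] l by (simp add: lg_def)
  then have less: "2 ^ lg < 2 * (n + 2)" unfolding l power_Suc by (intro mult_strict_left_mono) auto
  let ?c = "2 * (d + 8) * lg"
  let ?P = "\<lambda>k. 1 \<le> k \<and> (k = 1 \<or> ?c * (k * k) \<le> n)"
  have c: "1 \<le> ?c" using lg0 by simp
  have small: "k \<le> n" if "?P k" for k
  proof (cases "k = 1")
    case False
    have "k \<le> k * k" by (cases k) auto
    also have "\<dots> \<le> ?c * (k * k)" using mult_le_mono1[OF c, of "k * k"] by (simp only: mult_1_left)
    finally show ?thesis using that False by linarith
  qed (use n in simp)
  define k where "k = Greatest ?P"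
  have P1: "?P 1" by simp
  have k: "?P k" unfolding k_def by (rule GreatestI_nat[of ?P, OF P1 small])
  have "n < ?c * ((k + 1) * (k + 1))"
  proof (rule ccontr)
    assume "\<not> ?thesis"
    then have "?P (k + 1)" by simp
    then have "k + 1 \<le> k" by (rule Greatest_le_nat[of ?P _ n, folded k_def]) (rule small)
    then show False by simp
  qed
  then have "small_params n (2 ^ lg) lg d k"
    using n d lg less k small[OF k] by unfold_locales auto
  then show ?thesis by blast
qed

text \<open>The left side stands for the logarithm of the factor N^13, with a small reserve; growing
  like log n, it is paid for by any constant fraction of the saving.\<close>

lemma eventually_saving:
  fixes C E :: real
  assumes "C > 0" "E > 0"
  shows "\<forall>\<^sub>F n in sequentially. 3 + E * log 2 (2 * real n + 4) \<le> C * sqrt (real n / log 2 (real n))"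
  using assms by real_asymp

text \<open>The table phase has logarithm about n/2 + sqrt n plus that of N^13, which leaves almost
  n/2 to spare.\<close>

lemma eventually_table:
  fixes C E :: real
  assumes "C > 0" "E > 0"
  shows "\<forall>\<^sub>F n in sequentially. 3 + E * log 2 (2 * real n + 4) + sqrt (real n) \<le> real n / 2 - C * sqrt (real n / log 2 (real n))"
  using assms by real_asymp

context small_params
begin

text \<open>\<open>k_large\<close> yields n <= 4 * (d + 8) * log n * (k + 1)^2, that is, k + 1 >= 2
  * c * r. Half of this saving pays for N^13, the other half remains; this fixes c.\<close>

lemma time_le:
  fixes c :: real
  defines "c \<equiv> 1 / (4 * sqrt (real (d + 8)))" and "L \<equiv> log 2 (2 * real n + 4)" and "E \<equiv> 13 * real (d + 8)"
    and "r \<equiv> sqrt (real n / log 2 (real n))"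
  assumes n4: "4 \<le> n" and saving: "3 + E * L \<le> c * r" and table: "3 + E * L + sqrt (real n) \<le> real n / 2 - c * r"
  shows "real (main_steps * ucost W) \<le> 2 powr (real n - c * r)"
proof -
  let ?D = "real (d + 8)"
  have p_le: "real p \<le> 2 powr L"
  proof -
    have "2 powr L = 2 * real n + 4" unfolding L_def by (rule powr_log_cancel) auto
    then show ?thesis using p_less by simp
  qed
  have lg_le: "real lg \<le> L"
  proof -
    have "2 powr real lg \<le> 2 powr L" using p_le p by (simp add: powr_realpow)
    then show ?thesis by simp
  qed
  have log_n: "0 < log 2 (real n)" using n4 by simp
  \<comment> \<open>This doubles the constant under the root: 2 * (d + 8) from
    \<open>k_large\<close> becomes 4 * (d + 8).\<close>
  have L_le: "L \<le> 2 * log 2 (real n)"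
  proof -
    have "4 * n \<le> n * n" using n4 by simp
    then have "2 * n + 4 \<le> n ^ 2" unfolding power2_eq_square using n4 by linarith
    then have "2 * real n + 4 \<le> real n ^ 2" by (metis (mono_tags) of_nat_add of_nat_le_iff of_nat_mult of_nat_numeral of_nat_power)
    then have "L \<le> log 2 (real n ^ 2)" unfolding L_def using n4 by simp
    also have "\<dots> = 2 * log 2 (real n)" using n4 by (simp add: log_nat_power)
    finally show ?thesis .
  qed
  have N13: "real (N ^ 13) \<le> 2 powr (E * L)"
  proof -
    have "real (N ^ 13) = real p ^ ((d + 8) * 13)" unfolding N_def power_mult by simp
    also have "\<dots> \<le> (2 powr L) ^ ((d + 8) * 13)" using p_le by (intro power_mono) auto
    also have "\<dots> = 2 powr (E * L)"
      by (simp add: E_def powr_realpow[symmetric] powr_powr mult.commute)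
    finally show ?thesis .
  qed
  have k_sqrt: "real k \<le> sqrt (real n)"
  proof (rule real_le_rsqrt)
    have "k * k \<le> n"
    proof (cases "k = 1")
      case False
      have "1 \<le> 2 * (d + 8) * lg" using lg_pos by simp
      from mult_le_mono1[OF this, of "k * k"] have "k * k \<le> 2 * (d + 8) * lg * (k * k)" by (simp only: mult_1_left)
      then show ?thesis using k_small False by linarith
    qed (use n in simp)
    then show "(real k)\<^sup>2 \<le> real n" unfolding power2_eq_square by (metis of_nat_le_iff of_nat_mult)
  qed
  have k_large': "2 * c * r \<le> real k + 1"
  proof -
    have "real n \<le> real (2 * (d + 8) * lg * ((k + 1) * (k + 1)))" using k_large by (intro of_nat_mono) simp
    also have "\<dots> = 2 * ?D * (real k + 1)\<^sup>2 * real lg" by (simp add: power2_eq_square algebra_simps)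
    also have "\<dots> \<le> 2 * ?D * (real k + 1)\<^sup>2 * (2 * log 2 (real n))"
      using lg_le L_le by (intro mult_left_mono) auto
    finally have "real n / log 2 (real n) \<le> 4 * ?D * (real k + 1)\<^sup>2"
      using log_n by (simp add: pos_divide_le_eq algebra_simps)
    then have "r \<le> sqrt (4 * ?D * (real k + 1)\<^sup>2)" unfolding r_def by (rule real_sqrt_le_mono)
    also have "\<dots> = 2 * sqrt ?D * (real k + 1)" unfolding real_sqrt_mult real_sqrt_four real_sqrt_abs by simp
    finally show ?thesis unfolding c_def by (simp add: field_simps)
  qed
  have "real (2 ^ (n div 2 + k)) \<le> 2 powr (real n / 2 + sqrt (real n))"
  proof -
    have "real (n div 2 * 2) \<le> real n" by (intro of_nat_mono) simp
    then have "real (n div 2) \<le> real n / 2" by simp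
    moreover have "real (2 ^ (n div 2 + k)) = 2 powr (real (n div 2) + real k)"
      using powr_realpow[of 2 "n div 2 + k"] by simp
    ultimately show ?thesis using k_sqrt by simp
  qed
  then have "real (N ^ 13) * real (2 ^ (n div 2 + k)) \<le> 2 powr (E * L) * 2 powr (real n / 2 + sqrt (real n))"
    using N13 by (intro mult_mono) auto
  also have "\<dots> \<le> 2 powr (real n - c * r - 1)"
    using table by (simp flip: powr_add)
  finally have 1: "real (N ^ 13) * real (2 ^ (n div 2 + k)) \<le> 2 powr (real n - c * r - 1)" .
  have "real (2 ^ (n - k)) = 2 powr (real n - real k)"
    using powr_realpow[of 2 "n - k"] k(2) by (simp add: of_nat_diff)
  then have "real (N ^ 13) * real (2 ^ (n - k)) \<le> 2 powr (E * L) * 2 powr (real n - real k)"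
    using N13 by (intro mult_mono) auto
  also have "\<dots> \<le> 2 powr (real n - c * r - 1)"
    using saving k_large' by (simp flip: powr_add)
  finally have 2: "real (N ^ 13) * real (2 ^ (n - k)) \<le> 2 powr (real n - c * r - 1)" .
  have "real (main_steps * ucost W) \<le> real (N ^ 13 * (2 ^ (n div 2 + k) + 2 ^ (n - k)))"
    using total_le by (rule of_nat_mono)
  also have "\<dots> = real (N ^ 13) * real (2 ^ (n div 2 + k)) + real (N ^ 13) * real (2 ^ (n - k))"
    by (simp only: of_nat_mult of_nat_add distrib_left)
  also have "\<dots> \<le> 2 powr (real n - c * r - 1) + 2 powr (real n - c * r - 1)" using 1 2 by (rule add_mono)
  also have "\<dots> = 2 powr (real n - c * r)" by (simp add: powr_diff)
  finally show ?thesis .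
qed

lemma exec_Main:
  fixes G :: "(nat, 'b) pre_digraph"
  assumes G: "fin_digraph G" "verts G = {1..n}" and arcs: "card (arcs G) \<le> a"
  shows "\<exists>t s. exec (Main d) (input_state n G) t s \<and> result s = num_hamiltonian_cycles G \<and> t \<le> main_steps * ucost W"
proof -
  let ?s = "input_state n G" and ?A = "\<lambda>u v. multiplicity_of G (u + 1) (v + 1)"
  interpret fin_digraph G by fact
  have m: "multiplicity_of G u v \<le> a" for u v
  proof -
    have "card (arcs_from_to G u v) \<le> card (arcs G)"
      by (rule card_mono) (auto simp: arcs_from_to_def)
    then show ?thesis using arcs unfolding multiplicity_of_def by (rule le_trans)
  qed
  have aW: "a < 2 ^ W"
    unfolding a_def by (rule two_power_less_W) (simp add: N_def p_power_mono)
  have nN: "n \<le> N" using np p_le_N by linarith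
  \<comment> \<open>\<open>tc\<close> says something only about bounded initial states; here the
    cells hold 0, n and multiplicities, the latter at most \<open>a\<close>.\<close>
  have "bd W ?s"
    using m aW less_two_power_W[OF nN] by (auto simp: bd_def input_state_def intro: le_less_trans)
  moreover have "tc W (Main d) ?s main_steps (\<lambda>s'. reg s' 0 = hc ?A n)"
  proof (rule tc_Main)
    show "mem ?s (u * n + v) = ?A u v" if "u < n" "v < n" for u v
      unfolding input_state_def using two_dim_index[OF that] by simp
  qed (use m in \<open>auto simp: input_state_def\<close>)
  ultimately obtain t s' where "exec (Main d) ?s t s'" "t \<le> main_steps * ucost W" "reg s' 0 = hc ?A n"
    unfolding tc_def by auto
  then show ?thesis
    using num_hamiltonian_cycles_hc[OF G n] unfolding result_def by metis
qed

end

lemma exec_Main_empty: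
  assumes G: "fin_digraph G" "verts G = {}"
  shows "\<exists>t s. exec (Main d) (input_state 0 G) t s \<and> result s = num_hamiltonian_cycles G \<and> t \<le> len 0 + 2"
proof -
  let ?s = "input_state 0 G"
  have "exec (Main d) ?s (cost (Reg 0) ?s + 1 + 1) ?s"
    unfolding Main_def by (rule exec.CondFalse[OF _ exec.Skip]) (simp add: input_state_def)
  then show ?thesis
    using num_hamiltonian_cycles_empty[OF G]
    by (intro exI[of _ "cost (Reg 0) ?s + 1 + 1"] exI[of _ ?s]) (simp add: input_state_def result_def)
qed

theorem theorem2:
  fixes b :: "real poly"
  shows "\<exists>(P :: prog) (T :: nat \<Rightarrow> real).
    (\<exists>c>0. \<forall>\<^sub>F n in sequentially. T n \<le> 2 powr (real n - c * sqrt (real n / log 2 (real n)))) \<and>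
    (\<forall>n (G :: (nat, nat) pre_digraph).
       fin_digraph G \<and> verts G = {1..n} \<and> real (card (arcs G)) \<le> 2 powr poly b (real n) \<longrightarrow>
       (\<exists>t s. exec P (input_state n G) t s \<and> result s = num_hamiltonian_cycles G \<and> real t \<le> T n))"
proof -
  obtain d where d: "3 \<le> d" and b: "\<And>n::nat. poly b (real n) \<le> real ((n + 2) ^ d)"
    using poly_le_power[of b] by blast
  \<comment> \<open>These choices serve the bound T; the program depends on d alone and finds the
    values from n.\<close>
  obtain lg k where sp: "\<And>n. 1 \<le> n \<Longrightarrow> small_params n (2 ^ lg n) (lg n) d (k n)"
    using small_params_exist[OF _ d] by metis
  define T where "T n = (if n = 0 then real (len 0 + 2) else
    real (small_params.main_steps n (2 ^ lg n) d (k n) * ucost (params.W (2 ^ lg n) d)))" for n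
  define c where "c = 1 / (4 * sqrt (real (d + 8)))"
  have c: "0 < c" by (simp add: c_def)
  have E: "0 < 13 * real (d + 8)" by simp
  have "\<forall>\<^sub>F n in sequentially. T n \<le> 2 powr (real n - c * sqrt (real n / log 2 (real n)))"
    using eventually_saving[OF c E] eventually_table[OF c E] eventually_ge_at_top[of 4]
  proof eventually_elim
    case (elim n)
    then have n: "1 \<le> n" by simp
    show ?case
      using small_params.time_le[OF sp[OF n] elim(3), folded c_def, OF elim(1,2)] n by (simp add: T_def)
  qed
  moreover have "\<exists>t s. exec (Main d) (input_state n G) t s \<and> result s = num_hamiltonian_cycles G \<and> real t \<le> T n"
    if G: "fin_digraph G" "verts G = {1..n}" "real (card (arcs G)) \<le> 2 powr poly b (real n)"
    for n and G :: "(nat, nat) pre_digraph"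
  proof (cases "n = 0")
    case True
    then have "verts G = {}" using G(2) by simp
    then obtain t s where "exec (Main d) (input_state 0 G) t s" "result s = num_hamiltonian_cycles G" "t \<le> len 0 + 2"
      using exec_Main_empty[OF G(1), of d] by blast
    moreover have "T n = real (len 0 + 2)" using True by (simp add: T_def)
    ultimately show ?thesis unfolding True using of_nat_mono by metis
  next
    case False
    then have n: "1 \<le> n" by simp
    interpret small_params n "2 ^ lg n" "lg n" d "k n" by (rule sp[OF n])
    have "real (card (arcs G)) \<le> 2 powr real ((n + 2) ^ d)"
      using G(3) b[of n] by (meson order_trans powr_mono one_le_numeral)
    also have "2 powr real m = real (2 ^ m)" for m by (simp add: powr_realpow)
    finally have "card (arcs G) \<le> 2 ^ ((n + 2) ^ d)" by (simp only: of_nat_le_iff)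
    \<comment> \<open>The requirement n + 2 <= p enters here: it turns the bound on the arcs into
      \<open>a\<close>.\<close>
    also have "\<dots> \<le> a" unfolding a_def using np by (intro power_increasing power_mono) auto
    finally have "card (arcs G) \<le> a" .
    from exec_Main[OF G(1,2) this] obtain t s where "exec (Main d) (input_state n G) t s"
      "result s = num_hamiltonian_cycles G" "t \<le> main_steps * ucost W"
      by blast
    moreover have "T n = real (main_steps * ucost W)" using False by (simp add: T_def)
    ultimately show ?thesis using of_nat_mono by metis
  qed
  ultimately show ?thesis using c by blast
qed

end
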